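(* Let $\widehat{R}(T,X,Y,Z)\in \mathbb{C}[T, X, Y, Z]$ be a homogeneous polynomial defining a smooth surface $S \subset \mathbb{P}^3$, and assume that the divisors in $\mathbb{P}^3$ given by $\widehat{R}$ and its partial derivatives $\widehat{R}_T, \widehat{R}_X, \widehat{R}_Y, \widehat{R}_Z$ are in general position (i.e., any intersection of them has the expected codimension). Dehomogenizing with respect to $T=1$ yields an affine polynomial $R(x,y,z) \in \mathbb{C}[x,y,z]$ such that $S \cap \{T \neq 0\} = \{R=0\}$. For any weighted order $m$, every (global) invariant $2$-jet differential of weighted order $m$ on $S$, i.e. every element of $H^0(S,E_{2,m}T_S^* )$, admits, on $S \cap \{T \neq 0\} \cap \{R_z \neq 0\}$, the general expression \[ J_{yx} = \sum_{\substack{0 \leqslant k \leqslant \lfloor m/3 \rfloor \\ 0 \leqslant j \leqslant m-3k}} \frac{F_{j,k}}{R_z^{m-2k}}\, (y')^{j}\,(x')^{m-3k-j}\, \begin{vmatrix} y' & x' \\ y'' & x'' \end{vmatrix}^k, \] where $F_{j,k} \in \mathbb{C}[x,y,z]$ are polynomials, viewed as elements of the quotient ring $\mathbb{C}[x,y,z]/(R)$ (hence as regular functions on $S \cap \{T \neq 0\}$).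
   Context: Everything is over $\mathbb{C}$; $[T:X:Y:Z]$ are homogeneous coordinates on $\mathbb{P}^3$ and $(x,y,z)=(X/T,Y/T,Z/T)$. The surface is written $S$ here to distinguish it from the coordinate $X$. Subscripts on $R$ denote partial derivatives. On $S\cap\{R_z\neq0\}$, $(x,y)$ are local coordinates on $S$; primes denote derivatives along curve germs $\zeta\mapsto(x(\zeta),y(\zeta),z(\zeta))$ in $S$. $E_{2,m}T_S^*$ is the (Demailly--Semple) bundle of invariant $2$-jet differentials of weighted degree $m$: in local coordinates $(x_1,x_2)$ on $S$ its local sections are the expressions $\sum_{0\leqslant j\leqslant\lfloor m/3\rfloor}\sum_{\alpha_1+\alpha_2=m-3j}R_{\alpha_1,\alpha_2,j}(x_1,x_2)(x_1')^{\alpha_1}(x_2')^{\alpha_2}(x_1'x_2''-x_2'x_1'')^j$ with $R_{\alpha_1,\alpha_2,j}$ holomorphic. *)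

theory Defs
  imports "HOL-Complex_Analysis.Complex_Analysis" "HOL-Library.Poly_Mapping"
    "HOL-Library.Extended_Nat"
begin

text \<open>Polynomials over the complex numbers in variables indexed by the finite type \<open>'n\<close>:
  finitely supported maps from exponent vectors to coefficients. The ring structure is the
  convolution product of \<^theory>\<open>HOL-Library.Poly_Mapping\<close>.\<close>

type_synonym 'n cpoly = "('n \<Rightarrow>\<^sub>0 nat) \<Rightarrow>\<^sub>0 complex"

definition cpoly_eval :: "'n::finite cpoly \<Rightarrow> complex^'n \<Rightarrow> complex" where
  "cpoly_eval p v =
     (\<Sum>e\<in>Poly_Mapping.keys p. Poly_Mapping.lookup p e * (\<Prod>i\<in>UNIV. (v $ i) ^ Poly_Mapping.lookup e i))"

definition cpoly_const :: "complex \<Rightarrow> 'n cpoly" where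
  "cpoly_const c = Poly_Mapping.single 0 c"

definition cpoly_var :: "'n \<Rightarrow> 'n cpoly" where
  "cpoly_var i = Poly_Mapping.single (Poly_Mapping.single i 1) 1"

definition cpoly_subst :: "'n::finite cpoly \<Rightarrow> ('k cpoly)^'n \<Rightarrow> 'k cpoly" where
  "cpoly_subst p s =
     (\<Sum>e\<in>Poly_Mapping.keys p.
        cpoly_const (Poly_Mapping.lookup p e) * (\<Prod>i\<in>UNIV. (s $ i) ^ Poly_Mapping.lookup e i))"

definition cpoly_deriv :: "'n \<Rightarrow> 'n cpoly \<Rightarrow> 'n cpoly" where
  "cpoly_deriv i p =
     (\<Sum>e\<in>Poly_Mapping.keys p.
        Poly_Mapping.single (e - Poly_Mapping.single i 1)
          (of_nat (Poly_Mapping.lookup e i) * Poly_Mapping.lookup p e))"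

definition homogeneous :: "nat \<Rightarrow> 'n::finite cpoly \<Rightarrow> bool" where
  "homogeneous d p \<longleftrightarrow>
     (\<forall>e\<in>Poly_Mapping.keys p. (\<Sum>i\<in>UNIV. Poly_Mapping.lookup e i) = d)"

text \<open>Conventions: the homogeneous coordinates \<open>[T:X:Y:Z]\<close> are the components \<open>1, 2, 3, 4\<close> of a
  vector in \<open>complex^4\<close>, the affine coordinates \<open>(x, y, z)\<close> the components \<open>1, 2, 3\<close> of a vector
  in \<open>complex^3\<close>. A point of \<open>P\<^sup>3\<close> is given by a nonzero vector up to \<open>proj_eq\<close>, and a subset of
  \<open>P\<^sup>3\<close> by the set of all homogeneous coordinate vectors of its points (its cone without the
  origin).\<close>

definition proj_eq :: "complex^4 \<Rightarrow> complex^4 \<Rightarrow> bool" where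
  "proj_eq v w \<longleftrightarrow> (\<exists>c. c \<noteq> 0 \<and> w = c *s v)"

definition proj_zeros :: "4 cpoly set \<Rightarrow> (complex^4) set" where
  "proj_zeros A = {v. v \<noteq> 0 \<and> (\<forall>p\<in>A. cpoly_eval p v = 0)}"

definition affine_point :: "complex^3 \<Rightarrow> complex^4" where
  "affine_point q = vector [1, q $ 1, q $ 2, q $ 3]"

definition dehomogenize :: "4 cpoly \<Rightarrow> 3 cpoly" where
  "dehomogenize p = cpoly_subst p (vector [1, cpoly_var 1, cpoly_var 2, cpoly_var 3])"

text \<open>Smoothness of the scheme defined by a form (Jacobian criterion).\<close>

definition smooth_form :: "4 cpoly \<Rightarrow> bool" where
  "smooth_form P \<longleftrightarrow> (\<forall>v\<in>proj_zeros {P}. \<exists>i. cpoly_eval (cpoly_deriv i P) v \<noteq> 0)"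


definition proj_closed :: "(complex^4) set \<Rightarrow> bool" where
  "proj_closed V \<longleftrightarrow> (\<exists>A. (\<forall>p\<in>A. \<exists>d. homogeneous d p) \<and> V = proj_zeros A)"

definition proj_irreducible :: "(complex^4) set \<Rightarrow> bool" where
  "proj_irreducible V \<longleftrightarrow> V \<noteq> {} \<and>
     (\<forall>A B. proj_closed A \<and> proj_closed B \<and> V \<subseteq> A \<union> B \<longrightarrow> V \<subseteq> A \<or> V \<subseteq> B)"

text \<open>Krull dimension for the Zariski topology (only meaningful for nonempty \<open>V\<close>).\<close>

definition proj_dim :: "(complex^4) set \<Rightarrow> enat" where
  "proj_dim V = Sup {enat n | n. \<exists>C :: nat \<Rightarrow> (complex^4) set.
     (\<forall>i\<le>n. proj_closed (C i) \<and> proj_irreducible (C i) \<and> C i \<subseteq> V) \<and>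
     (\<forall>i<n. C i \<subset> C (Suc i))}"

text \<open>Every intersection of \<open>k\<close> of the divisors is empty or of codimension \<open>k\<close> in \<open>P\<^sup>3\<close>; hence it
  is empty for \<open>k \<ge> 4\<close>. The divisors form an indexed family: equal entries of the list count
  separately.\<close>

definition general_position :: "4 cpoly list \<Rightarrow> bool" where
  "general_position Ps \<longleftrightarrow>
     (\<forall>I. I \<noteq> {} \<and> I \<subseteq> {..<length Ps} \<longrightarrow>
        (let V = proj_zeros {Ps ! i | i. i \<in> I} in V = {} \<or> proj_dim V + enat (card I) = 3))"


text \<open>Complex differentiability in several variables: the real Frechet derivative exists and is
  complex linear.\<close>

definition holomorphic_vec :: "(complex^'n::finite \<Rightarrow> complex) \<Rightarrow> (complex^'n) set \<Rightarrow> bool" where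
  "holomorphic_vec f U \<longleftrightarrow>
     (\<forall>p\<in>U. \<exists>a :: complex^'n. (f has_derivative (\<lambda>h. \<Sum>i\<in>UNIV. a $ i * h $ i)) (at p))"

definition holomorphic_germ :: "(complex \<Rightarrow> complex^'n) \<Rightarrow> bool" where
  "holomorphic_germ c \<longleftrightarrow> (\<forall>i. (\<lambda>\<zeta>. c \<zeta> $ i) analytic_on {0})"

abbreviation jet1 :: "(complex \<Rightarrow> complex^'n) \<Rightarrow> 'n \<Rightarrow> complex" where
  "jet1 c i \<equiv> deriv (\<lambda>\<zeta>. c \<zeta> $ i) 0"

abbreviation jet2 :: "(complex \<Rightarrow> complex^'n) \<Rightarrow> 'n \<Rightarrow> complex" where
  "jet2 c i \<equiv> deriv (deriv (\<lambda>\<zeta>. c \<zeta> $ i)) 0"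

text \<open>A local holomorphic coordinate system on the surface \<open>P = 0\<close>, given by its inverse \<open>[\<phi>]\<close>, a
  holomorphic parametrization of an open part of the surface, together with a holomorphic lift
  \<open>\<phi>\<close> to homogeneous coordinates. The last two conditions say that \<open>[\<phi>]\<close> is injective and an
  immersion into \<open>P\<^sup>3\<close>: the tangent space of \<open>P\<^sup>3\<close> at \<open>[v]\<close> is the quotient of \<open>complex^4\<close> by
  the line through \<open>v\<close>.\<close>

definition surface_chart :: "4 cpoly \<Rightarrow> (complex^2) set \<Rightarrow> (complex^2 \<Rightarrow> complex^4) \<Rightarrow> bool" where
  "surface_chart P U \<phi> \<longleftrightarrow>
     open U \<and> (\<forall>i. holomorphic_vec (\<lambda>p. \<phi> p $ i) U) \<and> \<phi> ` U \<subseteq> proj_zeros {P} \<and>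
     (\<forall>p\<in>U. \<forall>q\<in>U. proj_eq (\<phi> p) (\<phi> q) \<longrightarrow> p = q) \<and>
     (\<forall>p\<in>U. \<forall>c h. c *s \<phi> p + frechet_derivative \<phi> (at p) h = 0 \<longrightarrow> c = 0 \<and> h = 0)"

definition local_jet_expression ::
  "nat \<Rightarrow> (nat \<Rightarrow> nat \<Rightarrow> nat \<Rightarrow> complex^2 \<Rightarrow> complex) \<Rightarrow> (complex \<Rightarrow> complex^2) \<Rightarrow> complex" where
  "local_jet_expression m R u =
     (\<Sum>j\<le>m div 3. \<Sum>(a, b)\<in>{(a, b). a + b = m - 3 * j}.
        R a b j (u 0) * jet1 u 1 ^ a * jet1 u 2 ^ b *
        (jet1 u 1 * jet2 u 2 - jet1 u 2 * jet2 u 1) ^ j)"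

text \<open>A global section of the bundle of invariant 2-jet differentials of weighted degree \<open>m\<close> is
  given as the function \<open>J\<close> it induces on germs at \<open>0\<close> of holomorphic curves in the surface, a germ
  being represented by any holomorphic lift \<open>\<gamma>\<close> to homogeneous coordinates. In every coordinate
  system, \<open>J\<close> must be of the local form with holomorphic coefficients; this includes that \<open>J \<gamma>\<close>
  depends only on the projective curve \<open>[\<gamma>]\<close>, and only on its 2-jet. Values of \<open>J\<close> on functions that
  do not represent a curve germ in the surface are irrelevant.\<close>

definition invariant_jet_differential ::
  "4 cpoly \<Rightarrow> nat \<Rightarrow> ((complex \<Rightarrow> complex^4) \<Rightarrow> complex) \<Rightarrow> bool" where
  "invariant_jet_differential P m J \<longleftrightarrow>
     (\<forall>U \<phi>. surface_chart P U \<phi> \<longrightarrow>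
        (\<exists>R. (\<forall>a b j. holomorphic_vec (R a b j) U) \<and>
           (\<forall>u \<gamma>. holomorphic_germ u \<and> u 0 \<in> U \<and> holomorphic_germ \<gamma> \<and>
                  (\<forall>\<^sub>F \<zeta> in nhds 0. proj_eq (\<phi> (u \<zeta>)) (\<gamma> \<zeta>)) \<longrightarrow>
                J \<gamma> = local_jet_expression m R u)))"

end

theory Submission
  imports Defs
begin

text \<open>
  Let \<open>P\<close> be the homogeneous equation and \<open>C\<close> its cone without the origin. Consider curve germs
  \<open>\<gamma>\<close> in \<open>C\<close> with \<open>T' = T'' = 0\<close>, \<open>X' = P\<^sub>Z \<xi>\<close>, \<open>Y' = P\<^sub>Z \<eta>\<close>, \<open>Z' = -(P\<^sub>X \<xi> + P\<^sub>Y \<eta>)\<close> and put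
  \<open>\<omega> = \<eta> X'' - \<xi> Y''\<close>. Differentiating \<open>P = 0\<close> twice shows that all \<open>2 \<times> 2\<close> minors of
  \<open>(\<gamma>', \<gamma>'')\<close> are polynomials in \<open>\<xi>, \<eta>, \<omega>\<close>, isobaric of weight 3 for the weights \<open>1, 1, 3\<close>. Hence in every chart
  \<open>J \<gamma>\<close> is an isobaric polynomial of weight \<open>m\<close> in \<open>\<xi>, \<eta>, \<omega>\<close> with holomorphic coefficients. By general position
  \<open>P\<^sub>X, P\<^sub>Y, P\<^sub>Z\<close> have no common zero on \<open>C\<close>, so there are enough such germs to make these
  coefficients unique; they are therefore defined on all of \<open>C\<close>, including \<open>P\<^sub>Z = 0\<close> and \<open>T = 0\<close>, and
  become homogeneous of degree \<open>(d - 1) (m - 2 k)\<close> after multiplication by \<open>T\<^bsup>m - k\<^esup>\<close>. In the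
  affine part \<open>\<xi> = x' / R\<^sub>z\<close>, \<open>\<eta> = y' / R\<^sub>z\<close> and \<open>\<omega> = (y' x'' - x' y'') / R\<^sub>z\<close>, which produces
  the denominators \<open>R\<^sub>z\<^bsup>m - 2 k\<^esup>\<close>.

  It remains to see that a homogeneous function \<open>g\<close> on \<open>C\<close> that extends locally to a holomorphic
  function is a polynomial on the affine part. Choose \<open>e\<close> with \<open>T e = 0\<close> and \<open>P e \<noteq> 0\<close>, and divide \<open>g\<close> by
  \<open>P (v + t e)\<close> as in Weierstrass division. The remainder \<open>A\<^sub>v(t)\<close>, a polynomial of degree less than \<open>d\<close>
  in \<open>t\<close>, is given locally by Cauchy integrals, hence holomorphic in \<open>v\<close>; by uniqueness it is homogeneous, hence
  of polynomial growth. So \<open>A\<^sub>v(0)\<close> is a polynomial in the affine coordinates, and it equals \<open>g v\<close> on \<open>C\<close>.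
\<close>

text \<open>The affine surface carries many holomorphic functions that are not polynomials, so the
  growth bound has to come from compactness. The coefficients must therefore be followed across T =
  0, which is why everything is lifted to the cone. Where T = 0 or P_Z = 0 the adapted germs reach
  only degenerate 2-jets of the surface. This does no harm, because only an identity of polynomials
  in \<open>\<xi>\<close>, \<open>\<eta>\<close>, \<open>\<omega>\<close> has to be recovered from
  values. The coefficients themselves scale with degree (d - 2)(m - 2k) - k, which may be negative.
  The power T^(m - k) raises the degree to at least 0 for every d >= 1, and it is invisible where T
  = 1. The remainder, unlike g, lives on an open part of C^4, namely at all v whose line v + t e
  misses the origin. Since T e = 0, this includes the whole space T = 1, where the remainder is
  entire in each of x, y, z. The origin is the one point of the affine cone at which smoothness of
  the surface gives no control.\<close>

no_notation fps_nth (infixl \<open>$\<close> 75)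

section \<open>Polynomials in several variables\<close>


lemma cpoly_eval_superset:
  assumes "finite A" "Poly_Mapping.keys p \<subseteq> A"
  shows "cpoly_eval p v = (\<Sum>e\<in>A. Poly_Mapping.lookup p e * (\<Prod>i\<in>UNIV. (v $ i) ^ Poly_Mapping.lookup e i))"
  unfolding cpoly_eval_def
  by (rule sum.mono_neutral_left) (use assms in \<open>auto simp: in_keys_iff\<close>)

lemma cpoly_eval_add: "cpoly_eval (p + q) v = cpoly_eval p v + cpoly_eval q v"
proof -
  let ?A = "Poly_Mapping.keys p \<union> Poly_Mapping.keys q"
  show ?thesis
    using Poly_Mapping.keys_add[of p q]
    by (subst (1 2 3) cpoly_eval_superset[of ?A])
       (auto simp: lookup_add ring_distribs sum.distrib)
qed

lemma cpoly_eval_0 [simp]: "cpoly_eval 0 v = 0"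
  by (simp add: cpoly_eval_def)

lemma cpoly_eval_sum: "cpoly_eval (sum f A) v = (\<Sum>x\<in>A. cpoly_eval (f x) v)"
  by (induction A rule: infinite_finite_induct) (auto simp: cpoly_eval_add)

lemma cpoly_eval_single:
  "cpoly_eval (Poly_Mapping.single e c) v = c * (\<Prod>i\<in>UNIV. (v $ i) ^ Poly_Mapping.lookup e i)"
  by (cases "c = 0") (auto simp: cpoly_eval_def)

lemma cpoly_as_sum:
  "(p :: 'n cpoly) = (\<Sum>e\<in>Poly_Mapping.keys p. Poly_Mapping.single e (Poly_Mapping.lookup p e))"
proof (rule poly_mapping_eqI)
  fix k
  have "(\<Sum>e\<in>Poly_Mapping.keys p. Poly_Mapping.lookup (Poly_Mapping.single e (Poly_Mapping.lookup p e)) k)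
      = (\<Sum>e\<in>Poly_Mapping.keys p. if e = k then Poly_Mapping.lookup p k else 0)"
    by (rule sum.cong) (auto simp: lookup_single)
  then show "Poly_Mapping.lookup p k =
      Poly_Mapping.lookup (\<Sum>e\<in>Poly_Mapping.keys p. Poly_Mapping.single e (Poly_Mapping.lookup p e)) k"
    by (simp add: lookup_sum in_keys_iff)
qed

lemma cpoly_eval_mult: "cpoly_eval (p * q) v = cpoly_eval p v * cpoly_eval q v"
proof -
  have "p * q = (\<Sum>e\<in>Poly_Mapping.keys p. \<Sum>f\<in>Poly_Mapping.keys q.
      Poly_Mapping.single (e + f) (Poly_Mapping.lookup p e * Poly_Mapping.lookup q f))"
    by (subst (1) cpoly_as_sum[of p], subst (1) cpoly_as_sum[of q])
       (simp add: sum_product mult_single)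
  also have "cpoly_eval \<dots> v = cpoly_eval p v * cpoly_eval q v"
    unfolding cpoly_eval_sum cpoly_eval_single
    by (simp add: cpoly_eval_def sum_product lookup_add power_add prod.distrib mult_ac)
  finally show ?thesis .
qed

lemma cpoly_eval_const [simp]: "cpoly_eval (cpoly_const c) v = c"
  by (simp add: cpoly_const_def cpoly_eval_single)

lemma cpoly_eval_1 [simp]: "cpoly_eval 1 v = 1"
  using cpoly_eval_const[of 1 v] by (simp add: cpoly_const_def)

lemma cpoly_eval_power: "cpoly_eval (p ^ n) v = cpoly_eval p v ^ n"
  by (induction n) (auto simp: cpoly_eval_mult)

lemma cpoly_eval_prod: "cpoly_eval (prod f A) v = (\<Prod>x\<in>A. cpoly_eval (f x) v)"
  by (induction A rule: infinite_finite_induct) (auto simp: cpoly_eval_mult)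

lemma prod_power_single:
  "(\<Prod>i\<in>UNIV. f i ^ Poly_Mapping.lookup (Poly_Mapping.single j n) i) = f j ^ n"
  for f :: "'n::finite \<Rightarrow> 'b::comm_monoid_mult"
proof -
  have "(\<Prod>i\<in>UNIV. f i ^ Poly_Mapping.lookup (Poly_Mapping.single j n) i) =
      (\<Prod>i\<in>UNIV. if i = j then f j ^ n else 1)"
    by (rule prod.cong) (auto simp: lookup_single when_def)
  then show ?thesis by simp
qed

lemma cpoly_eval_var [simp]: "cpoly_eval (cpoly_var i) v = v $ i"
  by (simp add: cpoly_var_def cpoly_eval_single prod_power_single)

lemma cpoly_eval_subst:
  "cpoly_eval (cpoly_subst p s) v = cpoly_eval p (\<chi> i. cpoly_eval (s $ i) v)"
  by (simp add: cpoly_subst_def cpoly_eval_sum cpoly_eval_mult cpoly_eval_prod cpoly_eval_power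
      cpoly_eval_def[of p])

lemma vector_4 [simp]:
  "(vector [x, y, z, w] :: 'a::zero^4) $ 1 = x"
  "(vector [x, y, z, w] :: 'a::zero^4) $ 2 = y"
  "(vector [x, y, z, w] :: 'a::zero^4) $ 3 = z"
  "(vector [x, y, z, w] :: 'a::zero^4) $ 4 = w"
  unfolding vector_def by simp_all

lemma affine_point_nth [simp]:
  "affine_point q $ 1 = 1" "affine_point q $ 2 = q $ 1"
  "affine_point q $ 3 = q $ 2" "affine_point q $ 4 = q $ 3"
  by (simp_all add: affine_point_def)

lemma cpoly_eval_dehomogenize: "cpoly_eval (dehomogenize p) q = cpoly_eval p (affine_point q)"
proof -
  have "(\<chi> i. cpoly_eval ((vector [1, cpoly_var 1, cpoly_var 2, cpoly_var 3] :: (3 cpoly)^4) $ i) q)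
      = affine_point q"
    by (simp add: vec_eq_iff forall_4)
  then show ?thesis
    by (simp add: dehomogenize_def cpoly_eval_subst)
qed

lemma has_derivative_cpoly_eval:
  fixes v :: "complex^'n::finite"
  shows "(cpoly_eval p has_derivative (\<lambda>h. \<Sum>i\<in>UNIV. cpoly_eval (cpoly_deriv i p) v * h $ i)) (at v within S)"
proof -
  have mono: "((\<lambda>v. \<Prod>i\<in>UNIV. (v $ i) ^ Poly_Mapping.lookup e i) has_derivative
      (\<lambda>h. \<Sum>i\<in>UNIV. of_nat (Poly_Mapping.lookup e i) *
          (\<Prod>j\<in>UNIV. (v $ j) ^ Poly_Mapping.lookup (e - Poly_Mapping.single i 1) j) * h $ i)) (at v within S)"
    for e :: "'n \<Rightarrow>\<^sub>0 nat"
  proof -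
    have "((\<lambda>v. \<Prod>i\<in>UNIV. (v $ i) ^ Poly_Mapping.lookup e i) has_derivative
       (\<lambda>h. \<Sum>i\<in>UNIV. (of_nat (Poly_Mapping.lookup e i) * h $ i * (v $ i) ^ (Poly_Mapping.lookup e i - 1))
         * (\<Prod>j\<in>UNIV - {i}. (v $ j) ^ Poly_Mapping.lookup e j))) (at v within S)"
      by (intro has_derivative_prod has_derivative_power bounded_linear.has_derivative[OF bounded_linear_vec_nth] has_derivative_ident)
    moreover have "(of_nat (Poly_Mapping.lookup e i) * h $ i * (v $ i) ^ (Poly_Mapping.lookup e i - 1))
         * (\<Prod>j\<in>UNIV - {i}. (v $ j) ^ Poly_Mapping.lookup e j) =
        of_nat (Poly_Mapping.lookup e i) *
          (\<Prod>j\<in>UNIV. (v $ j) ^ Poly_Mapping.lookup (e - Poly_Mapping.single i 1) j) * h $ i" for h :: "complex^'n" and i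
    proof -
      have "(\<Prod>j\<in>UNIV. (v $ j) ^ Poly_Mapping.lookup (e - Poly_Mapping.single i 1) j) =
        (v $ i) ^ Poly_Mapping.lookup (e - Poly_Mapping.single i 1) i *
        (\<Prod>j\<in>UNIV - {i}. (v $ j) ^ Poly_Mapping.lookup (e - Poly_Mapping.single i 1) j)"
        by (subst prod.remove[of UNIV i]) auto
      \<comment> \<open>Exponents are subtracted with truncation in \<open>cpoly_deriv\<close> and
        in the power rule alike, so exponent 0 requires no separate case: its term carries the
        factor 0.\<close>
      also have "\<dots> = (v $ i) ^ (Poly_Mapping.lookup e i - 1) *
        (\<Prod>j\<in>UNIV - {i}. (v $ j) ^ Poly_Mapping.lookup e j)"
        by (intro arg_cong2[of _ _ _ _ "(*)"] prod.cong) (auto simp: lookup_minus lookup_single)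
      finally show ?thesis by simp
    qed
    ultimately show ?thesis by (simp only:)
  qed
  have "((\<lambda>v. \<Sum>e\<in>Poly_Mapping.keys p. Poly_Mapping.lookup p e * (\<Prod>i\<in>UNIV. (v $ i) ^ Poly_Mapping.lookup e i))
     has_derivative (\<lambda>h. \<Sum>e\<in>Poly_Mapping.keys p. Poly_Mapping.lookup p e * (\<Sum>i\<in>UNIV. of_nat (Poly_Mapping.lookup e i) *
          (\<Prod>j\<in>UNIV. (v $ j) ^ Poly_Mapping.lookup (e - Poly_Mapping.single i 1) j) * h $ i))) (at v within S)"
    by (intro has_derivative_sum has_derivative_mult_right mono)
  moreover have "(\<Sum>e\<in>Poly_Mapping.keys p. Poly_Mapping.lookup p e * (\<Sum>i\<in>UNIV. of_nat (Poly_Mapping.lookup e i) *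
          (\<Prod>j\<in>UNIV. (v $ j) ^ Poly_Mapping.lookup (e - Poly_Mapping.single i 1) j) * h $ i)) =
      (\<Sum>i\<in>UNIV. cpoly_eval (cpoly_deriv i p) v * h $ i)" for h :: "complex^'n"
    by (simp add: cpoly_deriv_def cpoly_eval_sum cpoly_eval_single sum_distrib_left sum_distrib_right mult_ac)
       (subst sum.swap, simp)
  ultimately show ?thesis
    by (simp add: cpoly_eval_def[of p, abs_def])
qed

lemma has_derivative_vecI:
  fixes f :: "'a::real_normed_vector \<Rightarrow> 'b::euclidean_space^'n::finite"
  assumes "\<And>i. ((\<lambda>x. f x $ i) has_derivative (\<lambda>h. f' h $ i)) (at x within S)"
  shows "(f has_derivative f') (at x within S)"
proof -
  have "((\<lambda>x. f x \<bullet> b) has_derivative (\<lambda>h. f' h \<bullet> b)) (at x within S)" if "b \<in> Basis" for b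
  proof -
    from that obtain i u where b: "b = axis i u" "u \<in> Basis"
      by (auto simp: Basis_vec_def)
    show ?thesis unfolding b
      using has_derivative_inner_left[OF assms[of i], of u] by (simp add: inner_axis)
  qed
  then show ?thesis
    by (subst has_derivative_componentwise_within) auto
qed

text \<open>Identities between partial derivatives are obtained below by differentiating one
  function of \<open>\<zeta>\<close> in two ways and comparing. The formal definition of
  \<open>cpoly_deriv\<close> then enters only through
  \<open>has_derivative_cpoly_eval\<close>.\<close>

lemma cpoly_eval_chain:
  assumes "\<And>i. ((\<lambda>\<zeta>. \<gamma> \<zeta> $ i) has_field_derivative \<gamma>' i) (at z)"
  shows "((\<lambda>\<zeta>. cpoly_eval p (\<gamma> \<zeta>)) has_field_derivative
      (\<Sum>i\<in>UNIV. cpoly_eval (cpoly_deriv i p) (\<gamma> z) * \<gamma>' i)) (at z)"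
proof -
  have "(\<gamma> has_derivative (\<lambda>h. \<chi> i. \<gamma>' i * h)) (at z)"
    using assms by (intro has_derivative_vecI) (auto simp: has_field_derivative_def)
  from has_derivative_compose[OF this has_derivative_cpoly_eval]
  have "((\<lambda>\<zeta>. cpoly_eval p (\<gamma> \<zeta>)) has_derivative
     (\<lambda>h. \<Sum>i\<in>UNIV. cpoly_eval (cpoly_deriv i p) (\<gamma> z) * (\<gamma>' i * h))) (at z)"
    by simp
  moreover have "(\<Sum>i\<in>UNIV. cpoly_eval (cpoly_deriv i p) (\<gamma> z) * (\<gamma>' i * h)) =
      (\<Sum>i\<in>UNIV. cpoly_eval (cpoly_deriv i p) (\<gamma> z) * \<gamma>' i) * h" for h
    unfolding sum_distrib_right by (intro sum.cong refl) (simp add: mult_ac)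
  ultimately show ?thesis
    by (simp add: has_field_derivative_def)
qed

lemma cpoly_deriv_dehomogenize:
  "cpoly_eval (cpoly_deriv 3 (dehomogenize p)) q = cpoly_eval (cpoly_deriv 4 p) (affine_point q)"
proof -
  have 1: "((\<lambda>\<zeta>. cpoly_eval (dehomogenize p) (q + \<zeta> *s axis 3 1)) has_field_derivative
     (\<Sum>i\<in>UNIV. cpoly_eval (cpoly_deriv i (dehomogenize p)) (q + 0 *s axis 3 1) * (if i = 3 then 1 else 0))) (at 0)"
    by (rule cpoly_eval_chain) (auto intro!: derivative_eq_intros simp: axis_def)
  have 2: "((\<lambda>\<zeta>. cpoly_eval p (affine_point q + \<zeta> *s axis 4 1)) has_field_derivative
     (\<Sum>i\<in>UNIV. cpoly_eval (cpoly_deriv i p) (affine_point q + 0 *s axis 4 1) * (if i = 4 then 1 else 0))) (at 0)"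
    by (rule cpoly_eval_chain) (auto intro!: derivative_eq_intros simp: axis_def)
  have "affine_point (q + \<zeta> *s axis 3 1) = affine_point q + \<zeta> *s axis 4 1" for \<zeta>
    by (simp add: vec_eq_iff forall_4 axis_def)
  with 2 have 3: "((\<lambda>\<zeta>. cpoly_eval (dehomogenize p) (q + \<zeta> *s axis 3 1)) has_field_derivative
     (\<Sum>i\<in>UNIV. cpoly_eval (cpoly_deriv i p) (affine_point q + 0 *s axis 4 1) * (if i = 4 then 1 else 0))) (at 0)"
    by (simp add: cpoly_eval_dehomogenize)
  from DERIV_unique[OF 1 3] show ?thesis
    by (simp add: if_distrib cong: if_cong)
qed

lemma cpoly_eval_scale:
  assumes "homogeneous d p"
  shows "cpoly_eval p (c *s v) = c ^ d * cpoly_eval p v"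
proof -
  have "(\<Prod>i\<in>UNIV. c ^ Poly_Mapping.lookup e i) = c ^ d" if "e \<in> Poly_Mapping.keys p" for e
    using assms that by (simp add: homogeneous_def flip: power_sum)
  then show ?thesis
    by (simp add: cpoly_eval_def power_mult_distrib prod.distrib sum_distrib_left mult_ac)
qed

text \<open>Differentiate P(c (v + t e_i)) = c^d P(v + t e_i) at t = 0. The left side produces an
  extra factor c, which is cancelled.\<close>

lemma cpoly_deriv_scale:
  assumes "homogeneous d p" "d \<ge> 1" "c \<noteq> 0"
  shows "cpoly_eval (cpoly_deriv i p) (c *s v) = c ^ (d - 1) * cpoly_eval (cpoly_deriv i p) v"
proof -
  have 1: "((\<lambda>\<zeta>. cpoly_eval p (c *s (v + \<zeta> *s axis i 1))) has_field_derivative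
     (\<Sum>j\<in>UNIV. cpoly_eval (cpoly_deriv j p) (c *s (v + 0 *s axis i 1)) * (if j = i then c else 0))) (at 0)"
    by (rule cpoly_eval_chain) (auto intro!: derivative_eq_intros simp: axis_def)
  have 2: "((\<lambda>\<zeta>. cpoly_eval p (v + \<zeta> *s axis i 1)) has_field_derivative
     (\<Sum>j\<in>UNIV. cpoly_eval (cpoly_deriv j p) (v + 0 *s axis i 1) * (if j = i then 1 else 0))) (at 0)"
    by (rule cpoly_eval_chain) (auto intro!: derivative_eq_intros simp: axis_def)
  from DERIV_unique[OF 1[unfolded cpoly_eval_scale[OF assms(1)]] DERIV_cmult[OF 2, of "c ^ d"]]
  have "cpoly_eval (cpoly_deriv i p) (c *s v) * c = c ^ d * cpoly_eval (cpoly_deriv i p) v"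
    by (simp add: if_distrib cong: if_cong)
  also have "c ^ d = c ^ (d - 1) * c"
    using assms(2) by (cases d) auto
  finally show ?thesis using assms(3) by simp
qed

lemma euler_relation:
  assumes "homogeneous d p"
  shows "(\<Sum>i\<in>UNIV. cpoly_eval (cpoly_deriv i p) v * v $ i) = of_nat d * cpoly_eval p v"
proof -
  have 1: "((\<lambda>\<zeta>. cpoly_eval p (\<zeta> *s v)) has_field_derivative
     (\<Sum>j\<in>UNIV. cpoly_eval (cpoly_deriv j p) (1 *s v) * v $ j)) (at 1)"
    by (rule cpoly_eval_chain) (auto intro!: derivative_eq_intros)
  have 2: "((\<lambda>\<zeta>. \<zeta> ^ d * cpoly_eval p v) has_field_derivative of_nat d * cpoly_eval p v) (at 1)"
    by (auto intro!: derivative_eq_intros)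
  from DERIV_unique[OF 1[unfolded cpoly_eval_scale[OF assms]] 2] show ?thesis by simp
qed

section \<open>Holomorphic functions of several variables\<close>

lemma complex_linear_vec_expand:
  fixes f' :: "complex^'n::finite \<Rightarrow> complex"
  assumes "linear f'" "\<And>c h. f' (c *s h) = c * f' h"
  shows "f' h = (\<Sum>i\<in>UNIV. f' (axis i 1) * h $ i)"
proof -
  have "f' h = f' (\<Sum>i\<in>UNIV. h $ i *s axis i 1)"
    by (simp add: basis_expansion)
  also have "\<dots> = (\<Sum>i\<in>UNIV. f' (axis i 1) * h $ i)"
    by (simp add: linear_sum[OF assms(1)] assms(2) mult.commute)
  finally show ?thesis .
qed

text \<open>Complex homogeneity of the derivative passes through products, quotients and
  compositions more easily than the explicit gradient of the definition; the gradient is read off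
  from the basis vectors.\<close>

lemma holomorphic_vecI:
  assumes "\<And>p. p \<in> U \<Longrightarrow> \<exists>f'. (f has_derivative f') (at p) \<and> (\<forall>c h. f' (c *s h) = c * f' h)"
  shows "holomorphic_vec f U"
  unfolding holomorphic_vec_def
proof
  fix p assume "p \<in> U"
  then obtain f' where f': "(f has_derivative f') (at p)" "\<And>c h. f' (c *s h) = c * f' h"
    using assms by blast
  define a where "a = (\<chi> i. f' (axis i 1))"
  have "f' = (\<lambda>h. \<Sum>i\<in>UNIV. a $ i * h $ i)"
    unfolding a_def vec_lambda_beta
    by (rule ext, rule complex_linear_vec_expand[OF has_derivative_linear[OF f'(1)] f'(2)])
  from f'(1)[unfolded this] show "\<exists>a. (f has_derivative (\<lambda>h. \<Sum>i\<in>UNIV. a $ i * h $ i)) (at p)" ..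
qed

lemma holomorphic_vecE:
  assumes "holomorphic_vec f U" "p \<in> U"
  obtains f' where "(f has_derivative f') (at p)" "\<And>c h. f' (c *s h) = c * f' h"
proof -
  obtain a where "(f has_derivative (\<lambda>h. \<Sum>i\<in>UNIV. a $ i * h $ i)) (at p)"
    using assms by (auto simp: holomorphic_vec_def)
  then show thesis by (rule that) (simp add: sum_distrib_left mult_ac)
qed

named_theorems hol_intros

lemma holomorphic_vec_subset: "holomorphic_vec f U \<Longrightarrow> V \<subseteq> U \<Longrightarrow> holomorphic_vec f V"
  by (auto simp: holomorphic_vec_def)

lemma holomorphic_vec_const [hol_intros]: "holomorphic_vec (\<lambda>_. c) U"
  by (rule holomorphic_vecI) (auto intro!: exI[of _ "\<lambda>_. 0"])

lemma holomorphic_vec_nth [hol_intros]: "holomorphic_vec (\<lambda>v. v $ i) U"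
  for U :: "(complex^'n::finite) set"
proof (rule holomorphic_vecI)
  fix p :: "complex^'n"
  show "\<exists>f'. ((\<lambda>v. v $ i) has_derivative f') (at p) \<and> (\<forall>c h. f' (c *s h) = c * f' h)"
    by (rule exI[of _ "\<lambda>h. h $ i"])
      (auto intro: bounded_linear_imp_has_derivative[OF bounded_linear_vec_nth])
qed

lemma holomorphic_vec_add [hol_intros]:
  assumes "holomorphic_vec f U" "holomorphic_vec g U"
  shows "holomorphic_vec (\<lambda>v. f v + g v) U"
proof (rule holomorphic_vecI)
  fix p assume p: "p \<in> U"
  obtain f' where f': "(f has_derivative f') (at p)" "\<And>c h. f' (c *s h) = c * f' h"
    using assms(1) p by (rule holomorphic_vecE) blast
  obtain g' where g': "(g has_derivative g') (at p)" "\<And>c h. g' (c *s h) = c * g' h"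
    using assms(2) p by (rule holomorphic_vecE) blast
  show "\<exists>k. ((\<lambda>v. f v + g v) has_derivative k) (at p) \<and> (\<forall>c h. k (c *s h) = c * k h)"
    by (rule exI[of _ "\<lambda>h. f' h + g' h"]) (auto intro!: has_derivative_add f' g' simp: f' g' ring_distribs)
qed

lemma holomorphic_vec_mult [hol_intros]:
  assumes "holomorphic_vec f U" "holomorphic_vec g U"
  shows "holomorphic_vec (\<lambda>v. f v * g v) U"
proof (rule holomorphic_vecI)
  fix p assume p: "p \<in> U"
  obtain f' where f': "(f has_derivative f') (at p)" "\<And>c h. f' (c *s h) = c * f' h"
    using assms(1) p by (rule holomorphic_vecE) blast
  obtain g' where g': "(g has_derivative g') (at p)" "\<And>c h. g' (c *s h) = c * g' h"
    using assms(2) p by (rule holomorphic_vecE) blast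
  show "\<exists>k. ((\<lambda>v. f v * g v) has_derivative k) (at p) \<and> (\<forall>c h. k (c *s h) = c * k h)"
    by (rule exI[of _ "\<lambda>h. f p * g' h + f' h * g p"])
       (auto intro!: has_derivative_mult f' g' simp: f' g' ring_distribs mult_ac)
qed

lemma holomorphic_vec_inverse [hol_intros]:
  assumes "holomorphic_vec f U" "\<And>v. v \<in> U \<Longrightarrow> f v \<noteq> 0"
  shows "holomorphic_vec (\<lambda>v. inverse (f v)) U"
proof (rule holomorphic_vecI)
  fix p assume p: "p \<in> U"
  obtain f' where f': "(f has_derivative f') (at p)" "\<And>c h. f' (c *s h) = c * f' h"
    using assms(1) p by (rule holomorphic_vecE) blast
  show "\<exists>k. ((\<lambda>v. inverse (f v)) has_derivative k) (at p) \<and> (\<forall>c h. k (c *s h) = c * k h)"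
    by (rule exI[of _ "\<lambda>h. - (inverse (f p) * f' h * inverse (f p))"])
       (use Deriv.has_derivative_inverse[OF assms(2)[OF p] f'(1)] in \<open>auto simp: f' mult_ac\<close>)
qed

lemma holomorphic_vec_divide [hol_intros]:
  assumes "holomorphic_vec f U" "holomorphic_vec g U" "\<And>v. v \<in> U \<Longrightarrow> g v \<noteq> 0"
  shows "holomorphic_vec (\<lambda>v. f v / g v) U"
  using holomorphic_vec_mult[OF assms(1) holomorphic_vec_inverse[OF assms(2,3)]]
  by (simp add: divide_inverse)

lemma holomorphic_vec_uminus [hol_intros]:
  "holomorphic_vec f U \<Longrightarrow> holomorphic_vec (\<lambda>v. - f v) U"
  using holomorphic_vec_mult[OF holomorphic_vec_const[of "-1"]] by simp

lemma holomorphic_vec_diff [hol_intros]: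
  "holomorphic_vec f U \<Longrightarrow> holomorphic_vec g U \<Longrightarrow> holomorphic_vec (\<lambda>v. f v - g v) U"
  using holomorphic_vec_add[OF _ holomorphic_vec_uminus, of f U g] by simp

lemma holomorphic_vec_sum [hol_intros]:
  "(\<And>i. i \<in> A \<Longrightarrow> holomorphic_vec (f i) U) \<Longrightarrow> holomorphic_vec (\<lambda>v. \<Sum>i\<in>A. f i v) U"
  by (induction A rule: infinite_finite_induct) (auto intro!: hol_intros)

lemma holomorphic_vec_power [hol_intros]:
  "holomorphic_vec f U \<Longrightarrow> holomorphic_vec (\<lambda>v. f v ^ n) U"
  by (induction n) (auto intro!: hol_intros)

lemma holomorphic_vec_cpoly_eval [hol_intros]: "holomorphic_vec (cpoly_eval p) U"
  by (rule holomorphic_vecI)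
     (rule exI, rule conjI, rule has_derivative_cpoly_eval, simp add: sum_distrib_left mult_ac)

lemma holomorphic_vec_compose:
  fixes g :: "complex^'n::finite \<Rightarrow> complex^'k::finite"
  assumes "holomorphic_vec f U" "\<And>i. holomorphic_vec (\<lambda>v. g v $ i) W" "g ` W \<subseteq> U"
  shows "holomorphic_vec (\<lambda>v. f (g v)) W"
proof (rule holomorphic_vecI)
  fix p assume p: "p \<in> W"
  have "\<forall>i. \<exists>g'. ((\<lambda>v. g v $ i) has_derivative g') (at p) \<and> (\<forall>c h. g' (c *s h) = c * g' h)"
    using assms(2) p by (meson holomorphic_vecE)
  then obtain g' where g': "\<And>i. ((\<lambda>v. g v $ i) has_derivative g' i) (at p)"
    "\<And>i c h. g' i (c *s h) = c * g' i h" by metis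
  have G: "(g has_derivative (\<lambda>h. \<chi> i. g' i h)) (at p)"
    by (rule has_derivative_vecI) (simp add: g')
  obtain f' where f': "(f has_derivative f') (at (g p))" "\<And>c h. f' (c *s h) = c * f' h"
    using assms(1,3) p by (meson holomorphic_vecE image_subset_iff)
  have "(\<chi> i. g' i (c *s h)) = c *s (\<chi> i. g' i h)" for c h
    by (simp add: vec_eq_iff g')
  then show "\<exists>k. ((\<lambda>v. f (g v)) has_derivative k) (at p) \<and> (\<forall>c h. k (c *s h) = c * k h)"
    using has_derivative_compose[OF G f'(1)] f'(2) by (intro exI conjI) auto
qed

lemma holomorphic_vec_continuous_on: "holomorphic_vec f U \<Longrightarrow> continuous_on U f"
  by (metis continuous_at_imp_continuous_on has_derivative_continuous holomorphic_vecE)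

lemma holomorphic_vec_line:
  assumes "holomorphic_vec f U"
  shows "(\<lambda>\<zeta>. f (v + \<zeta> *s h)) holomorphic_on {\<zeta>. v + \<zeta> *s h \<in> U}"
proof (rule holomorphic_onI)
  fix z assume z: "z \<in> {\<zeta>. v + \<zeta> *s h \<in> U}"
  then obtain f' where f': "(f has_derivative f') (at (v + z *s h))" "\<And>c h. f' (c *s h) = c * f' h"
    using assms by (auto elim: holomorphic_vecE)
  have "((\<lambda>\<zeta>. v + \<zeta> *s h) has_derivative (\<lambda>k. k *s h)) (at z)"
    by (rule has_derivative_vecI) (auto intro!: derivative_eq_intros)
  from has_derivative_compose[OF this f'(1)]
  have "((\<lambda>\<zeta>. f (v + \<zeta> *s h)) has_field_derivative f' h) (at z)"
    by (simp add: f'(2) has_field_derivative_def mult.commute[of _ "f' h"])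
  then show "(\<lambda>\<zeta>. f (v + \<zeta> *s h)) field_differentiable at z within {\<zeta>. v + \<zeta> *s h \<in> U}"
    by (meson field_differentiable_at_within field_differentiable_def)
qed

lemma continuous_on_line [continuous_intros]:
  fixes h :: "'b::topological_space \<Rightarrow> complex^'n::finite"
  assumes "continuous_on A f" "continuous_on A h"
  shows "continuous_on A (\<lambda>x. f x *s h x)"
proof -
  have "continuous_on A (\<lambda>x. \<chi> i. f x * h x $ i)"
    by (intro continuous_intros assms)
  then show ?thesis by (simp add: vector_scalar_mult_def)
qed

lemma norm_vector_scalar_mult: "norm (c *s v) = norm c * norm v"
  for v :: "complex^'n::finite"
  by (simp add: norm_vec_def norm_mult L2_set_right_distrib)

section \<open>Contour integrals depending on a parameter\<close>

lemma continuous_on_contour_integral_param: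
  assumes cont: "continuous_on (U \<times> path_image g) (\<lambda>(\<zeta>, w). f \<zeta> w)"
    and g: "continuous_on {0..1} g" "continuous_on {0..1} (\<lambda>t. vector_derivative g (at t))"
  shows "continuous_on U (\<lambda>\<zeta>. contour_integral g (f \<zeta>))"
proof -
  have "continuous_on (U \<times> cbox 0 1) ((\<lambda>(\<zeta>, w). f \<zeta> w) \<circ> (\<lambda>p. (fst p, g (snd p))))"
  proof (rule continuous_on_compose[OF _ continuous_on_subset[OF cont]])
    show "continuous_on (U \<times> cbox 0 1) (\<lambda>p. (fst p, g (snd p)))"
      by (intro continuous_intros continuous_on_compose2[OF g(1)]) auto
    show "(\<lambda>p. (fst p, g (snd p))) ` (U \<times> cbox 0 1) \<subseteq> U \<times> path_image g"
      by (auto simp: path_image_def)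
  qed
  moreover have "continuous_on (U \<times> cbox 0 1) (\<lambda>p. vector_derivative g (at (snd p)))"
    by (intro continuous_intros continuous_on_compose2[OF g(2)]) auto
  ultimately have "continuous_on (U \<times> cbox 0 1) (\<lambda>(\<zeta>, t). f \<zeta> (g t) * vector_derivative g (at t))"
    by (auto simp: case_prod_unfold o_def intro: continuous_on_mult)
  from integral_continuous_on_param[OF this] show ?thesis
    by (simp add: contour_integral_integral)
qed

text \<open>By Morera it suffices to integrate over triangles. Joint continuity allows the two
  integrations to be exchanged, and the inner integral over the triangle then vanishes by Cauchy's
  theorem for each fixed w.\<close>

lemma holomorphic_contour_parameter:
  assumes "open U"
    and cont: "continuous_on (U \<times> path_image (circlepath z r)) (\<lambda>(\<zeta>, w). f \<zeta> w)"
    and hol: "\<And>w. w \<in> path_image (circlepath z r) \<Longrightarrow> (\<lambda>\<zeta>. f \<zeta> w) holomorphic_on U"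
  shows "(\<lambda>\<zeta>. contour_integral (circlepath z r) (f \<zeta>)) holomorphic_on U"
proof -
  let ?g = "circlepath z r"
  have vd: "continuous_on {0..1} (\<lambda>t. vector_derivative (circlepath z r) (at t))"
    unfolding vector_derivative_circlepath by (intro continuous_intros)
  have cg: "continuous_on {0..1} ?g"
    using path_circlepath unfolding path_def .
  have cont1: "continuous_on U (\<lambda>\<zeta>. contour_integral ?g (f \<zeta>))"
    by (rule continuous_on_contour_integral_param[OF cont cg vd])
  have "(\<lambda>\<zeta>. contour_integral ?g (f \<zeta>)) analytic_on U"
  proof (rule Morera_triangle[OF cont1 \<open>open U\<close>], intro allI impI)
    fix a b c assume sub: "convex hull {a, b, c} \<subseteq> U"
    have sw: "contour_integral (linepath x y) (\<lambda>\<zeta>. contour_integral ?g (f \<zeta>))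
        = contour_integral ?g (\<lambda>w. contour_integral (linepath x y) (\<lambda>\<zeta>. f \<zeta> w))"
      if "closed_segment x y \<subseteq> U" for x y
    proof (rule contour_integral_swap)
      show "continuous_on (path_image (linepath x y) \<times> path_image ?g) (\<lambda>(\<zeta>, w). f \<zeta> w)"
        using that by (intro continuous_on_subset[OF cont] Sigma_mono) auto
    qed (auto simp: vector_derivative_linepath_at vd)
    have int: "(\<lambda>w. contour_integral (linepath x y) (\<lambda>\<zeta>. f \<zeta> w)) contour_integrable_on ?g"
      if "closed_segment x y \<subseteq> U" for x y
    proof (rule contour_integrable_continuous_circlepath)
      have "continuous_on (path_image ?g \<times> path_image (linepath x y)) (\<lambda>(w, \<zeta>). f \<zeta> w)"
      proof -
        have "continuous_on (path_image ?g \<times> path_image (linepath x y)) ((\<lambda>(\<zeta>, w). f \<zeta> w) \<circ> prod.swap)"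
          by (rule continuous_on_compose[OF continuous_on_swap continuous_on_subset[OF cont]])
             (use that in auto)
        then show ?thesis by (simp add: o_def case_prod_unfold)
      qed
      then show "continuous_on (path_image ?g) (\<lambda>w. contour_integral (linepath x y) (\<lambda>\<zeta>. f \<zeta> w))"
        by (rule continuous_on_contour_integral_param)
           (auto simp: vector_derivative_linepath_at continuous_on_linepath)
    qed
    have segs: "closed_segment a b \<subseteq> U" "closed_segment b c \<subseteq> U" "closed_segment c a \<subseteq> U"
      by (rule order_trans[OF _ sub], rule segments_subset_convex_hull)+
    have inner: "contour_integral (linepath a b) (\<lambda>\<zeta>. f \<zeta> w) + contour_integral (linepath b c) (\<lambda>\<zeta>. f \<zeta> w) +
        contour_integral (linepath c a) (\<lambda>\<zeta>. f \<zeta> w) = 0" if "w \<in> path_image ?g" for w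
    proof -
      have h: "(\<lambda>\<zeta>. f \<zeta> w) holomorphic_on convex hull {a, b, c}"
        by (rule holomorphic_on_subset[OF hol[OF that] sub])
      have "((\<lambda>\<zeta>. f \<zeta> w) has_contour_integral 0) (linepath a b +++ linepath b c +++ linepath c a)"
        by (rule Cauchy_theorem_triangle[OF h])
      from has_chain_integral_chain_integral3[OF this] show ?thesis .
    qed
    show "contour_integral (linepath a b) (\<lambda>\<zeta>. contour_integral ?g (f \<zeta>)) +
       contour_integral (linepath b c) (\<lambda>\<zeta>. contour_integral ?g (f \<zeta>)) +
       contour_integral (linepath c a) (\<lambda>\<zeta>. contour_integral ?g (f \<zeta>)) = 0"
      unfolding sw[OF segs(1)] sw[OF segs(2)] sw[OF segs(3)]
      using contour_integral_eq_0[of ?g "\<lambda>w. contour_integral (linepath a b) (\<lambda>\<zeta>. f \<zeta> w) +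
        contour_integral (linepath b c) (\<lambda>\<zeta>. f \<zeta> w) + contour_integral (linepath c a) (\<lambda>\<zeta>. f \<zeta> w)"]
        inner int[OF segs(1)] int[OF segs(2)] int[OF segs(3)]
      by (simp add: contour_integral_add contour_integrable_add del: path_image_circlepath)
  qed
  then show ?thesis using analytic_imp_holomorphic by blast
qed

section \<open>Polynomials in one variable and growth\<close>

text \<open>Lagrange interpolation at the nodes 0, ..., N. The weights \<open>L\<close> depend on N
  alone, so the formula can be applied uniformly to a family of polynomials.\<close>

lemma coeff_interpolation:
  obtains L :: "nat \<Rightarrow> nat \<Rightarrow> complex" where
    "\<And>p i. degree p \<le> N \<Longrightarrow> coeff p i = (\<Sum>s\<le>N. L i s * poly p (of_nat s))"
proof
  define B :: "nat \<Rightarrow> complex poly" where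
    "B s = smult (1 / (\<Prod>t\<in>{..N}-{s}. of_nat s - of_nat t)) (\<Prod>t\<in>{..N}-{s}. [:- of_nat t, 1:])" for s
  have B: "poly (B s) (of_nat u) = (if u = s then 1 else 0)" if "s \<le> N" "u \<le> N" for s u
  proof (cases "u = s")
    case True
    have "(\<Prod>t\<in>{..N}-{s}. of_nat s - of_nat t :: complex) \<noteq> 0" by auto
    with True show ?thesis by (simp add: B_def poly_prod)
  next
    case False
    then have "(\<Prod>t\<in>{..N}-{s}. of_nat u - of_nat t :: complex) = 0" using that by auto
    with False show ?thesis by (simp add: B_def poly_prod)
  qed
  have dB: "degree (B s) \<le> N" if "s \<le> N" for s
  proof -
    have "degree (\<Prod>t\<in>{..N}-{s}. [:- of_nat t, 1:] :: complex poly) \<le> (\<Sum>t\<in>{..N}-{s}. 1)"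
      by (rule order_trans[OF degree_prod_sum_le]) auto
    also have "\<dots> = N" using that by simp
    finally show ?thesis using degree_smult_le order_trans unfolding B_def by blast
  qed
  fix p :: "complex poly" and i
  assume p: "degree p \<le> N"
  have "p = (\<Sum>s\<le>N. smult (poly p (of_nat s)) (B s))"
  proof (rule poly_eqI_degree[where A = "of_nat ` {..N}"])
    show "poly p x = poly (\<Sum>s\<le>N. smult (poly p (of_nat s)) (B s)) x" if "x \<in> of_nat ` {..N}" for x
    proof -
      from that obtain u where u: "u \<le> N" "x = of_nat u" by auto
      have "poly (\<Sum>s\<le>N. smult (poly p (of_nat s)) (B s)) x = (\<Sum>s\<le>N. if s = u then poly p x else 0)"
        unfolding poly_sum u(2) by (rule sum.cong) (use u in \<open>auto simp: B\<close>)
      with u show ?thesis by simp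
    qed
    have c: "card (of_nat ` {..N} :: complex set) = Suc N"
      by (simp add: card_image inj_on_def)
    show "degree p < card (of_nat ` {..N} :: complex set)" using p c by simp
    have "degree (\<Sum>s\<le>N. smult (poly p (of_nat s)) (B s)) \<le> N"
      by (rule degree_sum_le) (use dB order_trans[OF degree_smult_le] in auto)
    then show "degree (\<Sum>s\<le>N. smult (poly p (of_nat s)) (B s)) < card (of_nat ` {..N} :: complex set)"
      using c by simp
  qed
  then have "coeff p i = (\<Sum>s\<le>N. poly p (of_nat s) * coeff (B s) i)"
    by (metis (no_types, lifting) coeff_smult coeff_sum sum.cong)
  then show "coeff p i = (\<Sum>s\<le>N. coeff (B s) i * poly p (of_nat s))" by (simp add: mult.commute)
qed

lemma complex_poly_has_root:
  fixes p :: "complex poly"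
  assumes "degree p > 0"
  shows "\<exists>z. poly p z = 0"
proof -
  have "coeff p (degree p) \<noteq> 0" using assms by auto
  then have "coeff p 0 = 0 \<or> (\<exists>i\<in>{1..degree p}. coeff p i \<noteq> 0)"
    using assms by (intro disjI2 bexI[of _ "degree p"]) auto
  then obtain z where "(\<Sum>i\<le>degree p. coeff p i * z ^ i) = 0"
    by (rule fundamental_theorem_of_algebra)
  then show ?thesis by (auto simp: poly_altdef)
qed

text \<open>Near a root of p of multiplicity n the bound forces q to vanish to order n as well. The
  induction removes one common linear factor at a time and checks that the bound survives the
  division.\<close>

lemma poly_dvdI_local_bound:
  fixes p q :: "complex poly"
  assumes "p \<noteq> 0" "\<And>z. poly p z = 0 \<Longrightarrow> \<exists>C. \<forall>\<^sub>F t in at z. norm (poly q t) \<le> C * norm (poly p t)"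
  shows "p dvd q"
  using assms
proof (induction "degree p" arbitrary: p q)
  case 0
  have "is_unit p" using 0(1,2) by (simp add: is_unit_iff_degree)
  then show ?case by (rule unit_imp_dvd)
next
  case (Suc n)
  have "degree p > 0" using Suc(2) by simp
  then obtain z where z: "poly p z = 0" using complex_poly_has_root[of p] by auto
  obtain C where C: "\<forall>\<^sub>F t in at z. norm (poly q t) \<le> C * norm (poly p t)"
    using Suc(4)[OF z] by blast
  have "norm (poly q z) \<le> C * norm (poly p z)"
    by (rule tendsto_le[OF _ _ _ C]) (auto intro!: tendsto_intros)
  then have qz: "poly q z = 0" using z by simp
  obtain p' q' where pq: "p = [:-z, 1:] * p'" "q = [:-z, 1:] * q'"
    using z qz by (auto simp: poly_eq_0_iff_dvd elim!: dvdE)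
  have p'0: "p' \<noteq> 0" using Suc(3) pq by auto
  have "Suc n = Suc (degree p')"
    using Suc(2) p'0 unfolding pq by (subst (asm) degree_mult_eq) auto
  moreover have "\<exists>C. \<forall>\<^sub>F t in at w. norm (poly q' t) \<le> C * norm (poly p' t)" if "poly p' w = 0" for w
  proof -
    from that have "poly p w = 0" by (simp add: pq)
    then obtain C where "\<forall>\<^sub>F t in at w. norm (poly q t) \<le> C * norm (poly p t)"
      using Suc(4) by blast
    \<comment> \<open>This covers w = z too, since \<open>at w\<close> is a punctured neighbourhood;
      for a multiple root that case does occur.\<close>
    moreover have "\<forall>\<^sub>F t in at w. t \<noteq> z"
      by (rule eventually_neq_at_within)
    ultimately have "\<forall>\<^sub>F t in at w. norm (poly q' t) \<le> C * norm (poly p' t)"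
    proof eventually_elim
      case (elim t)
      then have "norm (t - z) * norm (poly q' t) \<le> norm (t - z) * (C * norm (poly p' t))"
        by (simp add: pq norm_mult[symmetric] algebra_simps)
      with elim show ?case by simp
    qed
    then show ?thesis ..
  qed
  ultimately have "p' dvd q'" using Suc(1)[of p' q'] p'0 by blast
  then show ?case unfolding pq by (rule mult_dvd_mono[OF dvd_refl])
qed

text \<open>The logarithmic derivative of q at 0 is minus the sum of the inverses of the roots,
  counted with multiplicity, and each inverse has norm at most 1/m. Written without quotients, the
  estimate can be proved by splitting off one root at a time.\<close>

lemma poly_root_lower_bound:
  fixes q :: "complex poly"
  assumes "q \<noteq> 0" "m > 0" "\<And>z. poly q z = 0 \<Longrightarrow> m \<le> norm z"
  shows "norm (poly (pderiv q) 0) * m \<le> of_nat (degree q) * norm (poly q 0)"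
  using assms(1,3)
proof (induction "degree q" arbitrary: q)
  case 0
  have "pderiv q = 0" using 0(1) by (simp add: pderiv_eq_0_iff)
  then show ?case by simp
next
  case (Suc n)
  have "degree q > 0" using Suc(2) by simp
  then obtain a where a: "poly q a = 0" using complex_poly_has_root[of q] by auto
  then obtain r where r: "q = [:-a, 1:] * r" by (auto simp: poly_eq_0_iff_dvd elim!: dvdE)
  have r0: "r \<noteq> 0" using Suc(3) r by auto
  have dr: "degree q = Suc (degree r)"
    using r0 unfolding r by (subst degree_mult_eq) auto
  have IH: "norm (poly (pderiv r) 0) * m \<le> of_nat (degree r) * norm (poly r 0)"
    by (rule Suc(1)) (use dr Suc(2,4) r0 r in auto)
  have ma: "m \<le> norm a" by (rule Suc(4)[OF a])
  have "poly (pderiv q) 0 = poly r 0 - a * poly (pderiv r) 0"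
    unfolding r by (subst pderiv_mult) (simp add: pderiv_pCons)
  then have "norm (poly (pderiv q) 0) \<le> norm (poly r 0) + norm a * norm (poly (pderiv r) 0)"
    by (metis norm_mult norm_triangle_ineq4)
  then have "norm (poly (pderiv q) 0) * m \<le> (norm (poly r 0) + norm a * norm (poly (pderiv r) 0)) * m"
    using assms(2) by (intro mult_right_mono) auto
  also have "\<dots> = m * norm (poly r 0) + norm a * (norm (poly (pderiv r) 0) * m)"
    by (simp add: algebra_simps)
  also have "\<dots> \<le> norm a * norm (poly r 0) + norm a * (of_nat (degree r) * norm (poly r 0))"
    by (intro add_mono mult_right_mono mult_left_mono IH ma) auto
  also have "\<dots> = of_nat (degree q) * norm (poly q 0)"
    unfolding dr by (simp add: r norm_mult algebra_simps)
  finally show ?case .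
qed

text \<open>Take for m in \<open>poly_root_lower_bound\<close> the norm of the smallest root. This
  is a quantitative substitute for the implicit function theorem whose constant involves q only
  through its degree.\<close>

lemma poly_small_root:
  fixes q :: "complex poly"
  assumes "poly (pderiv q) 0 \<noteq> 0"
  obtains z where "poly q z = 0"
    "norm (poly (pderiv q) 0) * norm z \<le> of_nat (degree q) * norm (poly q 0)"
proof -
  have q0: "q \<noteq> 0" using assms by auto
  have "degree q > 0" using assms by (auto simp: pderiv_eq_0_iff[symmetric] intro: Nat.gr0I)
  then obtain a where a: "poly q a = 0" using complex_poly_has_root[of q] by auto
  have fin: "finite {z. poly q z = 0}" using q0 by (rule poly_roots_finite)
  define z where "z = arg_min_on norm {z. poly q z = 0}"
  have z: "poly q z = 0" "\<And>w. poly q w = 0 \<Longrightarrow> norm z \<le> norm w"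
    using arg_min_if_finite[OF fin, of norm] arg_min_least[OF fin, of _ norm] a
    unfolding z_def by auto
  show thesis
  proof (cases "z = 0")
    case True
    then show ?thesis using that[OF z(1)] by simp
  next
    case False
    show ?thesis
      by (rule that[OF z(1)], rule poly_root_lower_bound[OF q0 _ z(2)]) (use False in auto)
  qed
qed

lemma poly_altdef_le:
  fixes p :: "'a::comm_semiring_1 poly"
  assumes "degree p \<le> n"
  shows "poly p x = (\<Sum>i\<le>n. coeff p i * x ^ i)"
  unfolding poly_altdef
  by (rule sum.mono_neutral_left) (use assms in \<open>auto simp: coeff_eq_0\<close>)

text \<open>By Liouville f is a polynomial of degree at most N, hence equal to its interpolation.
  The bound B does not occur in the formula, so it may depend on further variables that are
  frozen.\<close>

lemma entire_poly_growth_interpolation: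
  obtains L :: "nat \<Rightarrow> nat \<Rightarrow> complex" where
    "\<And>(f :: complex \<Rightarrow> complex) B x. f holomorphic_on UNIV \<Longrightarrow> (\<And>z. norm (f z) \<le> B * (1 + norm z) ^ N) \<Longrightarrow>
      f x = (\<Sum>i\<le>N. \<Sum>s\<le>N. L i s * f (of_nat s) * x ^ i)"
proof -
  obtain L :: "nat \<Rightarrow> nat \<Rightarrow> complex" where
    L: "\<And>p i. degree p \<le> N \<Longrightarrow> coeff p i = (\<Sum>s\<le>N. L i s * poly p (of_nat s))"
    by (rule coeff_interpolation[of N]) blast
  show thesis
  proof
    fix f :: "complex \<Rightarrow> complex" and B x assume hol: "f holomorphic_on UNIV" and B: "\<And>z. norm (f z) \<le> B * (1 + norm z) ^ N"
    have B0: "B \<ge> 0" using order_trans[OF norm_ge_zero B[of 0]] by simp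
    have le: "norm (f z) \<le> (B * 2 ^ N) * norm z ^ N" if "1 \<le> norm z" for z
    proof -
      have "(1 + norm z) ^ N \<le> (2 * norm z) ^ N" using that by (intro power_mono) auto
      with B0 have "B * (1 + norm z) ^ N \<le> B * (2 * norm z) ^ N" by (rule mult_left_mono[rotated])
      with B[of z] show ?thesis by (simp add: power_mult_distrib)
    qed
    define p where "p = (\<Sum>k\<le>N. monom ((deriv ^^ k) f 0 / fact k) k)"
    have f: "f z = poly p z" for z
      using Liouville_polynomial[OF hol le, where \<xi> = z] by (simp add: p_def poly_sum poly_monom)
    have "degree p \<le> N"
      unfolding p_def by (rule degree_sum_le) (auto intro: order_trans[OF degree_monom_le])
    then have "f x = (\<Sum>i\<le>N. (\<Sum>s\<le>N. L i s * poly p (of_nat s)) * x ^ i)"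
      unfolding f using poly_altdef_le[of p N x] L by simp
    then show "f x = (\<Sum>i\<le>N. \<Sum>s\<le>N. L i s * f (of_nat s) * x ^ i)"
      by (simp add: f sum_distrib_right)
  qed
qed

text \<open>The interpolation formula is applied in one variable after the other, which expresses f
  by its values on a finite grid. The growth bound splits because 1 + a + b + c is at most (1 + a +
  b)(1 + c) for nonnegative reals.\<close>

lemma separately_entire_poly_growth:
  fixes f :: "complex \<Rightarrow> complex \<Rightarrow> complex \<Rightarrow> complex"
  assumes hol: "\<And>y z. (\<lambda>x. f x y z) holomorphic_on UNIV" "\<And>x z. (\<lambda>y. f x y z) holomorphic_on UNIV"
      "\<And>x y. (\<lambda>z. f x y z) holomorphic_on UNIV"
    and C: "\<And>x y z. norm (f x y z) \<le> C * (1 + norm x + norm y + norm z) ^ N"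
  obtains F :: "3 cpoly" where "\<And>q. cpoly_eval F q = f (q $ 1) (q $ 2) (q $ 3)"
proof -
  have C0: "C \<ge> 0" using order_trans[OF norm_ge_zero C[of 0 0 0]] by simp
  have C': "C * (1 + norm x + norm y + norm z) ^ N \<le>
      C * (1 + norm x + norm y) ^ N * (1 + norm z) ^ N" for x y z :: complex
  proof -
    have "1 + norm x + norm y + norm z \<le> (1 + norm x + norm y) * (1 + norm z)"
      by (simp add: algebra_simps)
    then have "(1 + norm x + norm y + norm z) ^ N \<le> ((1 + norm x + norm y) * (1 + norm z)) ^ N"
      by (intro power_mono) auto
    from mult_left_mono[OF this C0] show ?thesis by (simp add: power_mult_distrib mult_ac)
  qed
  obtain L :: "nat \<Rightarrow> nat \<Rightarrow> complex" where
    L: "\<And>(f :: complex \<Rightarrow> complex) B x. f holomorphic_on UNIV \<Longrightarrow> (\<And>z. norm (f z) \<le> B * (1 + norm z) ^ N) \<Longrightarrow>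
      f x = (\<Sum>i\<le>N. \<Sum>s\<le>N. L i s * f (of_nat s) * x ^ i)"
    by (rule entire_poly_growth_interpolation[of N]) blast
  have 1: "f x y z = (\<Sum>i\<le>N. \<Sum>s\<le>N. L i s * f (of_nat s) y z * x ^ i)" for x y z
    by (intro L[OF hol(1), where B = "C * (1 + norm y + norm z) ^ N"])
       (use C'[of y z] order_trans[OF C] in \<open>simp add: add_ac\<close>)
  have 2: "f x y z = (\<Sum>i\<le>N. \<Sum>s\<le>N. L i s * f x (of_nat s) z * y ^ i)" for x y z
    by (intro L[OF hol(2), where B = "C * (1 + norm x + norm z) ^ N"])
       (use C'[of x z] order_trans[OF C] in \<open>simp add: add_ac\<close>)
  have 3: "f x y z = (\<Sum>i\<le>N. \<Sum>s\<le>N. L i s * f x y (of_nat s) * z ^ i)" for x y z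
    by (intro L[OF hol(3), where B = "C * (1 + norm x + norm y) ^ N"])
       (use C'[of x y] order_trans[OF C] in \<open>simp add: add_ac\<close>)
  define F :: "3 cpoly" where "F = (\<Sum>i\<le>N. \<Sum>s\<le>N. \<Sum>j\<le>N. \<Sum>t\<le>N. \<Sum>k\<le>N. \<Sum>u\<le>N.
     cpoly_const (L i s * L j t * L k u * f (of_nat s) (of_nat t) (of_nat u)) *
       cpoly_var 1 ^ i * cpoly_var 2 ^ j * cpoly_var 3 ^ k)"
  have "cpoly_eval F q = f (q $ 1) (q $ 2) (q $ 3)" for q
    by (subst 1, subst 2, subst 3)
       (simp add: F_def cpoly_eval_sum cpoly_eval_mult cpoly_eval_power sum_distrib_left sum_distrib_right mult_ac)
  then show thesis by (rule that)
qed

section \<open>Restriction of a form to a line\<close>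

definition line_poly :: "'n::finite cpoly \<Rightarrow> complex^'n \<Rightarrow> complex^'n \<Rightarrow> complex poly" where
  "line_poly P e v = (\<Sum>k\<in>Poly_Mapping.keys P. smult (Poly_Mapping.lookup P k)
     (\<Prod>i\<in>UNIV. [:v $ i, e $ i:] ^ Poly_Mapping.lookup k i))"

lemma poly_line_poly [simp]: "poly (line_poly P e v) t = cpoly_eval P (v + t *s e)"
  by (simp add: line_poly_def poly_sum poly_prod poly_power cpoly_eval_def)

lemma degree_line_poly_le:
  assumes "homogeneous d P"
  shows "degree (line_poly P e v) \<le> d"
  unfolding line_poly_def
proof (rule degree_sum_le, simp)
  fix k assume k: "k \<in> Poly_Mapping.keys P"
  have "degree (\<Prod>i\<in>UNIV. [:v $ i, e $ i:] ^ Poly_Mapping.lookup k i) \<le>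
     (\<Sum>i\<in>UNIV. degree ([:v $ i, e $ i:] ^ Poly_Mapping.lookup k i))"
    using degree_prod_sum_le[of UNIV "\<lambda>i. [:v $ i, e $ i:] ^ Poly_Mapping.lookup k i"] by (simp add: o_def)
  also have "\<dots> \<le> (\<Sum>i\<in>UNIV. Poly_Mapping.lookup k i)"
  proof (rule sum_mono)
    fix i
    have "degree [:v $ i, e $ i:] \<le> 1" by simp
    then show "degree ([:v $ i, e $ i:] ^ Poly_Mapping.lookup k i) \<le> Poly_Mapping.lookup k i"
      using degree_power_le[of "[:v $ i, e $ i:]" "Poly_Mapping.lookup k i"]
      by (metis mult_le_mono1 nat_mult_1 order_trans)
  qed
  also have "\<dots> = d" using assms k by (simp add: homogeneous_def)
  finally show "degree (smult (Poly_Mapping.lookup P k) (\<Prod>i\<in>UNIV. [:v $ i, e $ i:] ^ Poly_Mapping.lookup k i)) \<le> d"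
    using degree_smult_le order_trans by blast
qed

text \<open>From P(v + t e) = t^d P(e + v/t) it follows that \<open>line_poly P e v\<close> is the
  coefficient reversal r of \<open>line_poly P v e\<close>, whose constant coefficient is P e. The
  comparison nodes 1, ..., d + 1 avoid t = 0, where the identity is meaningless.\<close>

lemma coeff_line_poly_top:
  assumes "homogeneous d P"
  shows "coeff (line_poly P e v) d = cpoly_eval P e"
proof -
  define r where "r = (\<Sum>n\<le>d. monom (coeff (line_poly P v e) n) (d - n))"
  have pr: "poly r t = t ^ d * poly (line_poly P v e) (1 / t)" if "t \<noteq> 0" for t
  proof -
    have "t ^ (d - n) = t ^ d * (1 / t) ^ n" if "n \<le> d" for n
      using \<open>t \<noteq> 0\<close> that by (simp add: power_diff power_one_over)
    then show ?thesis
      unfolding poly_altdef_le[OF degree_line_poly_le[OF assms]]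
      by (simp add: r_def poly_sum poly_monom sum_distrib_left mult_ac)
  qed
  have "line_poly P e v = r"
  proof (rule poly_eqI_degree[where A = "of_nat ` {1..Suc d}"])
    fix t :: complex assume "t \<in> of_nat ` {1..Suc d}"
    then have t: "t \<noteq> 0" by auto
    have "v + t *s e = t *s (e + (1 / t) *s v)"
      using t by (simp add: vec_eq_iff field_simps)
    then have "cpoly_eval P (v + t *s e) = t ^ d * cpoly_eval P (e + (1 / t) *s v)"
      by (simp only: cpoly_eval_scale[OF assms])
    then show "poly (line_poly P e v) t = poly r t"
      using pr[OF t] by simp
  next
    have c: "card (of_nat ` {1..Suc d} :: complex set) = Suc d"
      by (subst card_image) (auto simp: inj_on_def)
    show "degree (line_poly P e v) < card (of_nat ` {1..Suc d} :: complex set)"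
      using degree_line_poly_le[OF assms, of e v] c by simp
    have "degree r \<le> d"
      unfolding r_def by (rule degree_sum_le) (auto intro: order_trans[OF degree_monom_le])
    then show "degree r < card (of_nat ` {1..Suc d} :: complex set)" using c by simp
  qed
  moreover have "coeff r d = coeff (line_poly P v e) 0"
  proof -
    have "coeff r d = (\<Sum>n\<le>d. if n = 0 then coeff (line_poly P v e) 0 else 0)"
      unfolding r_def coeff_sum by (rule sum.cong) auto
    then show ?thesis by simp
  qed
  ultimately show ?thesis
    by (simp flip: poly_0_coeff_0)
qed

lemma holomorphic_vec_coeff_line_poly [hol_intros]:
  "holomorphic_vec (\<lambda>v. coeff (line_poly P e v) n) U"
proof -
  have mult: "\<forall>n. holomorphic_vec (\<lambda>v. coeff (f v * g v) n) U"
    if "\<forall>n. holomorphic_vec (\<lambda>v. coeff (f v) n) U" "\<forall>n. holomorphic_vec (\<lambda>v. coeff (g v) n) U"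
    for f g :: "complex^'a \<Rightarrow> complex poly"
    unfolding coeff_mult using that by (auto intro!: hol_intros)
  have pow: "\<forall>n. holomorphic_vec (\<lambda>v. coeff (f v ^ k) n) U"
    if "\<forall>n. holomorphic_vec (\<lambda>v. coeff (f v) n) U" for f :: "complex^'a \<Rightarrow> complex poly" and k
    by (induction k) (auto intro!: mult[rule_format] that[rule_format] holomorphic_vec_const simp del: coeff_mult)
  have prod: "\<forall>n. holomorphic_vec (\<lambda>v. coeff (\<Prod>i\<in>A. f i v) n) U"
    if "\<And>i. \<forall>n. holomorphic_vec (\<lambda>v. coeff (f i v) n) U" for f :: "'a \<Rightarrow> complex^'a \<Rightarrow> complex poly" and A
    by (induction A rule: infinite_finite_induct)
       (auto intro!: mult[rule_format] that[rule_format] holomorphic_vec_const)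
  have lin: "holomorphic_vec (\<lambda>v. coeff [:v $ i, e $ i:] n) U" for i n
  proof -
    have "coeff [:v $ i, e $ i:] n = (if n = 0 then v $ i else if n = 1 then e $ i else 0)" for v
      by (auto simp: coeff_pCons split: nat.splits)
    then show ?thesis
      by (cases "n = 0"; cases "n = 1") (auto intro!: hol_intros)
  qed
  show ?thesis
    unfolding line_poly_def coeff_sum coeff_smult
    by (intro hol_intros prod[rule_format] pow[rule_format] lin)
qed

section \<open>Polynomiality of homogeneous holomorphic functions on a smooth cone\<close>

text \<open>This is the coefficient of t^k in the polynomial (q w - q t) / (w - t), found by
  expanding each w^n - t^n as a geometric sum.\<close>

definition diff_quotient_coeff :: "complex poly \<Rightarrow> nat \<Rightarrow> complex \<Rightarrow> complex" where
  "diff_quotient_coeff q k w = (\<Sum>n\<in>{k<..degree q}. coeff q n * w ^ (n - Suc k))"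

text \<open>A fixed upper limit makes the number of terms independent of q, so that holomorphic
  dependence on the coefficients of q becomes visible.\<close>

lemma diff_quotient_coeff_le:
  assumes "degree q \<le> d"
  shows "diff_quotient_coeff q k w = (\<Sum>n\<in>{k<..d}. coeff q n * w ^ (n - Suc k))"
  unfolding diff_quotient_coeff_def
  by (rule sum.mono_neutral_left) (use assms in \<open>auto simp: coeff_eq_0\<close>)

lemma diff_quotient_coeff:
  assumes "degree q \<le> d"
  shows "poly q w - poly q t = (w - t) * (\<Sum>k<d. diff_quotient_coeff q k w * t ^ k)"
proof -
  have "poly q w - poly q t = (\<Sum>n\<le>d. coeff q n * (w ^ n - t ^ n))"
    using assms by (simp add: poly_altdef_le right_diff_distrib sum_subtractf)
  also have "\<dots> = (\<Sum>n\<le>d. coeff q n * ((w - t) * (\<Sum>k<n. w ^ (n - Suc k) * t ^ k)))"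
  proof (rule sum.cong[OF refl])
    fix n
    have "w ^ n - t ^ n = - (t ^ n - w ^ n)" by simp
    also have "\<dots> = (w - t) * (\<Sum>k<n. w ^ (n - Suc k) * t ^ k)"
      unfolding power_diff_sumr2[of t n w] by (simp add: algebra_simps)
    finally show "coeff q n * (w ^ n - t ^ n) = coeff q n * ((w - t) * (\<Sum>k<n. w ^ (n - Suc k) * t ^ k))"
      by simp
  qed
  also have "\<dots> = (w - t) * (\<Sum>n\<le>d. \<Sum>k<n. coeff q n * w ^ (n - Suc k) * t ^ k)"
    by (simp add: sum_distrib_left mult_ac)
  also have "(\<Sum>n\<le>d. \<Sum>k<n. coeff q n * w ^ (n - Suc k) * t ^ k) =
     (\<Sum>n\<le>d. \<Sum>k<d. if k < n then coeff q n * w ^ (n - Suc k) * t ^ k else 0)"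
    by (intro sum.cong refl sum.mono_neutral_cong_left) auto
  also have "\<dots> = (\<Sum>k<d. \<Sum>n\<le>d. if k < n then coeff q n * w ^ (n - Suc k) * t ^ k else 0)"
    by (rule sum.swap)
  also have "\<dots> = (\<Sum>k<d. diff_quotient_coeff q k w * t ^ k)"
    unfolding diff_quotient_coeff_le[OF assms] sum_distrib_right
    by (intro sum.cong refl sum.mono_neutral_cong_right) auto
  finally show ?thesis .
qed

text \<open>Hermite interpolation at the roots of \<open>q\<close>: replacing \<open>(q w - q t) / (w - t)\<close> by its two summands
  turns the Cauchy integrals into \<open>g z t\<close> minus \<open>q t\<close> times a bounded function.\<close>

lemma contour_interpolation:
  fixes q :: "complex poly" and g :: "complex \<Rightarrow> complex \<Rightarrow> complex"
  assumes fin: "finite Z" and r: "r > 0" and deg: "degree q \<le> d"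
    and disj: "\<And>z z'. z \<in> Z \<Longrightarrow> z' \<in> Z \<Longrightarrow> z \<noteq> z' \<Longrightarrow> 2 * r < dist z z'"
    and hol: "\<And>z. z \<in> Z \<Longrightarrow> g z holomorphic_on cball z r"
    and nz: "\<And>z w. z \<in> Z \<Longrightarrow> dist z w = r \<Longrightarrow> poly q w \<noteq> 0"
    and z: "z \<in> Z" and t0: "dist z t0 < r"
    and a: "\<And>k. k < d \<Longrightarrow> a k = (\<Sum>z\<in>Z. 1 / (2 * pi * \<i>) *
       contour_integral (circlepath z r) (\<lambda>w. g z w * diff_quotient_coeff q k w / poly q w))"
  shows "\<exists>C. \<forall>\<^sub>F t in nhds t0. norm ((\<Sum>k<d. a k * t ^ k) - g z t) \<le> C * norm (poly q t)"
proof -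
  define K where "K t = (\<Sum>z\<in>Z. 1 / (2 * pi * \<i>) *
     contour_integral (circlepath z r) (\<lambda>w. g z w / (poly q w * (w - t))))" for t
  have cont: "continuous_on (sphere z r) (g z)" if "z \<in> Z" for z
    by (rule continuous_on_subset[OF holomorphic_on_imp_continuous_on[OF hol[OF that]]]) auto
  have contq: "continuous_on A (\<lambda>w. diff_quotient_coeff q k w)" for A k
    unfolding diff_quotient_coeff_def by (intro continuous_intros)
  have away: "t \<notin> sphere z' r" "z' \<noteq> z \<Longrightarrow> t \<notin> cball z' r" if "z' \<in> Z" "dist z t < r" for z' t
  proof -
    show "z' \<noteq> z \<Longrightarrow> t \<notin> cball z' r"
      using disj[OF z that(1)] that(2) dist_triangle[of z z' t] by (auto simp: dist_commute)
    then show "t \<notin> sphere z' r" using that(2) by (cases "z' = z") auto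
  qed
  have cia: "(\<lambda>w. g z' w * diff_quotient_coeff q k w / poly q w) contour_integrable_on circlepath z' r"
    if "z' \<in> Z" for z' k
    by (rule contour_integrable_continuous_circlepath)
       (use nz[OF that] r in \<open>auto intro!: continuous_intros cont that contq\<close>)
  have cib: "(\<lambda>w. g z' w / (poly q w * (w - t))) contour_integrable_on circlepath z' r"
    if "z' \<in> Z" "dist z t < r" for z' t
    by (rule contour_integrable_continuous_circlepath)
       (use nz[OF that(1)] r away(1)[OF that] in \<open>auto intro!: continuous_intros cont that\<close>)
  have key: "(\<Sum>k<d. a k * t ^ k) = g z t - poly q t * K t" if t: "dist z t < r" for t
  proof -
    have ci: "(\<Sum>k<d. contour_integral (circlepath z' r) (\<lambda>w. g z' w * diff_quotient_coeff q k w / poly q w) * t ^ k)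
       = (if z' = z then 2 * pi * \<i> * g z t else 0) -
          poly q t * contour_integral (circlepath z' r) (\<lambda>w. g z' w / (poly q w * (w - t)))"
      if z': "z' \<in> Z" for z'
    proof -
      \<comment> \<open>Only the disc that contains t contributes a Cauchy value; on every other
        closed disc the kernel is holomorphic and integrates to 0.\<close>
      have "((\<lambda>w. g z' w / (w - t)) has_contour_integral (if z' = z then 2 * pi * \<i> * g z t else 0)) (circlepath z' r)"
      proof (cases "z' = z")
        case True
        then show ?thesis
          using Cauchy_integral_circlepath_simple[OF hol[OF z'], of t] t
          by (simp add: dist_norm norm_minus_commute)
      next
        case False
        have "(\<lambda>w. g z' w / (w - t)) holomorphic_on cball z' r"
          using away(2)[OF z' t False] by (intro holomorphic_intros hol z') auto
        then have "((\<lambda>w. g z' w / (w - t)) has_contour_integral 0) (circlepath z' r)"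
          by (rule Cauchy_theorem_convex_simple) (use r in auto)
        with False show ?thesis by simp
      qed
      from has_contour_integral_diff[OF this has_contour_integral_lmul[OF has_contour_integral_integral[OF cib[OF z' t]]]]
      have "((\<lambda>w. g z' w / (w - t) - poly q t * (g z' w / (poly q w * (w - t)))) has_contour_integral
        (if z' = z then 2 * pi * \<i> * g z t else 0) -
          poly q t * contour_integral (circlepath z' r) (\<lambda>w. g z' w / (poly q w * (w - t)))) (circlepath z' r)" .
      moreover have "((\<lambda>w. \<Sum>k<d. g z' w * diff_quotient_coeff q k w / poly q w * t ^ k) has_contour_integral
         (\<Sum>k<d. contour_integral (circlepath z' r) (\<lambda>w. g z' w * diff_quotient_coeff q k w / poly q w) * t ^ k)) (circlepath z' r)"
        by (intro has_contour_integral_sum has_contour_integral_rmul has_contour_integral_integral cia z') auto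
      moreover have "(\<Sum>k<d. g z' w * diff_quotient_coeff q k w / poly q w * t ^ k) =
          g z' w / (w - t) - poly q t * (g z' w / (poly q w * (w - t)))"
        if "w \<in> path_image (circlepath z' r)" for w
      proof -
        have gen: "a / b * ((b - c) / x) = a / x - c * (a / (b * x))" if "b \<noteq> 0" "x \<noteq> 0" for a b c x :: complex
          using that by (simp add: field_simps)
        have w: "dist z' w = r" using that r by simp
        then have n: "poly q w \<noteq> 0" "w \<noteq> t" using nz[OF z'] away(1)[OF z' t] by auto
        have "(\<Sum>k<d. g z' w * diff_quotient_coeff q k w / poly q w * t ^ k) =
          g z' w / poly q w * (\<Sum>k<d. diff_quotient_coeff q k w * t ^ k)"
          by (simp add: sum_distrib_left mult_ac)
        also have "(\<Sum>k<d. diff_quotient_coeff q k w * t ^ k) = (poly q w - poly q t) / (w - t)"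
          using diff_quotient_coeff[OF deg, of w t] n by (simp add: field_simps)
        also have "g z' w / poly q w * ((poly q w - poly q t) / (w - t)) =
          g z' w / (w - t) - poly q t * (g z' w / (poly q w * (w - t)))"
          by (rule gen) (use n in auto)
        finally show ?thesis .
      qed
      ultimately show ?thesis
        by (metis (no_types, lifting) has_contour_integral_eq has_contour_integral_unique)
    qed
    have "(\<Sum>k<d. a k * t ^ k) = (\<Sum>z'\<in>Z. 1 / (2 * pi * \<i>) *
       (\<Sum>k<d. contour_integral (circlepath z' r) (\<lambda>w. g z' w * diff_quotient_coeff q k w / poly q w) * t ^ k))"
      by (simp add: a sum_distrib_left sum_distrib_right mult_ac) (rule sum.swap)
    also have "\<dots> = (\<Sum>z'\<in>Z. (if z' = z then g z t else 0) -
       poly q t * (1 / (2 * pi * \<i>) * contour_integral (circlepath z' r) (\<lambda>w. g z' w / (poly q w * (w - t)))))"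
      by (intro sum.cong refl, subst ci) (auto simp: field_simps)
    also have "\<dots> = g z t - poly q t * K t"
      using z fin by (simp add: sum_subtractf K_def sum_distrib_left)
    finally show ?thesis .
  qed
  have "continuous_on (ball z r) K"
    unfolding K_def
  proof (intro continuous_intros continuous_on_contour_integral_param)
    fix z' assume z': "z' \<in> Z"
    have 1: "continuous_on (ball z r \<times> path_image (circlepath z' r)) (\<lambda>p. g z' (snd p))"
      by (rule continuous_on_compose2[OF cont[OF z']]) (use r in \<open>auto intro!: continuous_intros\<close>)
    have 2: "poly q w * (w - t) \<noteq> 0" if "t \<in> ball z r" "dist z' w = r" for t w
      using nz[OF z' that(2)] away(1)[OF z', of t] that by auto
    show "continuous_on (ball z r \<times> path_image (circlepath z' r)) (\<lambda>(t, w). g z' w / (poly q w * (w - t)))"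
      unfolding case_prod_unfold using 2 r
      by (intro continuous_intros 1) auto
    show "continuous_on {0..1} (circlepath z' r)"
      using path_circlepath unfolding path_def .
    show "continuous_on {0..1} (\<lambda>t. vector_derivative (circlepath z' r) (at t))"
      unfolding vector_derivative_circlepath by (intro continuous_intros)
  qed
  then have "isCont K t0"
    using t0 by (simp add: continuous_on_eq_continuous_at)
  then have "(K \<longlongrightarrow> K t0) (nhds t0)"
    by (simp add: continuous_at tendsto_at_iff_tendsto_nhds)
  then have "\<forall>\<^sub>F t in nhds t0. dist (K t) (K t0) < 1"
    by (rule tendstoD) simp
  moreover have "\<forall>\<^sub>F t in nhds t0. t \<in> ball z r"
    by (rule eventually_nhds_in_open) (use t0 in auto)
  ultimately have "\<forall>\<^sub>F t in nhds t0. norm ((\<Sum>k<d. a k * t ^ k) - g z t) \<le> (norm (K t0) + 1) * norm (poly q t)"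
  proof eventually_elim
    case (elim t)
    have "norm (K t) \<le> norm (K t0) + 1"
      using elim(1) norm_triangle_ineq2[of "K t" "K t0"] by (simp add: dist_norm)
    then have "norm (poly q t) * norm (K t) \<le> norm (poly q t) * (norm (K t0) + 1)"
      by (intro mult_left_mono) auto
    then show ?case
      using elim(2) by (simp add: key norm_mult mult.commute)
  qed
  then show ?thesis ..
qed

text \<open>Discs of radius R around points of \<open>ball 0 R\<close> stay inside
  \<open>ball 0 (3 * R)\<close>, so Cauchy's inequality bounds the derivative by M / R and the mean
  value inequality applies.\<close>

lemma holomorphic_bounded_lipschitz:
  assumes hol: "k holomorphic_on ball 0 (3 * R)" and R: "R > 0"
    and M: "\<And>z. norm z < 3 * R \<Longrightarrow> norm (k z) \<le> M" and x: "norm x < R"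
  shows "norm (k 0 - k x) \<le> M / R * norm x"
proof -
  have "norm (k 0 - k x) \<le> M / R * norm (0 - x)"
  proof (rule field_differentiable_bound[where S = "ball 0 R" and f' = "deriv k"])
    fix z :: complex assume z: "z \<in> ball 0 R"
    then have "z \<in> ball 0 (3 * R)" using R by auto
    then show "(k has_field_derivative deriv k z) (at z within ball 0 R)"
      using holomorphic_derivI[OF hol open_ball] by (meson DERIV_subset at_within_open_NO_MATCH has_field_derivative_at_within open_ball)
    have sub: "cball z R \<subseteq> ball 0 (3 * R)"
    proof
      fix w assume "w \<in> cball z R"
      then show "w \<in> ball 0 (3 * R)"
        using z R norm_triangle_ineq[of z "w - z"] by (auto simp: dist_norm norm_minus_commute)
    qed
    have "norm ((deriv ^^ 1) k z) \<le> fact 1 * M / R ^ 1"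
      using sub by (intro Cauchy_inequality holomorphic_on_subset[OF hol]
          holomorphic_on_imp_continuous_on M R) (auto simp: dist_norm norm_minus_commute subset_iff)
    then show "norm (deriv k z) \<le> M / R" by simp
  qed (use R x in auto)
  then show ?thesis by simp
qed

text \<open>In a direction with nonzero partial derivative, \<open>poly_small_root\<close> yields a zero of \<open>P\<close> at
  distance \<open>O(\<bar>P v\<bar>)\<close> from \<open>v\<close>; there \<open>h\<close> vanishes, and \<open>h\<close> is Lipschitz.\<close>

lemma vanishing_on_cone_bound:
  assumes hom: "homogeneous d P" and sm: "smooth_form P"
    and W: "open W" "v0 \<in> W" and h: "holomorphic_vec h W"
    and v0: "v0 \<in> proj_zeros {P}" and van: "\<And>v. v \<in> W \<Longrightarrow> v \<in> proj_zeros {P} \<Longrightarrow> h v = 0"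
  shows "\<exists>C. \<forall>\<^sub>F v in nhds v0. norm (h v) \<le> C * norm (cpoly_eval P v)"
proof -
  obtain i where i: "cpoly_eval (cpoly_deriv i P) v0 \<noteq> 0"
    using sm v0 by (auto simp: smooth_form_def)
  define c where "c = norm (cpoly_eval (cpoly_deriv i P) v0) / 2"
  have c: "c > 0" using i by (simp add: c_def)
  have contP: "continuous_on UNIV (cpoly_eval p)" for p :: "4 cpoly"
    by (rule holomorphic_vec_continuous_on) (rule hol_intros)
  have isc: "(cpoly_eval p \<longlongrightarrow> cpoly_eval p v0) (nhds v0)" for p :: "4 cpoly"
    using contP by (simp add: continuous_on_eq_continuous_at continuous_at tendsto_at_iff_tendsto_nhds)
  have P0: "cpoly_eval P v0 = 0" "v0 \<noteq> 0" using v0 by (auto simp: proj_zeros_def)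
  obtain e where e: "e > 0" "cball v0 e \<subseteq> W"
    using W by (meson open_contains_cball)
  \<comment> \<open>A point within R of v0, moved by at most 3 R, stays within 4 R. There h is
    holomorphic with bound M, and 4 R below the norm of v0 ensures that the moved point is not the
    origin.\<close>
  define R where "R = min e (norm v0 / 2) / 4"
  have R: "R > 0" "4 * R \<le> e" "4 * R < norm v0" using e(1) P0(2) by (auto simp: R_def min_less_iff_disj)
  have "compact (h ` cball v0 e)"
    by (rule compact_continuous_image[OF continuous_on_subset[OF holomorphic_vec_continuous_on[OF h] e(2)] compact_cball])
  then obtain M where M: "\<And>v. v \<in> cball v0 e \<Longrightarrow> norm (h v) \<le> M"
    by (meson bounded_iff compact_imp_bounded image_eqI)
  have ev1: "\<forall>\<^sub>F v in nhds v0. dist (cpoly_eval (cpoly_deriv i P) v) (cpoly_eval (cpoly_deriv i P) v0) < c"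
    by (rule tendstoD[OF isc c])
  \<comment> \<open>With this threshold the root x found below satisfies c |x| <= d c R / (d + 1) <
    c R, hence |x| < R; adding 1 gives the strict inequality and a nonzero denominator also for d =
    0.\<close>
  have ev2: "\<forall>\<^sub>F v in nhds v0. dist (cpoly_eval P v) (cpoly_eval P v0) < c * R / (d + 1)"
    by (rule tendstoD[OF isc]) (use c R in simp)
  have ev3: "\<forall>\<^sub>F v in nhds v0. v \<in> ball v0 R"
    by (rule eventually_nhds_in_open) (use R in auto)
  have "\<forall>\<^sub>F v in nhds v0. norm (h v) \<le> (M / R * d / c) * norm (cpoly_eval P v)"
    using ev1 ev2 ev3
  proof eventually_elim
    case (elim v)
    define Pi where "Pi = cpoly_eval (cpoly_deriv i P) v"
    define q where "q = line_poly P (axis i 1) v"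
    have "norm (cpoly_eval (cpoly_deriv i P) v0) \<le> norm Pi + dist Pi (cpoly_eval (cpoly_deriv i P) v0)"
      unfolding dist_norm by (metis norm_minus_commute norm_triangle_sub add.commute)
    with elim(1) have Pi: "norm Pi \<ge> c" unfolding c_def Pi_def by simp
    have 1: "((\<lambda>\<zeta>. cpoly_eval P (v + \<zeta> *s axis i 1)) has_field_derivative
     (\<Sum>j\<in>UNIV. cpoly_eval (cpoly_deriv j P) (v + 0 *s axis i 1) * (if j = i then 1 else 0))) (at 0)"
      by (rule cpoly_eval_chain) (auto intro!: derivative_eq_intros simp: axis_def)
    have 2: "((\<lambda>\<zeta>. cpoly_eval P (v + \<zeta> *s axis i 1)) has_field_derivative poly (pderiv q) 0) (at 0)"
      using poly_DERIV[of q 0] by (simp add: q_def)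
    from DERIV_unique[OF 1 2] have dq: "poly (pderiv q) 0 = Pi"
      by (simp add: Pi_def if_distrib cong: if_cong)
    obtain x where x: "poly q x = 0" "norm Pi * norm x \<le> of_nat (degree q) * norm (poly q 0)"
      using poly_small_root[of q] Pi c unfolding dq by force
    have "c * norm x \<le> norm Pi * norm x" using Pi by (intro mult_right_mono) auto
    also note x(2)
    also have "of_nat (degree q) * norm (poly q 0) \<le> of_nat d * norm (cpoly_eval P v)"
      using degree_line_poly_le[OF hom, of "axis i 1" v] by (simp add: q_def mult_right_mono)
    finally have cx: "c * norm x \<le> of_nat d * norm (cpoly_eval P v)" .
    also have "\<dots> \<le> of_nat d * (c * R / (d + 1))"
      using elim(2) P0 by (intro mult_left_mono) auto
    also have "\<dots> < c * R"
      using c R by (simp add: field_simps)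
    finally have xR: "norm x < R" using c by simp
    have dv: "dist v0 v < R" using elim(3) by simp
    have inb: "v + \<zeta> *s axis i 1 \<in> cball v0 (4 * R)" if "norm \<zeta> \<le> 3 * R" for \<zeta>
    proof -
      have "dist v0 (v + \<zeta> *s axis i 1) \<le> dist v0 v + dist v (v + \<zeta> *s axis i 1)" by (rule dist_triangle)
      also have "dist v (v + \<zeta> *s axis i 1) = norm \<zeta>"
        by (simp add: dist_norm norm_vector_scalar_mult)
      finally show ?thesis using dv that by simp
    qed
    then have inb': "v + \<zeta> *s axis i 1 \<in> cball v0 e" if "norm \<zeta> \<le> 3 * R" for \<zeta>
      using that R(2) subset_cball by blast
    define k where "k \<zeta> = h (v + \<zeta> *s axis i 1)" for \<zeta>
    have "norm (k 0 - k x) \<le> M / R * norm x"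
    proof (rule holomorphic_bounded_lipschitz)
      show "k holomorphic_on ball 0 (3 * R)"
        unfolding k_def
        by (rule holomorphic_on_subset[OF holomorphic_vec_line[OF h]]) (use inb' e(2) in auto)
      show "norm (k z) \<le> M" if "norm z < 3 * R" for z
        unfolding k_def using that by (intro M inb') auto
    qed (use R xR in auto)
    moreover have "k x = 0"
      unfolding k_def
    proof (rule van)
      have b: "norm x \<le> 3 * R" using xR R by simp
      show "v + x *s axis i 1 \<in> W" using inb'[OF b] e(2) by blast
      have "v + x *s axis i 1 \<noteq> 0" using inb[OF b] R(3) by auto
      then show "v + x *s axis i 1 \<in> proj_zeros {P}"
        using x(1) by (simp add: proj_zeros_def q_def)
    qed
    ultimately have "norm (h v) \<le> M / R * norm x" by (simp add: k_def)
    also have "M \<ge> 0" using M[of v0] e order_trans[OF norm_ge_zero] by auto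
    then have "M / R * norm x \<le> M / R * (d * norm (cpoly_eval P v) / c)"
      using cx c R by (intro mult_left_mono) (auto simp: field_simps)
    finally show ?case by (simp add: field_simps)
  qed
  then show ?thesis ..
qed

lemma eventually_nhds_line:
  fixes v h :: "complex^'n::finite"
  assumes "eventually Q (nhds (v + z *s h))"
  shows "\<forall>\<^sub>F t in nhds z. Q (v + t *s h)"
proof (rule eventually_compose_filterlim[OF assms])
  have "continuous_on UNIV (\<lambda>t. v + t *s h)" by (intro continuous_intros)
  then have "isCont (\<lambda>t. v + t *s h) z"
    by (simp add: continuous_on_eq_continuous_at)
  then show "filterlim (\<lambda>t. v + t *s h) (nhds (v + z *s h)) (nhds z)"
    by (simp add: isCont_def tendsto_at_iff_tendsto_nhds[where g = "\<lambda>t. v + t *s h"])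
qed

lemma continuous_on_cpoly_eval [continuous_intros]:
  "continuous_on A f \<Longrightarrow> continuous_on A (\<lambda>x. cpoly_eval p (f x))"
  by (rule continuous_on_compose2[OF holomorphic_vec_continuous_on[OF holomorphic_vec_cpoly_eval[of p UNIV]]]) auto

text \<open>Holomorphy on the cone is expressed by local extensions to open subsets of C^4, so that
  the cone itself never has to carry a complex structure. The degree N is a natural number, which is
  what turns homogeneity into polynomial growth.\<close>

locale cone_section =
  fixes P :: "4 cpoly" and d :: nat and e :: "complex^4" and g :: "complex^4 \<Rightarrow> complex" and N :: nat
  assumes d: "d \<ge> 1" and hom: "homogeneous d P" and smooth: "smooth_form P"
    and direction: "cpoly_eval P e \<noteq> 0"
    and scale: "\<And>v c. v \<in> proj_zeros {P} \<Longrightarrow> c \<noteq> 0 \<Longrightarrow> g (c *s v) = c ^ N * g v"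
    and local_extension: "\<And>v. v \<in> proj_zeros {P} \<Longrightarrow>
      \<exists>W G. open W \<and> v \<in> W \<and> holomorphic_vec G W \<and> (\<forall>x\<in>W \<inter> proj_zeros {P}. G x = g x)"
begin

definition local_ext :: "complex^4 \<Rightarrow> (complex^4) set \<Rightarrow> (complex^4 \<Rightarrow> complex) \<Rightarrow> bool" where
  "local_ext v W G \<longleftrightarrow> open W \<and> v \<in> W \<and> holomorphic_vec G W \<and> (\<forall>x\<in>W \<inter> proj_zeros {P}. G x = g x)"

text \<open>A line through the origin would have a root of P at the origin, since d >= 1, and no
  local extension of g is given there.\<close>

definition avoids :: "complex^4 \<Rightarrow> bool" where
  "avoids v \<longleftrightarrow> (\<forall>t. v + t *s e \<noteq> 0)"

text \<open>Weierstrass division of \<open>g\<close> by \<open>P\<close> in the direction \<open>e\<close>. Prescribing \<open>A\<close> modulo \<open>O(P)\<close> at the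
  roots accounts for multiplicities, so that \<open>A\<close> is unique also over the discriminant.\<close>

definition remainder :: "complex^4 \<Rightarrow> complex poly \<Rightarrow> bool" where
  "remainder v A \<longleftrightarrow> degree A < d \<and> (\<forall>z. cpoly_eval P (v + z *s e) = 0 \<longrightarrow>
     (\<exists>W G C. local_ext (v + z *s e) W G \<and>
        (\<forall>\<^sub>F t in nhds z. norm (poly A t - G (v + t *s e)) \<le> C * norm (cpoly_eval P (v + t *s e)))))"

text \<open>The leading coefficient is the constant P e, so no root escapes to infinity when v
  varies and division by P is possible on every line.\<close>

lemma degree_line: "degree (line_poly P e v) = d"
proof (rule antisym)
  show "d \<le> degree (line_poly P e v)"
    by (rule le_degree) (simp add: coeff_line_poly_top[OF hom] direction)
qed (rule degree_line_poly_le[OF hom])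

lemma line_nonzero: "line_poly P e v \<noteq> 0"
  using degree_line[of v] d by auto

lemma root_in_cone: "avoids v \<Longrightarrow> cpoly_eval P (v + z *s e) = 0 \<Longrightarrow> v + z *s e \<in> proj_zeros {P}"
  by (simp add: avoids_def proj_zeros_def)

text \<open>Two local extensions at the same point differ by a function that vanishes on the cone,
  hence by O(P). So A - B is O(P) at every root, which makes it divisible by
  \<open>line_poly P e v\<close>, and its degree is too small unless it is 0.\<close>

lemma remainder_unique:
  assumes v: "avoids v" and A: "remainder v A" and B: "remainder v B"
  shows "A = B"
proof -
  have tri: "norm (x - y + w) \<le> norm x + norm y + norm w" for x y w :: complex
    using norm_triangle_ineq[of "x - y" w] norm_triangle_ineq4[of x y] by linarith
  have "line_poly P e v dvd A - B"
  proof (rule poly_dvdI_local_bound[OF line_nonzero])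
    fix z assume "poly (line_poly P e v) z = 0"
    then have z: "cpoly_eval P (v + z *s e) = 0" by simp
    obtain W1 G1 C1 where 1: "local_ext (v + z *s e) W1 G1"
      "\<forall>\<^sub>F t in nhds z. norm (poly A t - G1 (v + t *s e)) \<le> C1 * norm (cpoly_eval P (v + t *s e))"
      using A z unfolding remainder_def by blast
    obtain W2 G2 C2 where 2: "local_ext (v + z *s e) W2 G2"
      "\<forall>\<^sub>F t in nhds z. norm (poly B t - G2 (v + t *s e)) \<le> C2 * norm (cpoly_eval P (v + t *s e))"
      using B z unfolding remainder_def by blast
    have "\<exists>C. \<forall>\<^sub>F x in nhds (v + z *s e). norm (G1 x - G2 x) \<le> C * norm (cpoly_eval P x)"
    proof (rule vanishing_on_cone_bound[OF hom smooth, where W = "W1 \<inter> W2"])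
      show "holomorphic_vec (\<lambda>x. G1 x - G2 x) (W1 \<inter> W2)"
        using 1(1) 2(1) unfolding local_ext_def
        by (auto intro!: holomorphic_vec_diff intro: holomorphic_vec_subset)
    qed (use 1(1) 2(1) root_in_cone[OF v z] in \<open>auto simp: local_ext_def\<close>)
    then obtain C3 where "\<forall>\<^sub>F x in nhds (v + z *s e). norm (G1 x - G2 x) \<le> C3 * norm (cpoly_eval P x)" ..
    from eventually_nhds_line[OF this] 1(2) 2(2)
    have "\<forall>\<^sub>F t in nhds z. norm (poly (A - B) t) \<le> (C1 + C2 + C3) * norm (poly (line_poly P e v) t)"
    proof eventually_elim
      case (elim t)
      have "poly (A - B) t = (poly A t - G1 (v + t *s e)) - (poly B t - G2 (v + t *s e)) + (G1 (v + t *s e) - G2 (v + t *s e))"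
        by simp
      also have "norm \<dots> \<le> norm (poly A t - G1 (v + t *s e)) + norm (poly B t - G2 (v + t *s e)) + norm (G1 (v + t *s e) - G2 (v + t *s e))"
        by (rule tri)
      also have "\<dots> \<le> (C1 + C2 + C3) * norm (poly (line_poly P e v) t)"
        using elim by (simp add: algebra_simps)
      finally show ?case .
    qed
    then show "\<exists>C. \<forall>\<^sub>F t in at z. norm (poly (A - B) t) \<le> C * norm (poly (line_poly P e v) t)"
      by (auto simp: eventually_at_filter elim: eventually_mono)
  qed
  moreover have "degree (A - B) < d"
    using A B by (auto simp: remainder_def intro: degree_diff_less)
  ultimately show ?thesis
    using dvd_imp_degree_le[of "line_poly P e v" "A - B"] degree_line[of v] by auto
qed

text \<open>By homogeneity a root t different from 0 gives a zero e + v/t of P, and P has no zero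
  within some distance r of e. So |t| is at most |v| / r, uniformly for v near v0.\<close>

lemma roots_bounded:
  obtains B where "\<And>v t. v \<in> ball v0 1 \<Longrightarrow> cpoly_eval P (v + t *s e) = 0 \<Longrightarrow> norm t \<le> B"
proof -
  have "open {x. cpoly_eval P x \<noteq> 0}"
    by (rule open_Collect_neq) (intro continuous_intros)+
  then obtain r where r: "r > 0" "ball e r \<subseteq> {x. cpoly_eval P x \<noteq> 0}"
    by (rule openE[of _ e]) (auto simp: direction)
  show thesis
  proof (rule that, rule ccontr)
    fix v t assume v: "v \<in> ball v0 1" and 0: "cpoly_eval P (v + t *s e) = 0"
      and "\<not> norm t \<le> (norm v0 + 1) / r"
    then have t: "norm t > (norm v0 + 1) / r" by simp
    moreover have "(norm v0 + 1) / r > 0" using r(1) by (simp add: add_nonneg_pos)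
    ultimately have t0: "norm t > 0" by linarith
    have nv: "norm v < norm v0 + 1"
      using v norm_triangle_sub[of v v0] by (simp add: dist_norm norm_minus_commute)
    have "v + t *s e = t *s (e + (1 / t) *s v)"
      using t0 by (simp add: vec_eq_iff field_simps)
    then have "cpoly_eval P (e + (1 / t) *s v) = 0"
      using 0 t0 by (simp only: cpoly_eval_scale[OF hom]) simp
    moreover have "dist e (e + (1 / t) *s v) < r"
    proof -
      have "dist e (e + (1 / t) *s v) = norm v / norm t"
        by (simp add: dist_norm norm_vector_scalar_mult norm_divide)
      also have "\<dots> < r" using t nv r(1) t0 by (simp add: field_simps)
      finally show ?thesis .
    qed
    ultimately show False using r(2) by auto
  qed
qed

text \<open>Discs are fixed around the roots on the line through v0, and compactness keeps the roots
  of neighbouring lines inside them. The coefficients are then Cauchy integrals over circles that do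
  not move with v, which yields continuity and holomorphy along lines.\<close>

lemma remainder_local:
  assumes v0: "avoids v0"
  obtains \<delta> a where "\<delta> > 0"
    "\<And>v. v \<in> ball v0 \<delta> \<Longrightarrow> remainder v (\<Sum>k<d. monom (a k v) k)"
    "\<And>k. continuous_on (ball v0 \<delta>) (a k)"
    "\<And>k v h. (\<lambda>\<zeta>. a k (v + \<zeta> *s h)) holomorphic_on {\<zeta>. v + \<zeta> *s h \<in> ball v0 \<delta>}"
proof -
  define Z where "Z = {t. cpoly_eval P (v0 + t *s e) = 0}"
  have fin: "finite Z"
    using poly_roots_finite[OF line_nonzero[of v0]] by (simp add: Z_def)
  have "\<forall>z\<in>Z. \<exists>WG. local_ext (v0 + z *s e) (fst WG) (snd WG)"
    using local_extension root_in_cone[OF v0] by (fastforce simp: Z_def local_ext_def)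
  then obtain WG where WG0: "\<forall>z\<in>Z. local_ext (v0 + z *s e) (fst (WG z)) (snd (WG z))"
    by metis
  define W where "W z = fst (WG z)" for z
  define G where "G z = snd (WG z)" for z
  have WG: "\<And>z. z \<in> Z \<Longrightarrow> local_ext (v0 + z *s e) (W z) (G z)"
    using WG0 by (simp add: W_def G_def)
  have ope: "open {p. fst p + snd p *s e \<in> T}" if "open T" for T
  proof -
    have "open ((\<lambda>p. fst p + snd p *s e) -` T)"
      by (rule open_vimage[OF that]) (intro continuous_intros)
    then show ?thesis by (simp add: vimage_def)
  qed
  have "\<exists>r>0. cball z r \<subseteq> {w. v0 + w *s e \<in> W z}" if z: "z \<in> Z" for z
  proof -
    have "open ((\<lambda>w. v0 + w *s e) -` W z)"
      by (rule open_vimage) (use WG[OF z] in \<open>auto simp: local_ext_def intro!: continuous_intros\<close>)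
    then show ?thesis
      using WG[OF z] unfolding open_contains_cball by (auto simp: local_ext_def vimage_def)
  qed
  then obtain rz where rz: "\<And>z. z \<in> Z \<Longrightarrow> rz z > 0" "\<And>z. z \<in> Z \<Longrightarrow> cball z (rz z) \<subseteq> {w. v0 + w *s e \<in> W z}"
    by metis
  \<comment> \<open>The entries \<open>rz z\<close> keep each disc inside the domain of its
    extension, a third of each distance makes the discs disjoint with room to spare, and 1 keeps the
    set nonempty.\<close>
  define RR where "RR = insert 1 (rz ` Z \<union> (\<lambda>(z, z'). dist z z' / 3) ` {(z, z'). z \<in> Z \<and> z' \<in> Z \<and> z \<noteq> z'})"
  have finRR: "finite RR"
    unfolding RR_def by (intro finite.insertI finite_UnI finite_imageI fin finite_subset[OF _ finite_cartesian_product[OF fin fin]]) auto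
  define r where "r = Min RR"
  have r: "r > 0"
    unfolding r_def by (subst Min_gr_iff[OF finRR]) (use rz(1) in \<open>auto simp: RR_def\<close>)
  have rle: "r \<le> x" if "x \<in> RR" for x
    unfolding r_def by (rule Min_le[OF finRR that])
  have rW: "v0 + w *s e \<in> W z" if "z \<in> Z" "w \<in> cball z r" for z w
    using rz(2)[OF that(1)] rle[of "rz z"] that by (force simp: RR_def)
  have disj: "2 * r < dist z z'" if "z \<in> Z" "z' \<in> Z" "z \<noteq> z'" for z z'
    using rle[of "dist z z' / 3"] that r by (force simp: RR_def)
  obtain B where B: "\<And>v t. v \<in> ball v0 1 \<Longrightarrow> cpoly_eval P (v + t *s e) = 0 \<Longrightarrow> norm t \<le> B"
    using roots_bounded[of v0] by blast
  \<comment> \<open>The tube lemma over the compact disc: for v near v0 the whole disc in direction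
    e still lies in the domain of the extension.\<close>
  have "\<exists>X. v0 \<in> X \<and> open X \<and> X \<times> cball z r \<subseteq> {p. fst p + snd p *s e \<in> W z}" if "z \<in> Z" for z
    by (rule Elementary_Topology.tube_lemma[OF compact_cball ope]) (use WG[OF that] rW[OF that] in \<open>auto simp: local_ext_def\<close>)
  then have "\<forall>z\<in>Z. \<exists>X. v0 \<in> X \<and> open X \<and> X \<times> cball z r \<subseteq> {p. fst p + snd p *s e \<in> W z}" ..
  from bchoice[OF this] obtain X where
     X0: "\<forall>z\<in>Z. v0 \<in> X z \<and> open (X z) \<and> X z \<times> cball z r \<subseteq> {p. fst p + snd p *s e \<in> W z}" ..
  have X: "\<And>z. z \<in> Z \<Longrightarrow> v0 \<in> X z" "\<And>z. z \<in> Z \<Longrightarrow> open (X z)"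
     "\<And>z. z \<in> Z \<Longrightarrow> X z \<times> cball z r \<subseteq> {p. fst p + snd p *s e \<in> W z}"
    using X0 by blast+
  have "open {x. cpoly_eval P x \<noteq> 0}"
    by (rule open_Collect_neq) (intro continuous_intros)+
  then have "\<exists>Y. v0 \<in> Y \<and> open Y \<and> Y \<times> (cball 0 B - (\<Union>z\<in>Z. ball z r)) \<subseteq> {p. fst p + snd p *s e \<in> {x. cpoly_eval P x \<noteq> 0}}"
    by (intro Elementary_Topology.tube_lemma[OF _ ope] compact_diff) (use r in \<open>auto simp: Z_def\<close>)
  then obtain Y where Y: "v0 \<in> Y" "open Y"
    and Y3: "Y \<times> (cball 0 B - (\<Union>z\<in>Z. ball z r)) \<subseteq> {p. fst p + snd p *s e \<in> {x. cpoly_eval P x \<noteq> 0}}"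
    by blast
  have "open (ball v0 1 \<inter> Y \<inter> (\<Inter>z\<in>Z. X z))"
    using fin X Y by (intro open_Int open_INT) auto
  moreover have "v0 \<in> ball v0 1 \<inter> Y \<inter> (\<Inter>z\<in>Z. X z)" using X Y by auto
  ultimately obtain \<delta> where \<delta>: "\<delta> > 0" "ball v0 \<delta> \<subseteq> ball v0 1 \<inter> Y \<inter> (\<Inter>z\<in>Z. X z)"
    by (rule openE)
  have inW: "v + w *s e \<in> W z" if "v \<in> ball v0 \<delta>" "z \<in> Z" "w \<in> cball z r" for v z w
  proof -
    have "(v, w) \<in> X z \<times> cball z r" using that \<delta>(2) by auto
    from subsetD[OF X(3)[OF that(2)] this] show ?thesis by simp
  qed
  have roots: "\<exists>z\<in>Z. t \<in> ball z r" if "v \<in> ball v0 \<delta>" "cpoly_eval P (v + t *s e) = 0" for v t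
  proof -
    have "v \<in> ball v0 1" "v \<in> Y" using that(1) \<delta>(2) by blast+
    then have "norm t \<le> B" using B that(2) by blast
    then have "(v, t) \<notin> Y \<times> (cball 0 B - (\<Union>z\<in>Z. ball z r))"
      using subsetD[OF Y3, of "(v, t)"] that(2) by fastforce
    with \<open>v \<in> Y\<close> \<open>norm t \<le> B\<close> show ?thesis by auto
  qed
  have nz: "cpoly_eval P (v + w *s e) \<noteq> 0" if nzp: "v \<in> ball v0 \<delta>" "z \<in> Z" "dist z w = r" for v z w
  proof
    assume "cpoly_eval P (v + w *s e) = 0"
    then obtain z' where z': "z' \<in> Z" "dist z' w < r" using roots[OF nzp(1)] by auto
    then have "z' \<noteq> z" using nzp(3) by auto
    then show False
      using disj[OF nzp(2) z'(1)] z'(2) nzp(3) dist_triangle[of z z' w] by (auto simp: dist_commute)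
  qed
  \<comment> \<open>The integrand of \<open>contour_interpolation\<close>, with q and g now
    depending on v. Summing over all discs makes the result insensitive to how roots split or merge
    inside a disc.\<close>
  define f where "f z k v w = G z (v + w *s e) * diff_quotient_coeff (line_poly P e v) k w / poly (line_poly P e v) w" for z k v w
  define a where "a k v = (\<Sum>z\<in>Z. 1 / (2 * pi * \<i>) * contour_integral (circlepath z r) (f z k v))" for k v
  have holG: "holomorphic_vec (G z) (W z)" if "z \<in> Z" for z
    using WG[OF that] by (simp add: local_ext_def)
  have contf: "continuous_on (ball v0 \<delta> \<times> path_image (circlepath z r)) (\<lambda>(v, w). f z k v w)" if z: "z \<in> Z" for z k
  proof -
    have 1: "continuous_on (ball v0 \<delta> \<times> sphere z r) (\<lambda>p. G z (fst p + snd p *s e))"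
      by (rule continuous_on_compose2[OF holomorphic_vec_continuous_on[OF holG[OF z]]])
         (use inW[OF _ z] in \<open>auto intro!: continuous_intros simp del: mem_ball\<close>)
    have 2: "continuous_on T (\<lambda>p. coeff (line_poly P e (fst p)) n)" for T :: "((complex^4) \<times> complex) set" and n
      by (rule continuous_on_compose2[OF holomorphic_vec_continuous_on[OF holomorphic_vec_coeff_line_poly[of P e n UNIV]]])
         (auto intro!: continuous_intros)
    show ?thesis
      unfolding f_def case_prod_unfold diff_quotient_coeff_le[OF degree_line_poly_le[OF hom]] poly_line_poly
      using r nz[OF _ z]
      by (auto intro!: continuous_intros 1 2 simp del: mem_ball)
  qed
  have holf: "holomorphic_vec (\<lambda>v. f z k v w) (ball v0 \<delta>)" if z: "z \<in> Z" and w: "w \<in> path_image (circlepath z r)" for z k w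
  proof -
    have w': "dist z w = r" using w r by simp
    have shift: "holomorphic_vec (\<lambda>v. H (v + w *s e)) (ball v0 \<delta>)" if "holomorphic_vec H T" "\<And>v. v \<in> ball v0 \<delta> \<Longrightarrow> v + w *s e \<in> T" for H T
      by (rule holomorphic_vec_compose[OF that(1)]) (use that(2) in \<open>auto intro!: hol_intros\<close>)
    show ?thesis
      unfolding f_def diff_quotient_coeff_le[OF degree_line_poly_le[OF hom]] poly_line_poly
      by (intro hol_intros shift[OF holG[OF z]] shift[OF holomorphic_vec_cpoly_eval[of P UNIV]] inW z nz w')
         (use w' z in auto)
  qed
  show thesis
  proof (rule that[OF \<delta>(1)])
    fix k
    show "continuous_on (ball v0 \<delta>) (a k)"
      unfolding a_def
    proof (intro continuous_intros continuous_on_contour_integral_param)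
      fix z
      show "continuous_on {0..1} (circlepath z r)"
        using path_circlepath unfolding path_def .
      show "continuous_on {0..1} (\<lambda>t. vector_derivative (circlepath z r) (at t))"
        unfolding vector_derivative_circlepath by (intro continuous_intros)
    qed (rule contf)
  next
    fix k and v h :: "complex^4"
    let ?U = "{\<zeta>. v + \<zeta> *s h \<in> ball v0 \<delta>}"
    have "open ((\<lambda>\<zeta>. v + \<zeta> *s h) -` ball v0 \<delta>)"
      by (rule open_vimage) (auto intro!: continuous_intros)
    then have opU: "open ?U" by (simp add: vimage_def)
    show "(\<lambda>\<zeta>. a k (v + \<zeta> *s h)) holomorphic_on ?U"
      unfolding a_def
    proof (intro holomorphic_intros holomorphic_contour_parameter opU)
      fix z assume z: "z \<in> Z"
      have "continuous_on (?U \<times> path_image (circlepath z r)) ((\<lambda>(v, w). f z k v w) \<circ> (\<lambda>p. (v + fst p *s h, snd p)))"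
        by (rule continuous_on_compose[OF _ continuous_on_subset[OF contf[OF z]]]) (auto intro!: continuous_intros)
      then show "continuous_on (?U \<times> path_image (circlepath z r)) (\<lambda>(\<zeta>, w). f z k (v + \<zeta> *s h) w)"
        by (simp add: o_def case_prod_unfold)
      show "(\<lambda>\<zeta>. f z k (v + \<zeta> *s h) w) holomorphic_on ?U" if "w \<in> path_image (circlepath z r)" for w
        by (rule holomorphic_vec_line[OF holf[OF z that]])
    qed
  next
    fix v assume v: "v \<in> ball v0 \<delta>"
    let ?A = "\<Sum>k<d. monom (a k v) k"
    have "degree ?A \<le> d - 1"
      by (rule degree_sum_le) (use d in \<open>auto intro: order_trans[OF degree_monom_le]\<close>)
    then have "degree ?A < d" using d by simp
    moreover have "\<exists>W G C. local_ext (v + t0 *s e) W G \<and>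
        (\<forall>\<^sub>F t in nhds t0. norm (poly ?A t - G (v + t *s e)) \<le> C * norm (cpoly_eval P (v + t *s e)))"
      if t0: "cpoly_eval P (v + t0 *s e) = 0" for t0
    proof -
      obtain z where z: "z \<in> Z" "dist z t0 < r" using roots[OF v t0] by auto
      \<comment> \<open>The extension chosen at the central root z serves every nearby root that
        falls into its disc.\<close>
      have "local_ext (v + t0 *s e) (W z) (G z)"
        using WG[OF z(1)] inW[OF v z(1), of t0] z(2) by (simp add: local_ext_def)
      moreover have "\<exists>C. \<forall>\<^sub>F t in nhds t0. norm ((\<Sum>k<d. a k v * t ^ k) - G z (v + t *s e)) \<le> C * norm (poly (line_poly P e v) t)"
      proof (rule contour_interpolation[OF fin r degree_line_poly_le[OF hom] disj _ _ z])
        show "(\<lambda>t. G z (v + t *s e)) holomorphic_on cball z r" if "z \<in> Z" for z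
          by (rule holomorphic_on_subset[OF holomorphic_vec_line[OF holG[OF that]]])
             (use inW[OF v that] in auto)
        show "poly (line_poly P e v) w \<noteq> 0" if "z \<in> Z" "dist z w = r" for z w
          using nz[OF v that] by simp
      qed (auto simp: a_def f_def[abs_def])
      ultimately show ?thesis by (auto simp: poly_sum poly_monom)
    qed
    ultimately show "remainder v ?A" by (simp add: remainder_def)
  qed
qed

end

section \<open>The global remainder: holomorphy, symmetries and growth\<close>

context cone_section
begin

definition Rem :: "complex^4 \<Rightarrow> complex poly" where
  "Rem v = (THE A. remainder v A)"

lemma Rem_eqI: "avoids v \<Longrightarrow> remainder v A \<Longrightarrow> Rem v = A"
  unfolding Rem_def by (rule the_equality) (auto intro: remainder_unique)

text \<open>The family a lives on the full ball, whereas \<open>Rem v\<close> is characterised only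
  where \<open>avoids v\<close> holds; the two are compared only there.\<close>

definition local_coeffs :: "complex^4 \<Rightarrow> real \<Rightarrow> (nat \<Rightarrow> complex^4 \<Rightarrow> complex) \<Rightarrow> bool" where
  "local_coeffs v0 \<delta> a \<longleftrightarrow> \<delta> > 0 \<and>
    (\<forall>v\<in>ball v0 \<delta>. \<forall>k. avoids v \<longrightarrow> coeff (Rem v) k = (if k < d then a k v else 0)) \<and>
    (\<forall>k. continuous_on (ball v0 \<delta>) (a k)) \<and>
    (\<forall>k v h. (\<lambda>\<zeta>. a k (v + \<zeta> *s h)) holomorphic_on {\<zeta>. v + \<zeta> *s h \<in> ball v0 \<delta>})"

lemma Rem_local:
  assumes "avoids v0"
  shows "remainder v0 (Rem v0)" "\<exists>\<delta> a. local_coeffs v0 \<delta> a"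
proof -
  obtain \<delta> a where a: "\<delta> > 0"
    "\<And>v. v \<in> ball v0 \<delta> \<Longrightarrow> remainder v (\<Sum>k<d. monom (a k v) k)"
    "\<And>k. continuous_on (ball v0 \<delta>) (a k)"
    "\<And>k v h. (\<lambda>\<zeta>. a k (v + \<zeta> *s h)) holomorphic_on {\<zeta>. v + \<zeta> *s h \<in> ball v0 \<delta>}"
    using remainder_local[OF assms] by blast
  have Rem: "Rem v = (\<Sum>k<d. monom (a k v) k)" if "v \<in> ball v0 \<delta>" "avoids v" for v
    using that by (intro Rem_eqI a)
  show "remainder v0 (Rem v0)"
    using a(1) a(2)[of v0] Rem[of v0] assms by simp
  have "local_coeffs v0 \<delta> a"
    unfolding local_coeffs_def using a(1,3,4) by (simp add: Rem coeff_sum)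
  then show "\<exists>\<delta> a. local_coeffs v0 \<delta> a" by blast
qed

lemmas remainder_Rem = Rem_local(1)

lemma continuous_on_coeff_Rem:
  assumes "\<And>v. v \<in> A \<Longrightarrow> avoids v"
  shows "continuous_on A (\<lambda>v. coeff (Rem v) k)"
  unfolding continuous_on_def
proof
  fix v0 assume v0: "v0 \<in> A"
  obtain \<delta> a where "local_coeffs v0 \<delta> a"
    using Rem_local(2)[OF assms[OF v0]] by blast
  then have a: "\<delta> > 0"
    "\<And>v k. v \<in> ball v0 \<delta> \<Longrightarrow> avoids v \<Longrightarrow> coeff (Rem v) k = (if k < d then a k v else 0)"
    "\<And>k. continuous_on (ball v0 \<delta>) (a k)"
    by (auto simp: local_coeffs_def)
  have "isCont (a k) v0"
    using a(1,3) by (simp add: continuous_on_eq_continuous_at)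
  then have "((\<lambda>v. if k < d then a k v else 0) \<longlongrightarrow> (if k < d then a k v0 else 0)) (at v0 within A)"
    by (auto simp: isCont_def intro: tendsto_within_subset)
  moreover have "\<forall>\<^sub>F v in at v0 within A. (if k < d then a k v else 0) = coeff (Rem v) k"
  proof -
    have "\<forall>\<^sub>F v in at v0 within A. v \<in> ball v0 \<delta> \<and> v \<in> A"
      using a(1) by (auto simp: eventually_at dist_commute intro!: exI[of _ \<delta>])
    then show ?thesis
      by eventually_elim (use a(2) assms in auto)
  qed
  ultimately have "((\<lambda>v. coeff (Rem v) k) \<longlongrightarrow> (if k < d then a k v0 else 0)) (at v0 within A)"
    by (rule Lim_transform_eventually)
  then show "((\<lambda>v. coeff (Rem v) k) \<longlongrightarrow> coeff (Rem v0) k) (at v0 within A)"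
    using a(1,2) assms[OF v0] by simp
qed

text \<open>Holomorphy on complex lines suffices, since the passage to polynomials in x, y, z treats
  one variable at a time. The constant coefficient is among the a k because d >= 1.\<close>

lemma holomorphic_Rem_line:
  assumes "\<And>\<zeta>. avoids (v + \<zeta> *s h)"
  shows "(\<lambda>\<zeta>. poly (Rem (v + \<zeta> *s h)) 0) holomorphic_on UNIV"
proof (rule holomorphic_onI)
  fix z
  obtain \<delta> a where "local_coeffs (v + z *s h) \<delta> a"
    using Rem_local(2)[OF assms[of z]] by blast
  then have a: "\<delta> > 0"
    "\<And>w k. w \<in> ball (v + z *s h) \<delta> \<Longrightarrow> avoids w \<Longrightarrow> coeff (Rem w) k = (if k < d then a k w else 0)"
    "\<And>k. (\<lambda>\<zeta>. a k (v + \<zeta> *s h)) holomorphic_on {\<zeta>. v + \<zeta> *s h \<in> ball (v + z *s h) \<delta>}"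
    unfolding local_coeffs_def by blast+
  let ?U = "{\<zeta>. v + \<zeta> *s h \<in> ball (v + z *s h) \<delta>}"
  have "open ((\<lambda>\<zeta>. v + \<zeta> *s h) -` ball (v + z *s h) \<delta>)"
    by (rule open_vimage) (auto intro!: continuous_intros)
  then have opU: "open ?U" by (simp add: vimage_def)
  have "(\<lambda>\<zeta>. poly (Rem (v + \<zeta> *s h)) 0) holomorphic_on ?U"
    by (rule holomorphic_transform[OF a(3)[of 0]]) (use a(2) assms d in \<open>simp add: poly_0_coeff_0\<close>)
  then show "(\<lambda>\<zeta>. poly (Rem (v + \<zeta> *s h)) 0) field_differentiable at z within UNIV"
    using opU a(1) by (simp add: holomorphic_on_imp_differentiable_at)
qed

lemma eventually_nhds_affine:
  fixes a b z :: complex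
  assumes "eventually Q (nhds (a + b * z))"
  shows "\<forall>\<^sub>F t in nhds z. Q (a + b * t)"
proof (rule eventually_compose_filterlim[OF assms])
  have "isCont (\<lambda>t. a + b * t) z" by (intro continuous_intros)
  then show "filterlim (\<lambda>t. a + b * t) (nhds (a + b * z)) (nhds z)"
    by (simp add: isCont_def tendsto_at_iff_tendsto_nhds[where g = "\<lambda>t. a + b * t"])
qed

text \<open>Both base points span the same line, so translating the parameter turns a remainder at
  one into a remainder at the other, and uniqueness identifies them.\<close>

lemma Rem_shift:
  assumes v: "avoids v"
  shows "Rem (v + s *s e) = pcompose (Rem v) [:s, 1:]"
proof (rule Rem_eqI)
  have eq: "v + s *s e + t *s e = v + (s + t) *s e" for t
    by (simp add: vec_eq_iff ring_distribs)
  show "avoids (v + s *s e)" using v unfolding avoids_def eq by blast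
  have R: "remainder v (Rem v)" by (rule remainder_Rem[OF v])
  show "remainder (v + s *s e) (pcompose (Rem v) [:s, 1:])"
    unfolding remainder_def eq
  proof (intro conjI allI impI)
    show "degree (pcompose (Rem v) [:s, 1:]) < d"
      using R by (simp add: remainder_def degree_pcompose)
    fix z assume "cpoly_eval P (v + (s + z) *s e) = 0"
    then obtain W G C where W: "local_ext (v + (s + z) *s e) W G"
      "\<forall>\<^sub>F t in nhds (s + z). norm (poly (Rem v) t - G (v + t *s e)) \<le> C * norm (cpoly_eval P (v + t *s e))"
      using R unfolding remainder_def by blast
    have "\<forall>\<^sub>F t in nhds (s + 1 * z). norm (poly (Rem v) t - G (v + t *s e)) \<le> C * norm (cpoly_eval P (v + t *s e))"
      using W(2) by simp
    from eventually_nhds_affine[OF this]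
    have "\<forall>\<^sub>F t in nhds z. norm (poly (Rem v) (s + t) - G (v + (s + t) *s e)) \<le> C * norm (cpoly_eval P (v + (s + t) *s e))"
      by simp
    with W(1) show "\<exists>W G C. local_ext (v + (s + z) *s e) W G \<and>
      (\<forall>\<^sub>F t in nhds z. norm (poly (pcompose (Rem v) [:s, 1:]) t - G (v + (s + t) *s e)) \<le> C * norm (cpoly_eval P (v + (s + t) *s e)))"
      by (auto simp: poly_pcompose)
  qed
qed

text \<open>Again by uniqueness: the substitution t -> t / c maps the line through c v to the line
  through v. Local extensions are transported by homogeneity of g, and the constant in the O(P)
  bound changes by the factor |c|^N / |c|^d.\<close>

lemma Rem_scale:
  assumes v: "avoids v" and c: "c \<noteq> 0"
  shows "Rem (c *s v) = smult (c ^ N) (pcompose (Rem v) [:0, 1 / c:])"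
proof (rule Rem_eqI)
  have eq: "c *s v + t *s e = c *s (v + (1 / c * t) *s e)" for t
    using c by (simp add: vec_eq_iff field_simps)
  show "avoids (c *s v)" using v c unfolding avoids_def eq vector_mul_eq_0 by blast
  have R: "remainder v (Rem v)" by (rule remainder_Rem[OF v])
  show "remainder (c *s v) (smult (c ^ N) (pcompose (Rem v) [:0, 1 / c:]))"
    unfolding remainder_def eq
  proof (intro conjI allI impI)
    show "degree (smult (c ^ N) (pcompose (Rem v) [:0, 1 / c:])) < d"
      using R c by (simp add: remainder_def degree_pcompose)
    fix z assume "cpoly_eval P (c *s (v + (1 / c * z) *s e)) = 0"
    then have "cpoly_eval P (v + (1 / c * z) *s e) = 0"
      using c unfolding cpoly_eval_scale[OF hom] by simp
    then obtain W G C where W: "local_ext (v + (1 / c * z) *s e) W G"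
      "\<forall>\<^sub>F t in nhds (1 / c * z). norm (poly (Rem v) t - G (v + t *s e)) \<le> C * norm (cpoly_eval P (v + t *s e))"
      using R unfolding remainder_def by blast
    define W' where "W' = (\<lambda>x. (1 / c) *s x) -` W"
    define G' where "G' x = c ^ N * G ((1 / c) *s x)" for x
    have cc: "(1 / c) *s (c *s x) = x" "c *s ((1 / c) *s x) = x" for x :: "complex^4"
      using c by (simp_all add: vec_eq_iff)
    have ext: "local_ext (c *s (v + (1 / c * z) *s e)) W' G'"
      unfolding local_ext_def
    proof (intro conjI ballI)
      show "open W'" unfolding W'_def
        by (rule open_vimage) (use W(1) in \<open>auto simp: local_ext_def intro!: continuous_intros\<close>)
      show "c *s (v + (1 / c * z) *s e) \<in> W'"
        using W(1) unfolding W'_def vimage_eq cc local_ext_def by blast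
      show "holomorphic_vec G' W'"
        unfolding G'_def
      proof (intro hol_intros)
        show "holomorphic_vec (\<lambda>x. G ((1 / c) *s x)) W'"
        proof (rule holomorphic_vec_compose[where U = W])
          show "holomorphic_vec (\<lambda>v. ((1 / c) *s v) $ i) W'" for i
            unfolding vector_smult_component by (intro hol_intros)
        qed (use W(1) in \<open>auto simp: local_ext_def W'_def\<close>)
      qed
      fix x assume x: "x \<in> W' \<inter> proj_zeros {P}"
      have "(1 / c) *s x \<noteq> 0" using x c unfolding vector_mul_eq_0 by (auto simp: proj_zeros_def)
      then have S: "(1 / c) *s x \<in> proj_zeros {P}"
        using x by (auto simp: proj_zeros_def cpoly_eval_scale[OF hom])
      then have "G ((1 / c) *s x) = g ((1 / c) *s x)"
        using W(1) x by (simp add: local_ext_def W'_def)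
      then show "G' x = g x"
        using scale[OF S c] unfolding G'_def cc by simp
    qed
    have "\<forall>\<^sub>F t in nhds (0 + 1 / c * z). norm (poly (Rem v) t - G (v + t *s e)) \<le> C * norm (cpoly_eval P (v + t *s e))"
      using W(2) by simp
    from eventually_nhds_affine[OF this]
    have "\<forall>\<^sub>F t in nhds z. norm (poly (Rem v) (1 / c * t) - G (v + (1 / c * t) *s e)) \<le> C * norm (cpoly_eval P (v + (1 / c * t) *s e))"
      by simp
    then have "\<forall>\<^sub>F t in nhds z. norm (poly (smult (c ^ N) (pcompose (Rem v) [:0, 1 / c:])) t - G' (c *s (v + (1 / c * t) *s e)))
       \<le> (norm (c ^ N) * C / norm (c ^ d)) * norm (cpoly_eval P (c *s (v + (1 / c * t) *s e)))"
    proof eventually_elim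
      case (elim t)
      have "poly (smult (c ^ N) (pcompose (Rem v) [:0, 1 / c:])) t - G' (c *s (v + (1 / c * t) *s e)) =
         c ^ N * (poly (Rem v) (1 / c * t) - G (v + (1 / c * t) *s e))"
        unfolding G'_def cc by (simp add: poly_pcompose right_diff_distrib mult.commute)
      then have "norm (poly (smult (c ^ N) (pcompose (Rem v) [:0, 1 / c:])) t - G' (c *s (v + (1 / c * t) *s e))) =
         norm (c ^ N) * norm (poly (Rem v) (1 / c * t) - G (v + (1 / c * t) *s e))"
        by (simp only: norm_mult)
      also have "\<dots> \<le> norm (c ^ N) * (C * norm (cpoly_eval P (v + (1 / c * t) *s e)))"
        using elim by (rule mult_left_mono) simp
      also have "\<dots> = (norm (c ^ N) * C / norm (c ^ d)) * norm (cpoly_eval P (c *s (v + (1 / c * t) *s e)))"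
        using c unfolding cpoly_eval_scale[OF hom] norm_mult by simp
      finally show ?case .
    qed
    with ext show "\<exists>W G C. local_ext (c *s (v + (1 / c * z) *s e)) W G \<and>
      (\<forall>\<^sub>F t in nhds z. norm (poly (smult (c ^ N) (pcompose (Rem v) [:0, 1 / c:])) t - G (c *s (v + (1 / c * t) *s e)))
         \<le> C * norm (cpoly_eval P (c *s (v + (1 / c * t) *s e))))"
      by blast
  qed
qed

text \<open>For v on the cone t = 0 is a root, and the O(P) bound evaluated at the root itself is an
  equality.\<close>

lemma Rem_on_cone:
  assumes v: "avoids v" and S: "v \<in> proj_zeros {P}"
  shows "poly (Rem v) 0 = g v"
proof -
  have "cpoly_eval P (v + 0 *s e) = 0" using S by (simp add: proj_zeros_def)
  then obtain W G C where W: "local_ext (v + 0 *s e) W G"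
    "\<forall>\<^sub>F t in nhds 0. norm (poly (Rem v) t - G (v + t *s e)) \<le> C * norm (cpoly_eval P (v + t *s e))"
    using remainder_Rem[OF v] unfolding remainder_def by blast
  from eventually_nhds_x_imp_x[OF W(2)] have "poly (Rem v) 0 = G v"
    using S by (simp add: proj_zeros_def)
  then show ?thesis using W(1) S by (simp add: local_ext_def)
qed

text \<open>\<open>Rem_shift\<close> moves v along e into a hyperplane transverse to e, and
  \<open>Rem_scale\<close> then moves it to the unit sphere of that hyperplane. On this compact set
  the coefficients are bounded, and undoing the two moves costs only polynomial factors.\<close>

theorem section_is_polynomial:
  assumes e1: "e $ 1 = 0"
  obtains F :: "3 cpoly" where
    "\<And>q. affine_point q \<in> proj_zeros {P} \<Longrightarrow> cpoly_eval F q = g (affine_point q)"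
proof -
  have av1: "avoids v" if "v $ 1 = 1" for v
    using that e1 by (auto simp: avoids_def vec_eq_iff intro!: exI[of _ 1])
  have "e \<noteq> 0"
  proof
    assume "e = 0"
    then have "e = 0 *s e" by simp
    then have "cpoly_eval P e = 0 ^ d * cpoly_eval P e" using cpoly_eval_scale[OF hom] by metis
    then show False using direction d by (simp add: power_0_left split: if_splits)
  qed
  then obtain i where i: "e $ i \<noteq> 0" by (auto simp: vec_eq_iff)
  \<comment> \<open>Since e_i is nonzero, every line in direction e meets the hyperplane h_i = 0
    exactly once; a nonzero h in it spans a line that misses the origin.\<close>
  define K where "K = sphere 0 1 \<inter> {h :: complex^4. h $ i = 0}"
  have avK: "avoids h" if "h \<noteq> 0" "h $ i = 0" for h
    unfolding avoids_def
  proof (intro allI notI)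
    fix t assume 0: "h + t *s e = 0"
    then have "(h + t *s e) $ i = 0" by simp
    then have "t = 0" using that i by simp
    then show False using 0 that by simp
  qed
  have "compact K"
    unfolding K_def by (intro compact_Int_closed compact_sphere closed_Collect_eq continuous_intros)
  moreover have "continuous_on K (\<lambda>h. \<Sum>k<d. norm (coeff (Rem h) k))"
    by (intro continuous_intros continuous_on_coeff_Rem) (auto simp: K_def intro!: avK)
  ultimately have "bounded ((\<lambda>h. \<Sum>k<d. norm (coeff (Rem h) k)) ` K)"
    by (intro compact_imp_bounded compact_continuous_image)
  then obtain M0 where M0: "\<And>h. h \<in> K \<Longrightarrow> (\<Sum>k<d. norm (coeff (Rem h) k)) \<le> M0"
    by (auto simp: bounded_iff abs_le_iff)
  define M where "M = max M0 0"
  have M: "M \<ge> 0" "\<And>h. h \<in> K \<Longrightarrow> (\<Sum>k<d. norm (coeff (Rem h) k)) \<le> M"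
    using M0 by (auto simp: M_def intro: max.coboundedI1)
  have polyK: "norm (poly (Rem h) x) \<le> M * (1 + norm x) ^ d" if "h \<in> K" for h x
  proof -
    have "avoids h" using that by (intro avK) (auto simp: K_def)
    then have "degree (Rem h) \<le> d" using remainder_Rem[of h] by (simp add: remainder_def)
    have "poly (Rem h) x = (\<Sum>k<d. coeff (Rem h) k * x ^ k)"
      unfolding poly_altdef
      by (rule sum.mono_neutral_left)
         (use remainder_Rem[OF \<open>avoids h\<close>] in \<open>auto simp: remainder_def coeff_eq_0\<close>)
    also have "norm \<dots> \<le> (\<Sum>k<d. norm (coeff (Rem h) k) * (1 + norm x) ^ d)"
    proof (rule sum_norm_le)
      fix k assume "k \<in> {..<d}"
      then have "norm x ^ k \<le> (1 + norm x) ^ k" "(1 + norm x) ^ k \<le> (1 + norm x) ^ d"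
        by (auto intro!: power_mono power_increasing)
      then show "norm (coeff (Rem h) k * x ^ k) \<le> norm (coeff (Rem h) k) * (1 + norm x) ^ d"
        unfolding norm_mult norm_power by (intro mult_left_mono) auto
    qed
    also have "\<dots> \<le> M * (1 + norm x) ^ d"
      unfolding sum_distrib_right[symmetric] by (intro mult_right_mono M that) auto
    finally show ?thesis .
  qed
  \<comment> \<open>These constants serve the bounds r <= c1 X and 1 + |s| <= c2 X for the shift s
    and the norm r of the shifted point, where X bounds |v| and X >= 1.\<close>
  define c1 where "c1 = 1 + norm e / norm (e $ i)"
  define c2 where "c2 = 1 + 1 / norm (e $ i)"
  have c12: "c1 \<ge> 0" "c2 \<ge> 0" by (auto simp: c1_def c2_def)
  have growth: "norm (poly (Rem v) 0) \<le> (M * c1 ^ N * c2 ^ d) * X ^ (N + d)"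
    if v1: "v $ 1 = 1" and X: "X \<ge> 1" "norm v \<le> X" for v X
  proof -
    define s where "s = v $ i / e $ i"
    define h where "h = v - s *s e"
    have h1: "h $ 1 = 1" and hi: "h $ i = 0" and v: "v = h + s *s e"
      using v1 e1 i by (auto simp: h_def s_def)
    define r where "r = norm h"
    \<comment> \<open>The shift preserves the first coordinate 1 because e_1 = 0. So r is at least
      1, and dividing s by r does not enlarge it.\<close>
    have r: "r \<ge> 1" using Finite_Cartesian_Product.norm_nth_le[of h 1] h1 by (simp add: r_def)
    then have h0: "h \<noteq> 0" by (auto simp: r_def)
    define u where "u = complex_of_real (1 / r) *s h"
    have hu: "h = complex_of_real r *s u" using r by (simp add: u_def vec_eq_iff)
    have uK: "u \<in> K"
      using r hi by (simp add: K_def u_def norm_vector_scalar_mult norm_divide) (simp add: r_def)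
    then have avu: "avoids u" by (intro avK) (auto simp: K_def)
    have "poly (Rem v) 0 = poly (Rem h) s"
      unfolding v Rem_shift[OF avK[OF h0 hi]] by (simp add: poly_pcompose)
    also have "\<dots> = complex_of_real r ^ N * poly (Rem u) (s / r)"
      using r by (subst hu, subst Rem_scale[OF avu]) (auto simp: poly_pcompose)
    finally have "norm (poly (Rem v) 0) = r ^ N * norm (poly (Rem u) (s / r))"
      using r by (simp add: norm_mult norm_power)
    also have "\<dots> \<le> r ^ N * (M * (1 + norm s) ^ d)"
    proof (intro mult_left_mono order_trans[OF polyK[OF uK]] M power_mono add_left_mono)
      show "norm (s / complex_of_real r) \<le> norm s"
        using r by (simp add: norm_divide divide_le_eq mult_left_le)
         (metis mult_left_mono mult.right_neutral norm_ge_zero)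
    qed (use r in auto)
    also have "\<dots> \<le> (c1 * X) ^ N * (M * (c2 * X) ^ d)"
    proof (intro mult_mono power_mono order_refl)
      have vi: "norm (v $ i) \<le> X" using Finite_Cartesian_Product.norm_nth_le[of v i] X(2) by simp
      then have ns: "norm s \<le> X / norm (e $ i)"
        using i by (simp add: s_def norm_divide divide_right_mono)
      have "r \<le> norm v + norm s * norm e"
        unfolding r_def h_def by (metis norm_triangle_ineq4 norm_vector_scalar_mult)
      also have "\<dots> \<le> X + X / norm (e $ i) * norm e"
        by (intro add_mono X mult_right_mono ns) auto
      also have "\<dots> = c1 * X" by (simp add: c1_def algebra_simps)
      finally show "r \<le> c1 * X" .
      show "1 + norm s \<le> c2 * X"
        using ns X by (simp add: c2_def algebra_simps)
    qed (use r M X c12 in auto)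
    also have "\<dots> = (M * c1 ^ N * c2 ^ d) * X ^ (N + d)"
      by (simp add: power_mult_distrib power_add)
    finally show ?thesis .
  qed
  define f where "f x y z = poly (Rem (vector [1, x, y, z])) 0" for x y z
  obtain F :: "3 cpoly" where F: "\<And>q. cpoly_eval F q = f (q $ 1) (q $ 2) (q $ 3)"
  proof (rule separately_entire_poly_growth[of f "M * c1 ^ N * c2 ^ d" "N + d"])
    fix y z
    have eq: "(vector [1, x, y, z] :: complex^4) = vector [1, 0, y, z] + x *s (axis 2 1 :: complex^4)" for x
      by (simp add: vec_eq_iff forall_4 axis_def)
    have "f x y z = poly (Rem (vector [1, 0, y, z] + x *s (axis 2 1 :: complex^4))) 0" for x
      unfolding f_def eq[of x] ..
    then show "(\<lambda>x. f x y z) holomorphic_on UNIV"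
      by (simp only:) (rule holomorphic_Rem_line, rule av1, simp add: axis_def)
  next
    fix x z
    have eq: "(vector [1, x, y, z] :: complex^4) = vector [1, x, 0, z] + y *s (axis 3 1 :: complex^4)" for y
      by (simp add: vec_eq_iff forall_4 axis_def)
    have "f x y z = poly (Rem (vector [1, x, 0, z] + y *s (axis 3 1 :: complex^4))) 0" for y
      unfolding f_def eq[of y] ..
    then show "(\<lambda>y. f x y z) holomorphic_on UNIV"
      by (simp only:) (rule holomorphic_Rem_line, rule av1, simp add: axis_def)
  next
    fix x y
    have eq: "(vector [1, x, y, z] :: complex^4) = vector [1, x, y, 0] + z *s (axis 4 1 :: complex^4)" for z
      by (simp add: vec_eq_iff forall_4 axis_def)
    have "f x y z = poly (Rem (vector [1, x, y, 0] + z *s (axis 4 1 :: complex^4))) 0" for z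
      unfolding f_def eq[of z] ..
    then show "(\<lambda>z. f x y z) holomorphic_on UNIV"
      by (simp only:) (rule holomorphic_Rem_line, rule av1, simp add: axis_def)
  next
    fix x y z
    have "norm (vector [1, x, y, z] :: complex^4) \<le> (\<Sum>i\<in>UNIV. norm ((vector [1, x, y, z] :: complex^4) $ i))"
      unfolding norm_vec_def by (rule L2_set_le_sum) simp
    also have "\<dots> = 1 + norm x + norm y + norm z" by (simp add: sum_4)
    finally show "norm (f x y z) \<le> (M * c1 ^ N * c2 ^ d) * (1 + norm x + norm y + norm z) ^ (N + d)"
      unfolding f_def by (intro growth) auto
  qed blast
  show thesis
  proof (rule that)
    fix q assume q: "affine_point q \<in> proj_zeros {P}"
    have "cpoly_eval F q = poly (Rem (affine_point q)) 0"
      by (simp add: F f_def affine_point_def)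
    also have "\<dots> = g (affine_point q)"
      by (rule Rem_on_cone[OF av1 q]) simp
    finally show "cpoly_eval F q = g (affine_point q)" .
  qed
qed

end

section \<open>Curve germs and charts\<close>

lemma holomorphic_germE:
  fixes \<gamma> :: "complex \<Rightarrow> complex^'n::finite"
  assumes "holomorphic_germ \<gamma>"
  obtains T where "open T" "0 \<in> T" "\<And>i. (\<lambda>\<zeta>. \<gamma> \<zeta> $ i) holomorphic_on T"
proof -
  have "\<forall>i. \<exists>T. open T \<and> 0 \<in> T \<and> (\<lambda>\<zeta>. \<gamma> \<zeta> $ i) holomorphic_on T"
    using assms by (simp add: holomorphic_germ_def analytic_at)
  then obtain T where T: "\<And>i. open (T i) \<and> 0 \<in> T i \<and> (\<lambda>\<zeta>. \<gamma> \<zeta> $ i) holomorphic_on T i"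
    by metis
  show thesis
  proof (rule that)
    show "open (\<Inter>i. T i)" using T by (intro open_INT) auto
    show "0 \<in> (\<Inter>i. T i)" using T by auto
    show "(\<lambda>\<zeta>. \<gamma> \<zeta> $ i) holomorphic_on (\<Inter>i. T i)" for i
      using T[of i] by (auto intro: holomorphic_on_subset)
  qed
qed

lemma holomorphic_germI:
  assumes "open T" "0 \<in> T" "\<And>i. (\<lambda>\<zeta>. \<gamma> \<zeta> $ i) holomorphic_on T"
  shows "holomorphic_germ \<gamma>"
  using assms unfolding holomorphic_germ_def analytic_at by blast

lemma germ_tendsto:
  fixes \<gamma> :: "complex \<Rightarrow> complex^'n::finite"
  assumes "holomorphic_germ \<gamma>"
  shows "filterlim \<gamma> (nhds (\<gamma> 0)) (nhds 0)"
proof -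
  obtain T where T: "open T" "0 \<in> T" "\<And>i. (\<lambda>\<zeta>. \<gamma> \<zeta> $ i) holomorphic_on T"
    using holomorphic_germE[OF assms] by blast
  have "isCont (\<lambda>\<zeta>. \<gamma> \<zeta> $ i) 0" for i
    using holomorphic_on_imp_continuous_on[OF T(3)] T(1,2) by (simp add: continuous_on_eq_continuous_at)
  then have "((\<lambda>\<zeta>. \<gamma> \<zeta>) \<longlongrightarrow> \<gamma> 0) (at 0)"
    unfolding isCont_def by (intro vec_tendstoI)
  then show ?thesis by (simp add: tendsto_at_iff_tendsto_nhds)
qed

lemma holomorphic_on_compose_vec:
  fixes u :: "complex \<Rightarrow> complex^'n::finite"
  assumes "holomorphic_vec f U" "open T" "\<And>i. (\<lambda>\<zeta>. u \<zeta> $ i) holomorphic_on T" "u ` T \<subseteq> U"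
  shows "(\<lambda>\<zeta>. f (u \<zeta>)) holomorphic_on T"
proof (rule holomorphic_onI)
  fix z assume z: "z \<in> T"
  obtain f' where f': "(f has_derivative f') (at (u z))" "\<And>c h. f' (c *s h) = c * f' h"
    using assms(1,4) z by (meson holomorphic_vecE image_subset_iff)
  have "((\<lambda>\<zeta>. u \<zeta> $ i) has_field_derivative deriv (\<lambda>\<zeta>. u \<zeta> $ i) z) (at z)" for i
    by (rule holomorphic_derivI[OF assms(3,2) z])
  then have "(u has_derivative (\<lambda>h. h *s (\<chi> i. deriv (\<lambda>\<zeta>. u \<zeta> $ i) z))) (at z)"
    by (intro has_derivative_vecI) (simp add: has_field_derivative_def mult.commute[of _ "deriv _ _"])
  from has_derivative_compose[OF this f'(1)]
  have "((\<lambda>\<zeta>. f (u \<zeta>)) has_field_derivative f' (\<chi> i. deriv (\<lambda>\<zeta>. u \<zeta> $ i) z)) (at z)"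
    by (simp add: f'(2) has_field_derivative_def mult.commute[of _ "f' _"])
  then show "(\<lambda>\<zeta>. f (u \<zeta>)) field_differentiable at z within T"
    by (meson field_differentiable_at_within field_differentiable_def)
qed

definition hessian :: "'n::finite cpoly \<Rightarrow> complex^'n \<Rightarrow> complex^'n \<Rightarrow> complex" where
  "hessian P v w = (\<Sum>i\<in>UNIV. \<Sum>j\<in>UNIV. cpoly_eval (cpoly_deriv j (cpoly_deriv i P)) v * w $ j * w $ i)"

lemma germ_jet_relations:
  fixes \<gamma> :: "complex \<Rightarrow> complex^'n::finite"
  assumes \<gamma>: "holomorphic_germ \<gamma>" and 0: "\<forall>\<^sub>F \<zeta> in nhds 0. cpoly_eval P (\<gamma> \<zeta>) = 0"
  shows "(\<Sum>i\<in>UNIV. cpoly_eval (cpoly_deriv i P) (\<gamma> 0) * jet1 \<gamma> i) = 0"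
    "(\<Sum>i\<in>UNIV. cpoly_eval (cpoly_deriv i P) (\<gamma> 0) * jet2 \<gamma> i) + hessian P (\<gamma> 0) (\<chi> i. jet1 \<gamma> i) = 0"
proof -
  obtain T1 where T1: "open T1" "0 \<in> T1" "\<And>i. (\<lambda>\<zeta>. \<gamma> \<zeta> $ i) holomorphic_on T1"
    using holomorphic_germE[OF \<gamma>] by blast
  obtain T2 where T2: "open T2" "0 \<in> T2" "\<And>\<zeta>. \<zeta> \<in> T2 \<Longrightarrow> cpoly_eval P (\<gamma> \<zeta>) = 0"
    using 0 unfolding eventually_nhds by blast
  define T where "T = T1 \<inter> T2"
  have T: "open T" "0 \<in> T" using T1 T2 by (auto simp: T_def)
  have hol: "(\<lambda>\<zeta>. \<gamma> \<zeta> $ i) holomorphic_on T" for i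
    using T1(3) by (rule holomorphic_on_subset) (auto simp: T_def)
  have d1: "((\<lambda>\<zeta>. \<gamma> \<zeta> $ i) has_field_derivative deriv (\<lambda>\<zeta>. \<gamma> \<zeta> $ i) z) (at z)" if "z \<in> T" for z i
    by (rule holomorphic_derivI[OF hol T(1) that])
  have d2: "(deriv (\<lambda>\<zeta>. \<gamma> \<zeta> $ i) has_field_derivative jet2 \<gamma> i) (at 0)" for i
    by (rule holomorphic_derivI[OF holomorphic_deriv[OF hol T(1)] T])
  have zero: "(f has_field_derivative 0) (at z)" if "z \<in> T" "\<And>\<zeta>. \<zeta> \<in> T \<Longrightarrow> f \<zeta> = 0" for z and f :: "complex \<Rightarrow> complex"
    by (rule DERIV_cong_ev[THEN iffD2, OF refl _ refl DERIV_const[of 0]])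
       (use that T(1) in \<open>auto simp: eventually_nhds\<close>)
  have r1: "(\<Sum>i\<in>UNIV. cpoly_eval (cpoly_deriv i P) (\<gamma> z) * deriv (\<lambda>\<zeta>. \<gamma> \<zeta> $ i) z) = 0" if z: "z \<in> T" for z
    by (rule DERIV_unique[OF cpoly_eval_chain[OF d1[OF z]] zero[OF z]]) (auto simp: T_def T2(3))
  from r1[OF T(2)] show "(\<Sum>i\<in>UNIV. cpoly_eval (cpoly_deriv i P) (\<gamma> 0) * jet1 \<gamma> i) = 0" .
  have "((\<lambda>z. \<Sum>i\<in>UNIV. cpoly_eval (cpoly_deriv i P) (\<gamma> z) * deriv (\<lambda>\<zeta>. \<gamma> \<zeta> $ i) z) has_field_derivative
     (\<Sum>i\<in>UNIV. cpoly_eval (cpoly_deriv i P) (\<gamma> 0) * jet2 \<gamma> i +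
        (\<Sum>j\<in>UNIV. cpoly_eval (cpoly_deriv j (cpoly_deriv i P)) (\<gamma> 0) * jet1 \<gamma> j) * jet1 \<gamma> i)) (at 0)"
    by (intro DERIV_sum DERIV_mult' cpoly_eval_chain d1 d2 T(2))
  from DERIV_unique[OF this zero[OF T(2) r1]]
  show "(\<Sum>i\<in>UNIV. cpoly_eval (cpoly_deriv i P) (\<gamma> 0) * jet2 \<gamma> i) + hessian P (\<gamma> 0) (\<chi> i. jet1 \<gamma> i) = 0"
    by (simp add: hessian_def sum.distrib sum_distrib_right)
qed

text \<open>The second derivative is displayed with a separate multiple 2 h'/h of the first
  derivative, because that part cancels in the determinants x' y'' - y' x''.\<close>

lemma quotient_jets:
  assumes T: "open T" "0 \<in> T" and f: "f holomorphic_on T" and h: "h holomorphic_on T" and h0: "h 0 \<noteq> 0"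
  shows "(\<lambda>\<zeta>. f \<zeta> / h \<zeta>) analytic_on {0}"
    "deriv (\<lambda>\<zeta>. f \<zeta> / h \<zeta>) 0 = (deriv f 0 * h 0 - f 0 * deriv h 0) / h 0 ^ 2"
    "deriv (deriv (\<lambda>\<zeta>. f \<zeta> / h \<zeta>)) 0 = (deriv (deriv f) 0 * h 0 - f 0 * deriv (deriv h) 0) / h 0 ^ 2
       - 2 * deriv h 0 * (deriv f 0 * h 0 - f 0 * deriv h 0) / h 0 ^ 3"
proof -
  define T' where "T' = T \<inter> h -` (-{0})"
  have "open T'"
    unfolding T'_def by (rule continuous_open_preimage[OF holomorphic_on_imp_continuous_on[OF h] T(1)]) auto
  then have T': "open T'" "0 \<in> T'" "\<And>z. z \<in> T' \<Longrightarrow> h z \<noteq> 0" "T' \<subseteq> T"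
    using T(2) h0 by (auto simp: T'_def)
  have f': "(f has_field_derivative deriv f z) (at z)" and h': "(h has_field_derivative deriv h z) (at z)"
    and f'': "(deriv f has_field_derivative deriv (deriv f) z) (at z)" and h'': "(deriv h has_field_derivative deriv (deriv h) z) (at z)"
    if "z \<in> T'" for z
    using that T'(4) T(1) f h by (auto intro!: holomorphic_derivI[of _ T] holomorphic_deriv)
  have d: "deriv (\<lambda>\<zeta>. f \<zeta> / h \<zeta>) z = (deriv f z * h z - f z * deriv h z) / (h z * h z)" if "z \<in> T'" for z
    by (rule DERIV_imp_deriv, rule DERIV_divide[OF f'[OF that] h'[OF that] T'(3)[OF that]])
  show "(\<lambda>\<zeta>. f \<zeta> / h \<zeta>) analytic_on {0}"
    unfolding analytic_at using T'
    by (intro exI[of _ T'] conjI holomorphic_intros) (auto intro: holomorphic_on_subset f h)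
  show "deriv (\<lambda>\<zeta>. f \<zeta> / h \<zeta>) 0 = (deriv f 0 * h 0 - f 0 * deriv h 0) / h 0 ^ 2"
    using d[OF T'(2)] by (simp add: power2_eq_square)
  have ev: "\<forall>\<^sub>F z in nhds 0. deriv (\<lambda>\<zeta>. f \<zeta> / h \<zeta>) z = (deriv f z * h z - f z * deriv h z) / (h z * h z)"
    using T' d by (auto simp: eventually_nhds)
  have "deriv (deriv (\<lambda>\<zeta>. f \<zeta> / h \<zeta>)) 0 = deriv (\<lambda>z. (deriv f z * h z - f z * deriv h z) / (h z * h z)) 0"
    by (rule deriv_cong_ev[OF ev refl])
  also have "\<dots> = (deriv (deriv f) 0 * h 0 - f 0 * deriv (deriv h) 0) / h 0 ^ 2
       - 2 * deriv h 0 * (deriv f 0 * h 0 - f 0 * deriv h 0) / h 0 ^ 3"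
    by (rule DERIV_imp_deriv)
       (use h0 in \<open>auto intro!: derivative_eq_intros f'[OF T'(2)] h'[OF T'(2)] f''[OF T'(2)] h''[OF T'(2)]
          simp: field_simps power2_eq_square power3_eq_cube\<close>)
  finally show "deriv (deriv (\<lambda>\<zeta>. f \<zeta> / h \<zeta>)) 0 = (deriv (deriv f) 0 * h 0 - f 0 * deriv (deriv h) 0) / h 0 ^ 2
       - 2 * deriv h 0 * (deriv f 0 * h 0 - f 0 * deriv h 0) / h 0 ^ 3" .
qed

lemma coordinate_indices:
  fixes l i :: 4
  assumes "l \<noteq> i"
  obtains a b where "distinct [a, b, l, i]" "UNIV = {a, b, l, i}"
proof -
  have "\<exists>a b. distinct [a, b, l, i] \<and> UNIV = {a, b, l, i}"
    using assms exhaust_4[of l] exhaust_4[of i] unfolding UNIV_4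
    by (elim disjE; simp)
       (rule exI[of _ 1] exI[of _ 2] exI[of _ 3] exI[of _ 4]; rule exI[of _ 1] exI[of _ 2] exI[of _ 3] exI[of _ 4]; force)+
  then show thesis using that by blast
qed

section \<open>Charts that present the surface as a graph\<close>

lemma proj_zeros_scale:
  assumes "homogeneous d P" "c \<noteq> 0"
  shows "c *s v \<in> proj_zeros {P} \<longleftrightarrow> v \<in> proj_zeros {P}"
  using assms(2) by (simp add: proj_zeros_def cpoly_eval_scale[OF assms(1)] vector_mul_eq_0)

definition chart_coords :: "4 \<Rightarrow> 4 \<Rightarrow> 4 \<Rightarrow> complex^4 \<Rightarrow> complex^2" where
  "chart_coords a b l v = vector [v $ a / v $ l, v $ b / v $ l]"

text \<open>The coordinate \<open>l\<close> is normalized to 1 and \<open>i\<close> is a holomorphic function of the affine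
  coordinates \<open>a\<close> and \<open>b\<close>.\<close>

definition graph_chart ::
  "4 cpoly \<Rightarrow> 4 \<Rightarrow> 4 \<Rightarrow> 4 \<Rightarrow> 4 \<Rightarrow> (complex^2) set \<Rightarrow> (complex^2 \<Rightarrow> complex^4) \<Rightarrow> (complex^4) set \<Rightarrow> bool" where
  "graph_chart P a b l i U \<phi> W \<longleftrightarrow>
     distinct [a, b, l, i] \<and> UNIV = {a, b, l, i} \<and> surface_chart P U \<phi> \<and> open W \<and>
     (\<forall>u\<in>U. \<phi> u $ l = 1 \<and> \<phi> u $ a = u $ 1 \<and> \<phi> u $ b = u $ 2) \<and>
     (\<forall>v\<in>W. v $ l \<noteq> 0 \<and> cpoly_eval (cpoly_deriv i P) v \<noteq> 0 \<and> chart_coords a b l v \<in> U \<and>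
        (v \<in> proj_zeros {P} \<longrightarrow> v = v $ l *s \<phi> (chart_coords a b l v)))"

lemma vec2_eq_iff: "x = y \<longleftrightarrow> x $ 1 = y $ 1 \<and> x $ 2 = y $ 2" for x y :: "'a^2"
  by (simp add: vec_eq_iff forall_2)

text \<open>The coordinate l fixes the scale and the coordinates a, b return the parameters, so
  injectivity and immersivity are read off from these three components alone.\<close>

lemma surface_chartI:
  assumes U: "open U" and hol: "\<And>j. holomorphic_vec (\<lambda>p. \<phi> p $ j) U"
    and zeros: "\<phi> ` U \<subseteq> proj_zeros {P}"
    and coords: "\<And>u. u \<in> U \<Longrightarrow> \<phi> u $ l = 1 \<and> \<phi> u $ a = u $ 1 \<and> \<phi> u $ b = u $ 2"
  shows "surface_chart P U \<phi>"
proof -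
  have "p = q" if pq: "p \<in> U" "q \<in> U" "proj_eq (\<phi> p) (\<phi> q)" for p q
  proof -
    from pq obtain c where c: "\<phi> q = c *s \<phi> p" by (auto simp: proj_eq_def)
    from arg_cong[OF c, of "\<lambda>x. x $ l"] have "c = 1" using coords pq by simp
    with c have "\<phi> p = \<phi> q" by simp
    then show "p = q" using coords[OF pq(1)] coords[OF pq(2)] by (simp add: vec2_eq_iff)
  qed
  moreover have "c = 0 \<and> h = 0" if p: "p \<in> U" and 0: "c *s \<phi> p + frechet_derivative \<phi> (at p) h = 0" for p c h
  proof -
    have "\<forall>j. \<exists>D. ((\<lambda>u. \<phi> u $ j) has_derivative D) (at p)"
      using hol p by (meson holomorphic_vecE)
    then obtain D where D: "\<And>j. ((\<lambda>u. \<phi> u $ j) has_derivative D j) (at p)" by metis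
    then have "(\<phi> has_derivative (\<lambda>h. \<chi> j. D j h)) (at p)"
      by (intro has_derivative_vecI) simp
    then have fd: "frechet_derivative \<phi> (at p) h = (\<chi> j. D j h)"
      by (simp add: frechet_derivative_at[symmetric])
    have "((\<lambda>u. 1) has_derivative D l) (at p)"
      by (rule has_derivative_transform_within_open[OF D U p]) (use coords in auto)
    then have "D l = (\<lambda>_. 0)" by (rule has_derivative_unique) simp
    with arg_cong[OF 0, of "\<lambda>x. x $ l"] have c: "c = 0" using coords[OF p] by (simp add: fd)
    have nth: "((\<lambda>u. u $ j) has_derivative (\<lambda>h. h $ j)) (at p)" for j
      by (rule bounded_linear_imp_has_derivative[OF bounded_linear_vec_nth])
    have "((\<lambda>u. u $ 1) has_derivative D a) (at p)"
      by (rule has_derivative_transform_within_open[OF D U p]) (use coords in auto)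
    then have Da: "D a = (\<lambda>h. h $ 1)" using nth by (rule has_derivative_unique)
    have "((\<lambda>u. u $ 2) has_derivative D b) (at p)"
      by (rule has_derivative_transform_within_open[OF D U p]) (use coords in auto)
    then have Db: "D b = (\<lambda>h. h $ 2)" using nth by (rule has_derivative_unique)
    have "h $ 1 = 0" using arg_cong[OF 0, of "\<lambda>x. x $ a"] c by (simp add: fd Da)
    moreover have "h $ 2 = 0" using arg_cong[OF 0, of "\<lambda>x. x $ b"] c by (simp add: fd Db)
    ultimately show "c = 0 \<and> h = 0" using c by (simp add: vec2_eq_iff)
  qed
  ultimately show ?thesis
    unfolding surface_chart_def using U hol zeros by blast
qed

text \<open>The map f replaces the coordinate i by the value of P and is locally invertible where
  P_i is nonzero. Its inverse on the slice with value 0 in place i and 1 in place l is the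
  graph.\<close>

lemma graph_chart_exists:
  assumes hom: "homogeneous d P" and d: "d \<ge> 1" and sm: "smooth_form P" and v0: "v0 \<in> proj_zeros {P}"
  obtains a b l i U \<phi> W where "graph_chart P a b l i U \<phi> W" "v0 \<in> W"
proof -
  have P0: "cpoly_eval P v0 = 0" "v0 \<noteq> 0" using v0 by (auto simp: proj_zeros_def)
  obtain i where i: "cpoly_eval (cpoly_deriv i P) v0 \<noteq> 0"
    using sm v0 by (auto simp: smooth_form_def)
  \<comment> \<open>If only the coordinate i were nonzero, Euler's relation would reduce to P_i v_i
    = 0 and force v0 = 0.\<close>
  have "\<exists>l. l \<noteq> i \<and> v0 $ l \<noteq> 0"
  proof (rule ccontr)
    assume "\<not> ?thesis"
    then have z: "v0 $ l = 0" if "l \<noteq> i" for l using that by auto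
    have "(\<Sum>j\<in>UNIV. cpoly_eval (cpoly_deriv j P) v0 * v0 $ j) =
       (\<Sum>j\<in>UNIV. if j = i then cpoly_eval (cpoly_deriv i P) v0 * v0 $ i else 0)"
      by (rule sum.cong) (auto simp: z)
    then have "v0 $ i = 0" using euler_relation[OF hom, of v0] P0 i by simp
    then have "v0 = 0" using z by (metis vec_eq_iff zero_index)
    with P0 show False by simp
  qed
  then obtain l where l: "l \<noteq> i" "v0 $ l \<noteq> 0" by blast
  obtain a b where ab: "distinct [a, b, l, i]" "UNIV = {a, b, l, i}"
    using coordinate_indices[OF l(1)] by blast
  have cases4: "c = a \<or> c = b \<or> c = l \<or> c = i" for c using ab(2) by blast
  define f where "f v = (\<chi> c. if c = i then cpoly_eval P v else v $ c)" for v :: "complex^4"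
  define f' where "f' v h = (\<chi> c. if c = i then (\<Sum>j\<in>UNIV. cpoly_eval (cpoly_deriv j P) v * h $ j) else h $ c)" for v h :: "complex^4"
  have f': "(f has_derivative f' v) (at v)" for v
  proof (rule has_derivative_vecI)
    show "((\<lambda>x. f x $ c) has_derivative (\<lambda>h. f' v h $ c)) (at v)" for c
      by (cases "c = i")
         (auto simp: f_def f'_def has_derivative_cpoly_eval intro: bounded_linear_imp_has_derivative[OF bounded_linear_vec_nth])
  qed
  have f'_scale: "f' v (c *s h) = c *s f' v h" for v c h
    by (simp add: f'_def vec_eq_iff sum_distrib_left mult_ac)
  have bl: "bounded_linear (f' v)" for v using f' by (rule has_derivative_bounded_linear)
  define F' where "F' v = Blinfun (f' v)" for v
  have F': "blinfun_apply (F' v) = f' v" for v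
    unfolding F'_def by (rule bounded_linear_Blinfun_apply[OF bl])
  have cF': "continuous_on UNIV F'"
  proof (rule continuous_on_blinfun_componentwise)
    fix h :: "complex^4"
    show "continuous_on UNIV (\<lambda>v. F' v h)"
      unfolding F' f'_def
    proof (rule continuous_on_vec_lambda)
      fix c
      show "continuous_on UNIV (\<lambda>v. if c = i then \<Sum>j\<in>UNIV. cpoly_eval (cpoly_deriv j P) v * h $ j else h $ c)"
        by (cases "c = i") (auto intro!: continuous_intros)
    qed
  qed
  define x0 where "x0 = (1 / v0 $ l) *s v0"
  have Pi0: "cpoly_eval (cpoly_deriv i P) x0 \<noteq> 0"
    using i l(2) by (simp add: x0_def cpoly_deriv_scale[OF hom d])
  have inj: "inj (f' x0)"
    unfolding linear_injective_0[OF bounded_linear.linear[OF bl]]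
  proof (intro allI impI)
    fix h assume h: "f' x0 h = 0"
    have z: "h $ c = 0" if "c \<noteq> i" for c
      using arg_cong[OF h, of "\<lambda>x. x $ c"] that by (simp add: f'_def)
    have "(\<Sum>j\<in>UNIV. cpoly_eval (cpoly_deriv j P) x0 * h $ j) =
       (\<Sum>j\<in>UNIV. if j = i then cpoly_eval (cpoly_deriv i P) x0 * h $ i else 0)"
      by (rule sum.cong) (auto simp: z)
    then have "h $ i = 0" using arg_cong[OF h, of "\<lambda>x. x $ i"] Pi0 by (simp add: f'_def)
    with z show "h = 0" by (metis vec_eq_iff zero_index)
  qed
  obtain k where k: "linear k" "k \<circ> f' x0 = id"
    using linear_injective_left_inverse[OF bounded_linear.linear[OF bl] inj] by blast
  have "Blinfun k o\<^sub>L F' x0 = id_blinfun"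
  proof (rule blinfun_eqI)
    fix h
    show "blinfun_apply (Blinfun k o\<^sub>L F' x0) h = blinfun_apply id_blinfun h"
      using k(2) bounded_linear_Blinfun_apply[of k] k(1)
      by (simp add: F' linear_conv_bounded_linear fun_eq_iff)
  qed
  from inverse_function_theorem[OF open_UNIV f'[folded F'] cF' UNIV_I this]
  obtain U' V g g' where g: "open U'" "x0 \<in> U'" "open V" "homeomorphism U' V f g"
    "\<And>y. y \<in> V \<Longrightarrow> (g has_derivative (g' y)) (at y)"
    "\<And>y. y \<in> V \<Longrightarrow> g' y = inv (f' (g y))"
    "\<And>y. y \<in> V \<Longrightarrow> bij (f' (g y))"
    unfolding F' by metis
  have fg: "f (g y) = y" if "y \<in> V" for y
    using g(4) that by (simp add: homeomorphism_def)
  have gf: "g (f x) = x" "f x \<in> V" if "x \<in> U'" for x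
    using g(4) that by (auto simp: homeomorphism_def)
  have holg: "holomorphic_vec (\<lambda>y. g y $ c) V" for c
  proof (rule holomorphic_vecI)
    fix y assume y: "y \<in> V"
    \<comment> \<open>The inverse function theorem used is a real one; complex linearity of the
      inverse derivative is recovered from that of f'.\<close>
    have sc: "g' y (s *s h) = s *s g' y h" for s h
    proof -
      have "f' (g y) (s *s g' y h) = s *s h"
        using g(7)[OF y] by (simp add: f'_scale g(6)[OF y] bij_is_surj surj_f_inv_f)
      then show ?thesis
        unfolding g(6)[OF y] using g(7)[OF y] by (intro inv_f_eq) (auto simp: bij_is_inj)
    qed
    have "((\<lambda>y. g y $ c) has_derivative (\<lambda>h. g' y h $ c)) (at y)"
      by (rule bounded_linear.has_derivative[OF bounded_linear_vec_nth g(5)[OF y]])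
    then show "\<exists>D. ((\<lambda>y. g y $ c) has_derivative D) (at y) \<and> (\<forall>s h. D (s *s h) = s * D h)"
      by (intro exI[of _ "\<lambda>h. g' y h $ c"]) (simp add: sc)
  qed
  define E where "E u = (\<chi> c. if c = l then 1 else if c = a then u $ 1 else if c = b then u $ 2 else 0)"
    for u :: "complex^2"
  have E: "E u $ l = 1" "E u $ a = u $ 1" "E u $ b = u $ 2" "E u $ i = 0" for u
    using ab(1) by (auto simp: E_def)
  have holE: "holomorphic_vec (\<lambda>u. E u $ c) T" for c T
    using cases4[of c] E by (auto intro!: hol_intros)
  have contE: "continuous_on T E" for T
    using continuous_on_vec_lambda[of T "\<lambda>c u. E u $ c", OF holomorphic_vec_continuous_on[OF holE[of _ T]]] by simp
  define U where "U = E -` V"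
  define \<phi> where "\<phi> u = g (E u)" for u
  have opU: "open U" unfolding U_def by (rule open_vimage[OF g(3) contE])
  have \<phi>nth: "\<phi> u $ c = E u $ c" "cpoly_eval P (\<phi> u) = 0" if "u \<in> U" "c \<noteq> i" for u c
  proof -
    have *: "f (\<phi> u) = E u" unfolding \<phi>_def by (rule fg) (use that in \<open>simp add: U_def\<close>)
    show "\<phi> u $ c = E u $ c" using arg_cong[OF *, of "\<lambda>x. x $ c"] that by (simp add: f_def)
    show "cpoly_eval P (\<phi> u) = 0" using arg_cong[OF *, of "\<lambda>x. x $ i"] E by (simp add: f_def)
  qed
  have coords: "\<phi> u $ l = 1 \<and> \<phi> u $ a = u $ 1 \<and> \<phi> u $ b = u $ 2" if "u \<in> U" for u
    using \<phi>nth(1)[OF that] ab(1) E by auto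
  have chart: "surface_chart P U \<phi>"
  proof (rule surface_chartI[OF opU _ _ coords])
    show "holomorphic_vec (\<lambda>p. \<phi> p $ j) U" for j
      unfolding \<phi>_def by (rule holomorphic_vec_compose[OF holg holE]) (simp add: U_def)
    show "\<phi> ` U \<subseteq> proj_zeros {P}"
    proof
      fix x assume "x \<in> \<phi> ` U"
      then obtain u where u: "u \<in> U" "x = \<phi> u" by blast
      have "x \<noteq> 0" using coords[OF u(1)] u(2) by auto
      then show "x \<in> proj_zeros {P}"
        using \<phi>nth(2)[OF u(1) l(1)] u(2) by (simp add: proj_zeros_def)
    qed
  qed
  define W1 where "W1 = {v :: complex^4. v $ l \<noteq> 0 \<and> cpoly_eval (cpoly_deriv i P) v \<noteq> 0}"
  have opW1: "open W1"
    unfolding W1_def by (intro open_Collect_conj open_Collect_neq continuous_intros)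
  define W where "W = (W1 \<inter> (\<lambda>v. (1 / v $ l) *s v) -` U') \<inter> (W1 \<inter> chart_coords a b l -` U)"
  have "open W"
  proof -
    have 1: "continuous_on W1 (\<lambda>v. (1 / v $ l) *s v)"
      by (intro continuous_intros) (auto simp: W1_def)
    have "continuous_on W1 (\<lambda>v. chart_coords a b l v $ c)" for c
      using exhaust_2[of c] unfolding chart_coords_def
      by (elim disjE; simp; intro continuous_intros) (auto simp: W1_def)
    from continuous_on_vec_lambda[of W1 "\<lambda>c v. chart_coords a b l v $ c", OF this]
    have 2: "continuous_on W1 (chart_coords a b l)" by simp
    show ?thesis
      unfolding W_def
      by (rule open_Int[OF continuous_open_preimage[OF 1 opW1 g(1)] continuous_open_preimage[OF 2 opW1 opU]])
  qed
  have key: "f ((1 / v $ l) *s v) = E (chart_coords a b l v)" if "v \<in> proj_zeros {P}" "v $ l \<noteq> 0" for v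
  proof -
    have "f ((1 / v $ l) *s v) $ c = E (chart_coords a b l v) $ c" for c
      using cases4[of c] ab(1) that E
      by (auto simp: f_def chart_coords_def cpoly_eval_scale[OF hom] proj_zeros_def)
    then show ?thesis by (simp add: vec_eq_iff)
  qed
  have "graph_chart P a b l i U \<phi> W"
    unfolding graph_chart_def
  proof (intro conjI ab chart \<open>open W\<close> ballI impI)
    fix v assume v: "v \<in> W" "v \<in> proj_zeros {P}"
    then have vl: "v $ l \<noteq> 0" "(1 / v $ l) *s v \<in> U'" by (auto simp: W_def W1_def)
    have "\<phi> (chart_coords a b l v) = (1 / v $ l) *s v"
      unfolding \<phi>_def using key[OF v(2) vl(1)] gf(1)[OF vl(2)] by simp
    then show "v = v $ l *s \<phi> (chart_coords a b l v)"
      using vl(1) by (simp add: vec_eq_iff)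
  qed (use coords in \<open>auto simp: W_def W1_def\<close>)
  moreover have "v0 \<in> W"
    using i l(2) g(2) gf(2)[OF g(2)] key[OF v0 l(2)]
    by (simp add: W_def W1_def U_def x0_def)
  ultimately show thesis by (rule that)
qed

section \<open>Coefficients of jet differentials\<close>

definition jet_sum :: "nat \<Rightarrow> (nat \<Rightarrow> nat \<Rightarrow> complex) \<Rightarrow> complex \<Rightarrow> complex \<Rightarrow> complex \<Rightarrow> complex" where
  "jet_sum n c \<xi> \<eta> \<omega> = (\<Sum>k\<le>n div 3. \<Sum>j\<le>n - 3 * k. c j k * \<eta> ^ j * \<xi> ^ (n - 3 * k - j) * \<omega> ^ k)"

text \<open>Isobaric polynomials with unspecified coefficients: closure under sums and products lets
  the jets of an arbitrary chart be substituted without computing any coefficient. The coefficients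
  are holomorphic on the open set W and not merely on the cone.\<close>

definition jet_poly ::
  "(complex^4) set \<Rightarrow> nat \<Rightarrow> (complex^4 \<Rightarrow> complex \<Rightarrow> complex \<Rightarrow> complex \<Rightarrow> complex) \<Rightarrow> bool" where
  "jet_poly W n F \<longleftrightarrow> (\<exists>c. (\<forall>j k. holomorphic_vec (c j k) W) \<and>
     (\<forall>v\<in>W. \<forall>\<xi> \<eta> \<omega>. F v \<xi> \<eta> \<omega> = jet_sum n (\<lambda>j k. c j k v) \<xi> \<eta> \<omega>))"

lemma jet_poly_monom:
  assumes "holomorphic_vec c W" "a + b + 3 * k = n"
  shows "jet_poly W n (\<lambda>v \<xi> \<eta> \<omega>. c v * \<eta> ^ a * \<xi> ^ b * \<omega> ^ k)"
  unfolding jet_poly_def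
proof (intro exI conjI allI ballI)
  define C where "C j' k' v = (if j' = a then if k' = k then c v else 0 else 0)" for j' k' v
  show "holomorphic_vec (C j' k') W" for j' k'
    unfolding C_def using assms(1) by (cases "j' = a"; cases "k' = k") (auto intro!: hol_intros)
  fix v \<xi> \<eta> \<omega>
  have "jet_sum n (\<lambda>j k. C j k v) \<xi> \<eta> \<omega> =
     (\<Sum>k'\<le>n div 3. \<Sum>j\<le>n - 3 * k'. if j = a then if k' = k then c v * \<eta> ^ a * \<xi> ^ b * \<omega> ^ k else 0 else 0)"
    unfolding jet_sum_def C_def using assms(2) by (intro sum.cong refl) auto
  also have "\<dots> = (\<Sum>k'\<le>n div 3. if k' = k then c v * \<eta> ^ a * \<xi> ^ b * \<omega> ^ k else 0)"
    using assms(2) by (intro sum.cong refl) (auto simp: sum.delta)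
  also have "\<dots> = c v * \<eta> ^ a * \<xi> ^ b * \<omega> ^ k"
    using assms(2) by (subst sum.delta) auto
  finally show "c v * \<eta> ^ a * \<xi> ^ b * \<omega> ^ k = jet_sum n (\<lambda>j k. C j k v) \<xi> \<eta> \<omega>" ..
qed

lemma jet_poly_add:
  assumes "jet_poly W n F" "jet_poly W n G"
  shows "jet_poly W n (\<lambda>v \<xi> \<eta> \<omega>. F v \<xi> \<eta> \<omega> + G v \<xi> \<eta> \<omega>)"
proof -
  obtain c where c: "\<forall>j k. holomorphic_vec (c j k) W"
    "\<forall>v\<in>W. \<forall>\<xi> \<eta> \<omega>. F v \<xi> \<eta> \<omega> = jet_sum n (\<lambda>j k. c j k v) \<xi> \<eta> \<omega>"
    using assms(1) by (auto simp: jet_poly_def)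
  obtain e where e: "\<forall>j k. holomorphic_vec (e j k) W"
    "\<forall>v\<in>W. \<forall>\<xi> \<eta> \<omega>. G v \<xi> \<eta> \<omega> = jet_sum n (\<lambda>j k. e j k v) \<xi> \<eta> \<omega>"
    using assms(2) by (auto simp: jet_poly_def)
  show ?thesis
    unfolding jet_poly_def
    by (rule exI[of _ "\<lambda>j k v. c j k v + e j k v"])
       (use c e in \<open>auto intro!: hol_intros simp: jet_sum_def sum.distrib ring_distribs\<close>)
qed

lemma jet_poly_0: "jet_poly W n (\<lambda>v \<xi> \<eta> \<omega>. 0)"
  unfolding jet_poly_def
  by (rule exI[of _ "\<lambda>j k v. 0"]) (auto intro!: hol_intros simp: jet_sum_def)

lemma jet_poly_sum:
  "(\<And>x. x \<in> A \<Longrightarrow> jet_poly W n (F x)) \<Longrightarrow> jet_poly W n (\<lambda>v \<xi> \<eta> \<omega>. \<Sum>x\<in>A. F x v \<xi> \<eta> \<omega>)"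
  by (induction A rule: infinite_finite_induct) (auto intro!: jet_poly_add jet_poly_0)

lemma jet_poly_cong:
  assumes "jet_poly W n F" "\<And>v \<xi> \<eta> \<omega>. v \<in> W \<Longrightarrow> G v \<xi> \<eta> \<omega> = F v \<xi> \<eta> \<omega>"
  shows "jet_poly W n G"
  using assms unfolding jet_poly_def by simp

lemma jet_poly_mult:
  assumes "jet_poly W n F" "jet_poly W m G"
  shows "jet_poly W (n + m) (\<lambda>v \<xi> \<eta> \<omega>. F v \<xi> \<eta> \<omega> * G v \<xi> \<eta> \<omega>)"
proof -
  obtain c where c: "\<forall>j k. holomorphic_vec (c j k) W"
    "\<forall>v\<in>W. \<forall>\<xi> \<eta> \<omega>. F v \<xi> \<eta> \<omega> = jet_sum n (\<lambda>j k. c j k v) \<xi> \<eta> \<omega>"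
    using assms(1) by (auto simp: jet_poly_def)
  obtain e where e: "\<forall>j k. holomorphic_vec (e j k) W"
    "\<forall>v\<in>W. \<forall>\<xi> \<eta> \<omega>. G v \<xi> \<eta> \<omega> = jet_sum m (\<lambda>j k. e j k v) \<xi> \<eta> \<omega>"
    using assms(2) by (auto simp: jet_poly_def)
  have "jet_poly W (n + m) (\<lambda>v \<xi> \<eta> \<omega>. \<Sum>k\<le>n div 3. \<Sum>j\<le>n - 3 * k. \<Sum>k'\<le>m div 3. \<Sum>j'\<le>m - 3 * k'.
     (c j k v * e j' k' v) * \<eta> ^ (j + j') * \<xi> ^ ((n - 3 * k - j) + (m - 3 * k' - j')) * \<omega> ^ (k + k'))"
  proof (intro jet_poly_sum jet_poly_monom)
    fix k j k' j' assume "k \<in> {..n div 3}" "j \<in> {..n - 3 * k}" "k' \<in> {..m div 3}" "j' \<in> {..m - 3 * k'}"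
    then have "3 * k \<le> n" "3 * k' \<le> m" "j \<le> n - 3 * k" "j' \<le> m - 3 * k'" by auto
    then show "j + j' + (n - 3 * k - j + (m - 3 * k' - j')) + 3 * (k + k') = n + m" by simp
    show "holomorphic_vec (\<lambda>v. c j k v * e j' k' v) W" using c e by (auto intro!: hol_intros)
  qed
  then show ?thesis
  proof (rule jet_poly_cong)
    fix v \<xi> \<eta> \<omega> assume v: "v \<in> W"
    then have "F v \<xi> \<eta> \<omega> * G v \<xi> \<eta> \<omega> = jet_sum n (\<lambda>j k. c j k v) \<xi> \<eta> \<omega> * jet_sum m (\<lambda>j k. e j k v) \<xi> \<eta> \<omega>"
      using c e by simp
    also have "\<dots> = (\<Sum>k\<le>n div 3. \<Sum>j\<le>n - 3 * k. \<Sum>k'\<le>m div 3. \<Sum>j'\<le>m - 3 * k'.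
     (c j k v * e j' k' v) * \<eta> ^ (j + j') * \<xi> ^ ((n - 3 * k - j) + (m - 3 * k' - j')) * \<omega> ^ (k + k'))"
      unfolding jet_sum_def sum_distrib_right unfolding sum_distrib_left
      by (intro sum.cong refl) (simp only: power_add mult_ac)
    finally show "F v \<xi> \<eta> \<omega> * G v \<xi> \<eta> \<omega> = \<dots>" .
  qed
qed

lemma jet_poly_coeff: "holomorphic_vec c W \<Longrightarrow> jet_poly W 0 (\<lambda>v \<xi> \<eta> \<omega>. c v)"
  using jet_poly_monom[of c W 0 0 0 0] by simp

lemma jet_poly_coeff_mult:
  assumes "holomorphic_vec c W" "jet_poly W n F"
  shows "jet_poly W n (\<lambda>v \<xi> \<eta> \<omega>. c v * F v \<xi> \<eta> \<omega>)"
  using jet_poly_mult[OF jet_poly_coeff[OF assms(1)] assms(2)] by simp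

lemma jet_poly_uminus: "jet_poly W n F \<Longrightarrow> jet_poly W n (\<lambda>v \<xi> \<eta> \<omega>. - F v \<xi> \<eta> \<omega>)"
  using jet_poly_coeff_mult[OF holomorphic_vec_const[of "-1"]] by simp

lemma jet_poly_diff:
  "jet_poly W n F \<Longrightarrow> jet_poly W n G \<Longrightarrow> jet_poly W n (\<lambda>v \<xi> \<eta> \<omega>. F v \<xi> \<eta> \<omega> - G v \<xi> \<eta> \<omega>)"
  using jet_poly_add[OF _ jet_poly_uminus, of W n F G] by simp

lemma jet_poly_power:
  "jet_poly W n F \<Longrightarrow> jet_poly W (k * n) (\<lambda>v \<xi> \<eta> \<omega>. F v \<xi> \<eta> \<omega> ^ k)"
  by (induction k) (auto intro!: jet_poly_mult jet_poly_coeff hol_intros)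

lemma jet_poly_vars:
  "jet_poly W 1 (\<lambda>v \<xi> \<eta> \<omega>. \<xi>)" "jet_poly W 1 (\<lambda>v \<xi> \<eta> \<omega>. \<eta>)" "jet_poly W 3 (\<lambda>v \<xi> \<eta> \<omega>. \<omega>)"
  using jet_poly_monom[OF holomorphic_vec_const[of 1], of 0 1 0 1 W]
    jet_poly_monom[OF holomorphic_vec_const[of 1], of 1 0 0 1 W]
    jet_poly_monom[OF holomorphic_vec_const[of 1], of 0 0 1 3 W]
  by simp_all

text \<open>The tangent vector with \<open>T' = 0\<close>, \<open>X' = P\<^sub>Z \<xi>\<close> and \<open>Y' = P\<^sub>Z \<eta>\<close>. Unlike \<open>Z'\<close> as a function of \<open>X'\<close> and
  \<open>Y'\<close>, it stays finite where \<open>P\<^sub>Z = 0\<close>; this is what bounds the pole order along \<open>R\<^sub>z = 0\<close>.\<close>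

definition tangent :: "4 cpoly \<Rightarrow> complex^4 \<Rightarrow> complex \<Rightarrow> complex \<Rightarrow> complex^4" where
  "tangent P v \<xi> \<eta> = vector [0, cpoly_eval (cpoly_deriv 4 P) v * \<xi>, cpoly_eval (cpoly_deriv 4 P) v * \<eta>,
     - (cpoly_eval (cpoly_deriv 2 P) v * \<xi> + cpoly_eval (cpoly_deriv 3 P) v * \<eta>)]"

text \<open>The minors \<open>\<gamma>\<^sub>c' \<gamma>\<^sub>e'' - \<gamma>\<^sub>e' \<gamma>\<^sub>c''\<close> of a 2-jet in the cone with \<open>T'' = 0\<close> and \<open>\<eta> X'' - \<xi> Y'' = \<omega>\<close>.\<close>

definition jet_minor :: "4 cpoly \<Rightarrow> 4 \<Rightarrow> 4 \<Rightarrow> complex^4 \<Rightarrow> complex \<Rightarrow> complex \<Rightarrow> complex \<Rightarrow> complex" where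
  "jet_minor P c e v \<xi> \<eta> \<omega> =
    (let Q = hessian P v (tangent P v \<xi> \<eta>);
       A = - (cpoly_eval (cpoly_deriv 4 P) v * \<omega>);
       B = - (\<eta> * Q) - cpoly_eval (cpoly_deriv 2 P) v * \<omega>;
       C = - (\<xi> * Q) + cpoly_eval (cpoly_deriv 3 P) v * \<omega>
     in if c = 2 \<and> e = 3 then A else if c = 3 \<and> e = 2 then - A
        else if c = 3 \<and> e = 4 then B else if c = 4 \<and> e = 3 then - B
        else if c = 2 \<and> e = 4 then C else if c = 4 \<and> e = 2 then - C else 0)"

text \<open>In the minors with Z the unknown Z'' occurs only as P_Z Z'', which the second order
  relation replaces by -Q - P_X X'' - P_Y Y''. The remaining terms combine to
  \<open>\<omega>\<close>, and P_Z is never divided by.\<close>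

lemma jet_minor:
  assumes "w $ 1 = 0" "\<eta> * w $ 2 - \<xi> * w $ 3 = \<omega>"
    and "(\<Sum>c\<in>UNIV. cpoly_eval (cpoly_deriv c P) v * w $ c) + hessian P v (tangent P v \<xi> \<eta>) = 0"
  shows "tangent P v \<xi> \<eta> $ c * w $ e - tangent P v \<xi> \<eta> $ e * w $ c = jet_minor P c e v \<xi> \<eta> \<omega>"
proof -
  define Q where "Q = hessian P v (tangent P v \<xi> \<eta>)"
  have Q: "Q = - (cpoly_eval (cpoly_deriv 2 P) v * w $ 2 + cpoly_eval (cpoly_deriv 3 P) v * w $ 3
      + cpoly_eval (cpoly_deriv 4 P) v * w $ 4)"
    using assms(1,3) unfolding sum_4 Q_def[symmetric] eq_neg_iff_add_eq_0 by (simp add: add_ac)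
  show ?thesis
    unfolding jet_minor_def Let_def Q_def[symmetric] assms(2)[symmetric] Q
    using exhaust_4[of c] exhaust_4[of e] assms(1)
    by (elim disjE) (simp_all add: tangent_def algebra_simps)
qed

lemma jet_poly_tangent: "jet_poly W 1 (\<lambda>v \<xi> \<eta> \<omega>. tangent P v \<xi> \<eta> $ c)"
  using exhaust_4[of c]
  by (elim disjE)
     (auto simp: tangent_def intro!: jet_poly_0 jet_poly_diff jet_poly_uminus jet_poly_coeff_mult
        jet_poly_vars[unfolded One_nat_def] hol_intros)

lemma jet_poly_hessian: "jet_poly W 2 (\<lambda>v \<xi> \<eta> \<omega>. hessian P v (tangent P v \<xi> \<eta>))"
proof -
  have "jet_poly W (1 + 1) (\<lambda>v \<xi> \<eta> \<omega>. hessian P v (tangent P v \<xi> \<eta>))"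
    unfolding hessian_def
    by (intro jet_poly_sum jet_poly_mult jet_poly_coeff_mult jet_poly_tangent hol_intros)
  then show ?thesis by (simp add: numeral_2_eq_2)
qed

lemma jet_poly_minor: "jet_poly W 3 (jet_minor P c e)"
proof -
  have q: "jet_poly W 3 (\<lambda>v \<xi> \<eta> \<omega>. \<eta> * hessian P v (tangent P v \<xi> \<eta>))"
    "jet_poly W 3 (\<lambda>v \<xi> \<eta> \<omega>. \<xi> * hessian P v (tangent P v \<xi> \<eta>))"
    using jet_poly_mult[OF jet_poly_vars(2) jet_poly_hessian] jet_poly_mult[OF jet_poly_vars(1) jet_poly_hessian]
    by (simp_all add: numeral_3_eq_3 numeral_2_eq_2)
  have "jet_poly W 3 (\<lambda>v \<xi> \<eta> \<omega>. jet_minor P c e v \<xi> \<eta> \<omega>)"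
    unfolding jet_minor_def Let_def
    by (cases "c = 2"; cases "c = 3"; cases "c = 4"; cases "e = 2"; cases "e = 3"; cases "e = 4")
       (auto intro!: jet_poly_0 jet_poly_add jet_poly_diff jet_poly_uminus jet_poly_coeff_mult q jet_poly_vars hol_intros)
  then show ?thesis .
qed

text \<open>\<open>\<xi>\<close>, \<open>\<eta>\<close>, \<open>\<omega>\<close> are parameters and
  not functions of the germ: where P_Z = 0 one germ is adapted to many triples.\<close>

definition adapted_germ ::
  "4 cpoly \<Rightarrow> complex^4 \<Rightarrow> complex \<Rightarrow> complex \<Rightarrow> complex \<Rightarrow> (complex \<Rightarrow> complex^4) \<Rightarrow> bool" where
  "adapted_germ P v \<xi> \<eta> \<omega> \<gamma> \<longleftrightarrow> holomorphic_germ \<gamma> \<and> (\<forall>\<^sub>F \<zeta> in nhds 0. \<gamma> \<zeta> \<in> proj_zeros {P}) \<and> \<gamma> 0 = v \<and>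
     (\<chi> c. jet1 \<gamma> c) = tangent P v \<xi> \<eta> \<and> jet2 \<gamma> 1 = 0 \<and> \<eta> * jet2 \<gamma> 2 - \<xi> * jet2 \<gamma> 3 = \<omega>"

definition jet_coeffs :: "4 cpoly \<Rightarrow> nat \<Rightarrow> ((complex \<Rightarrow> complex^4) \<Rightarrow> complex) \<Rightarrow> complex^4 \<Rightarrow>
    (nat \<Rightarrow> nat \<Rightarrow> complex) \<Rightarrow> bool" where
  "jet_coeffs P m J v c \<longleftrightarrow>
     (\<forall>\<gamma> \<xi> \<eta> \<omega>. adapted_germ P v \<xi> \<eta> \<omega> \<gamma> \<longrightarrow> J \<gamma> = jet_sum m c \<xi> \<eta> \<omega>)"

text \<open>The last numerator is the 3 by 3 determinant of the coordinates l, a, b of the germ and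
  its first two derivatives, expanded along the undifferentiated row. Second derivatives thus enter
  only through the minors computed in \<open>jet_minor\<close>.\<close>

lemma chart_coords_germ:
  fixes a b l :: 4
  assumes \<gamma>: "holomorphic_germ \<gamma>" and l: "\<gamma> 0 $ l \<noteq> 0"
  defines "u \<equiv> \<lambda>\<zeta>. chart_coords a b l (\<gamma> \<zeta>)"
  shows "holomorphic_germ u"
    "jet1 u 1 = (jet1 \<gamma> a * \<gamma> 0 $ l - \<gamma> 0 $ a * jet1 \<gamma> l) / (\<gamma> 0 $ l) ^ 2"
    "jet1 u 2 = (jet1 \<gamma> b * \<gamma> 0 $ l - \<gamma> 0 $ b * jet1 \<gamma> l) / (\<gamma> 0 $ l) ^ 2"
    "jet1 u 1 * jet2 u 2 - jet1 u 2 * jet2 u 1 =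
       (\<gamma> 0 $ l * (jet1 \<gamma> a * jet2 \<gamma> b - jet1 \<gamma> b * jet2 \<gamma> a)
        - \<gamma> 0 $ a * (jet1 \<gamma> l * jet2 \<gamma> b - jet1 \<gamma> b * jet2 \<gamma> l)
        + \<gamma> 0 $ b * (jet1 \<gamma> l * jet2 \<gamma> a - jet1 \<gamma> a * jet2 \<gamma> l)) / (\<gamma> 0 $ l) ^ 3"
proof -
  obtain T where T: "open T" "0 \<in> T" "\<And>i. (\<lambda>\<zeta>. \<gamma> \<zeta> $ i) holomorphic_on T"
    using holomorphic_germE[OF \<gamma>] by blast
  have u: "(\<lambda>\<zeta>. u \<zeta> $ 1) = (\<lambda>\<zeta>. \<gamma> \<zeta> $ a / \<gamma> \<zeta> $ l)" "(\<lambda>\<zeta>. u \<zeta> $ 2) = (\<lambda>\<zeta>. \<gamma> \<zeta> $ b / \<gamma> \<zeta> $ l)"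
    by (simp_all add: u_def chart_coords_def)
  note qa = quotient_jets[OF T(1,2) T(3)[of a] T(3)[of l] l]
  note qb = quotient_jets[OF T(1,2) T(3)[of b] T(3)[of l] l]
  show "holomorphic_germ u"
    using qa(1) qb(1) by (simp add: holomorphic_germ_def forall_2 u)
  show "jet1 u 1 = (jet1 \<gamma> a * \<gamma> 0 $ l - \<gamma> 0 $ a * jet1 \<gamma> l) / (\<gamma> 0 $ l) ^ 2"
    "jet1 u 2 = (jet1 \<gamma> b * \<gamma> 0 $ l - \<gamma> 0 $ b * jet1 \<gamma> l) / (\<gamma> 0 $ l) ^ 2"
    unfolding u by (rule qa(2) qb(2))+
  have alg: "(f' * h - f * h') / h ^ 2 * ((g'' * h - g * h'') / h ^ 2 - 2 * h' * (g' * h - g * h') / h ^ 3)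
     - (g' * h - g * h') / h ^ 2 * ((f'' * h - f * h'') / h ^ 2 - 2 * h' * (f' * h - f * h') / h ^ 3) =
     (h * (f' * g'' - g' * f'') - f * (h' * g'' - g' * h'') + g * (h' * f'' - f' * h'')) / h ^ 3"
    if "h \<noteq> 0" for f f' f'' g g' g'' h h' h'' :: complex
  proof -
    have "(f' * h - f * h') / h ^ 2 * ((g'' * h - g * h'') / h ^ 2 - 2 * h' * (g' * h - g * h') / h ^ 3)
     - (g' * h - g * h') / h ^ 2 * ((f'' * h - f * h'') / h ^ 2 - 2 * h' * (f' * h - f * h') / h ^ 3) =
      ((f' * h - f * h') * (g'' * h - g * h'') - (g' * h - g * h') * (f'' * h - f * h'')) / h ^ 4"
      using that by (simp add: field_simps power2_eq_square power3_eq_cube power4_eq_xxxx)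
    also have "(f' * h - f * h') * (g'' * h - g * h'') - (g' * h - g * h') * (f'' * h - f * h'') =
      h * (h * (f' * g'' - g' * f'') - f * (h' * g'' - g' * h'') + g * (h' * f'' - f' * h''))"
      by (simp add: algebra_simps)
    also have "\<dots> / h ^ 4 = (h * (f' * g'' - g' * f'') - f * (h' * g'' - g' * h'') + g * (h' * f'' - f' * h'')) / h ^ 3"
      using that by (simp add: power4_eq_xxxx power3_eq_cube)
    finally show ?thesis .
  qed
  show "jet1 u 1 * jet2 u 2 - jet1 u 2 * jet2 u 1 =
       (\<gamma> 0 $ l * (jet1 \<gamma> a * jet2 \<gamma> b - jet1 \<gamma> b * jet2 \<gamma> a)
        - \<gamma> 0 $ a * (jet1 \<gamma> l * jet2 \<gamma> b - jet1 \<gamma> b * jet2 \<gamma> l)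
        + \<gamma> 0 $ b * (jet1 \<gamma> l * jet2 \<gamma> a - jet1 \<gamma> a * jet2 \<gamma> l)) / (\<gamma> 0 $ l) ^ 3"
    unfolding u qa(2,3) qb(2,3) by (rule alg[OF l])
qed

text \<open>Admitting a second lift of the same projective curve exhibits the independence of the
  lift, which later yields invariance under scaling.\<close>

lemma jet_differential_in_chart:
  assumes J: "invariant_jet_differential P m J" and ch: "graph_chart P a b l i U \<phi> W"
  shows "\<exists>R. (\<forall>a b j. holomorphic_vec (R a b j) U) \<and>
    (\<forall>\<gamma> \<gamma>'. holomorphic_germ \<gamma> \<and> (\<forall>\<^sub>F \<zeta> in nhds 0. \<gamma> \<zeta> \<in> proj_zeros {P}) \<and> \<gamma> 0 \<in> W \<and>
       holomorphic_germ \<gamma>' \<and> (\<forall>\<^sub>F \<zeta> in nhds 0. proj_eq (\<gamma> \<zeta>) (\<gamma>' \<zeta>)) \<longrightarrow>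
       J \<gamma>' = local_jet_expression m R (\<lambda>\<zeta>. chart_coords a b l (\<gamma> \<zeta>)))"
proof -
  have sc: "surface_chart P U \<phi>" and W: "open W"
    and vW: "\<And>v. v \<in> W \<Longrightarrow> v $ l \<noteq> 0 \<and> chart_coords a b l v \<in> U \<and>
        (v \<in> proj_zeros {P} \<longrightarrow> v = v $ l *s \<phi> (chart_coords a b l v))"
    using ch by (auto simp: graph_chart_def)
  obtain R where R: "\<forall>a b j. holomorphic_vec (R a b j) U"
     "\<forall>u \<gamma>. holomorphic_germ u \<and> u 0 \<in> U \<and> holomorphic_germ \<gamma> \<and>
                  (\<forall>\<^sub>F \<zeta> in nhds 0. proj_eq (\<phi> (u \<zeta>)) (\<gamma> \<zeta>)) \<longrightarrow>
                J \<gamma> = local_jet_expression m R u"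
    using J sc unfolding invariant_jet_differential_def by blast
  show ?thesis
  proof (intro exI[of _ R] conjI R(1) allI impI; elim conjE)
    fix \<gamma> \<gamma>' assume \<gamma>: "holomorphic_germ \<gamma>" "\<forall>\<^sub>F \<zeta> in nhds 0. \<gamma> \<zeta> \<in> proj_zeros {P}" "\<gamma> 0 \<in> W"
      and \<gamma>': "holomorphic_germ \<gamma>'" "\<forall>\<^sub>F \<zeta> in nhds 0. proj_eq (\<gamma> \<zeta>) (\<gamma>' \<zeta>)"
    have "\<forall>\<^sub>F v in nhds (\<gamma> 0). v \<in> W" using W \<gamma>(3) by (rule eventually_nhds_in_open)
    then have "\<forall>\<^sub>F \<zeta> in nhds 0. \<gamma> \<zeta> \<in> W"
      by (rule eventually_compose_filterlim[OF _ germ_tendsto[OF \<gamma>(1)]])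
    with \<gamma>(2) \<gamma>'(2) have "\<forall>\<^sub>F \<zeta> in nhds 0. proj_eq (\<phi> (chart_coords a b l (\<gamma> \<zeta>))) (\<gamma>' \<zeta>)"
    proof eventually_elim
      case (elim \<zeta>)
      then obtain c where c: "c \<noteq> 0" "\<gamma>' \<zeta> = c *s \<gamma> \<zeta>" by (auto simp: proj_eq_def)
      have "\<gamma> \<zeta> = \<gamma> \<zeta> $ l *s \<phi> (chart_coords a b l (\<gamma> \<zeta>))" using vW elim by blast
      then have "\<gamma>' \<zeta> = (c * \<gamma> \<zeta> $ l) *s \<phi> (chart_coords a b l (\<gamma> \<zeta>))"
        using c(2) by (metis vector_smult_assoc)
      then show ?case
        using c(1) vW[OF elim(3)] unfolding proj_eq_def by (intro exI[of _ "c * \<gamma> \<zeta> $ l"]) auto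
    qed
    moreover have "holomorphic_germ (\<lambda>\<zeta>. chart_coords a b l (\<gamma> \<zeta>))"
      using chart_coords_germ(1)[OF \<gamma>(1)] vW[OF \<gamma>(3)] by blast
    ultimately show "J \<gamma>' = local_jet_expression m R (\<lambda>\<zeta>. chart_coords a b l (\<gamma> \<zeta>))"
      using R(2) \<gamma>'(1) vW[OF \<gamma>(3)] by blast
  qed
qed

lemma proj_eq_refl: "proj_eq v v"
  unfolding proj_eq_def by (rule exI[of _ 1]) simp

text \<open>The jets of the chart coordinates are written as isobaric expressions p and D in
  \<open>\<xi>\<close>, \<open>\<eta>\<close>, \<open>\<omega>\<close> whose formulas make sense on
  all of W. The resulting coefficients are therefore the ambient extensions required by
  \<open>cone_section\<close>; off the cone \<open>jet_coeffs\<close> holds vacuously.\<close>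

lemma jet_coeffs_local:
  assumes J: "invariant_jet_differential P m J" and ch: "graph_chart P a b l i U \<phi> W"
  obtains c where "\<And>j k. holomorphic_vec (c j k) W"
    "\<And>v. v \<in> W \<Longrightarrow> jet_coeffs P m J v (\<lambda>j k. c j k v)"
proof -
  obtain R where R: "\<forall>a b j. holomorphic_vec (R a b j) U"
    "\<forall>\<gamma> \<gamma>'. holomorphic_germ \<gamma> \<and> (\<forall>\<^sub>F \<zeta> in nhds 0. \<gamma> \<zeta> \<in> proj_zeros {P}) \<and> \<gamma> 0 \<in> W \<and>
       holomorphic_germ \<gamma>' \<and> (\<forall>\<^sub>F \<zeta> in nhds 0. proj_eq (\<gamma> \<zeta>) (\<gamma>' \<zeta>)) \<longrightarrow>
       J \<gamma>' = local_jet_expression m R (\<lambda>\<zeta>. chart_coords a b l (\<gamma> \<zeta>))"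
    using jet_differential_in_chart[OF J ch] by blast
  have vW: "\<And>v. v \<in> W \<Longrightarrow> v $ l \<noteq> 0 \<and> chart_coords a b l v \<in> U"
    using ch by (auto simp: graph_chart_def)
  define p where "p x v \<xi> \<eta> = (tangent P v \<xi> \<eta> $ x * v $ l - v $ x * tangent P v \<xi> \<eta> $ l) / (v $ l) ^ 2"
    for x v \<xi> \<eta>
  define D where "D v \<xi> \<eta> \<omega> = (v $ l * jet_minor P a b v \<xi> \<eta> \<omega> - v $ a * jet_minor P l b v \<xi> \<eta> \<omega>
      + v $ b * jet_minor P l a v \<xi> \<eta> \<omega>) / (v $ l) ^ 3" for v \<xi> \<eta> \<omega>
  define F where "F v \<xi> \<eta> \<omega> = (\<Sum>j\<le>m div 3. \<Sum>x\<in>{(x, y). x + y = m - 3 * j}.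
      R (fst x) (snd x) j (chart_coords a b l v) * (p a v \<xi> \<eta> ^ fst x * p b v \<xi> \<eta> ^ snd x * D v \<xi> \<eta> \<omega> ^ j))"
    for v \<xi> \<eta> \<omega>
  have holinv: "holomorphic_vec (\<lambda>v. 1 / (v $ l) ^ n) W" for n
    using vW by (intro hol_intros) auto
  have jp: "jet_poly W 1 (\<lambda>v \<xi> \<eta> \<omega>. p x v \<xi> \<eta>)" for x
  proof (rule jet_poly_cong)
    show "jet_poly W 1 (\<lambda>v \<xi> \<eta> \<omega>. 1 / (v $ l) ^ 2 * (v $ l * tangent P v \<xi> \<eta> $ x - v $ x * tangent P v \<xi> \<eta> $ l))"
      by (intro jet_poly_coeff_mult jet_poly_diff jet_poly_tangent holinv hol_intros)
  qed (simp add: p_def mult.commute)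
  have jD: "jet_poly W 3 D"
  proof (rule jet_poly_cong)
    show "jet_poly W 3 (\<lambda>v \<xi> \<eta> \<omega>. 1 / (v $ l) ^ 3 * (v $ l * jet_minor P a b v \<xi> \<eta> \<omega> - v $ a * jet_minor P l b v \<xi> \<eta> \<omega>
      + v $ b * jet_minor P l a v \<xi> \<eta> \<omega>))"
      by (intro jet_poly_coeff_mult jet_poly_diff jet_poly_add jet_poly_minor holinv hol_intros)
  qed (simp add: D_def)
  have "jet_poly W m F"
    unfolding F_def
  proof (intro jet_poly_sum jet_poly_coeff_mult)
    fix j x assume j: "j \<in> {..m div 3}" and x: "x \<in> {(x, y). x + y = m - 3 * j}"
    have "jet_poly W (fst x * 1 + snd x * 1 + j * 3) (\<lambda>v \<xi> \<eta> \<omega>. p a v \<xi> \<eta> ^ fst x * p b v \<xi> \<eta> ^ snd x * D v \<xi> \<eta> \<omega> ^ j)"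
      by (intro jet_poly_mult jet_poly_power jp jD)
    moreover have "fst x * 1 + snd x * 1 + j * 3 = m"
      using j x by auto
    ultimately show "jet_poly W m (\<lambda>v \<xi> \<eta> \<omega>. p a v \<xi> \<eta> ^ fst x * p b v \<xi> \<eta> ^ snd x * D v \<xi> \<eta> \<omega> ^ j)"
      by simp
    show "holomorphic_vec (\<lambda>v. R (fst x) (snd x) j (chart_coords a b l v)) W"
    proof (rule holomorphic_vec_compose[OF R(1)[rule_format]])
      show "holomorphic_vec (\<lambda>v. chart_coords a b l v $ n) W" for n :: 2
        using exhaust_2[of n] vW by (auto simp: chart_coords_def intro!: hol_intros)
    qed (use vW in auto)
  qed
  then obtain c where c: "\<forall>j k. holomorphic_vec (c j k) W"
     "\<forall>v\<in>W. \<forall>\<xi> \<eta> \<omega>. F v \<xi> \<eta> \<omega> = jet_sum m (\<lambda>j k. c j k v) \<xi> \<eta> \<omega>"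
    by (auto simp: jet_poly_def)
  show thesis
  proof (rule that)
    show "holomorphic_vec (c j k) W" for j k using c(1) by blast
    fix v assume v: "v \<in> W"
    show "jet_coeffs P m J v (\<lambda>j k. c j k v)"
      unfolding jet_coeffs_def
    proof (intro allI impI)
      fix \<gamma> \<xi> \<eta> \<omega> assume \<gamma>: "adapted_germ P v \<xi> \<eta> \<omega> \<gamma>"
      then have g: "holomorphic_germ \<gamma>" "\<forall>\<^sub>F \<zeta> in nhds 0. \<gamma> \<zeta> \<in> proj_zeros {P}" "\<gamma> 0 = v"
        "(\<chi> c. jet1 \<gamma> c) = tangent P v \<xi> \<eta>" "jet2 \<gamma> 1 = 0" "\<eta> * jet2 \<gamma> 2 - \<xi> * jet2 \<gamma> 3 = \<omega>"
        by (auto simp: adapted_germ_def)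
      have j1: "jet1 \<gamma> c = tangent P v \<xi> \<eta> $ c" for c
        using g(4) by (metis vec_lambda_beta)
      have ev: "\<forall>\<^sub>F \<zeta> in nhds 0. cpoly_eval P (\<gamma> \<zeta>) = 0"
        using g(2) by eventually_elim (simp add: proj_zeros_def)
      have minor: "jet1 \<gamma> c * jet2 \<gamma> e - jet1 \<gamma> e * jet2 \<gamma> c = jet_minor P c e v \<xi> \<eta> \<omega>" for c e
        using jet_minor[of "\<chi> c. jet2 \<gamma> c" \<eta> \<xi> \<omega> P v c e] g(5,6)
          germ_jet_relations(2)[OF g(1) ev] by (simp add: j1 g(3,4))
      have l: "\<gamma> 0 $ l \<noteq> 0" using vW[OF v] g(3) by simp
      have "J \<gamma> = local_jet_expression m R (\<lambda>\<zeta>. chart_coords a b l (\<gamma> \<zeta>))"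
        using g v by (intro R(2)[rule_format]) (auto simp: proj_eq_refl)
      also have "\<dots> = F v \<xi> \<eta> \<omega>"
        unfolding local_jet_expression_def chart_coords_germ(4)[OF g(1) l]
        unfolding chart_coords_germ(2,3)[OF g(1) l] unfolding minor unfolding j1 g(3)
        by (simp add: F_def p_def D_def case_prod_unfold mult_ac)
      also have "\<dots> = jet_sum m (\<lambda>j k. c j k v) \<xi> \<eta> \<omega>" using c(2) v by blast
      finally show "J \<gamma> = jet_sum m (\<lambda>j k. c j k v) \<xi> \<eta> \<omega>" .
    qed
  qed
qed

section \<open>Existence of adapted germs and uniqueness of coefficients\<close>

lemma sum_except_one_unique:
  fixes p x y :: "'i::finite \<Rightarrow> complex"
  assumes "(\<Sum>c\<in>UNIV. p c * x c) = (\<Sum>c\<in>UNIV. p c * y c)" "\<And>c. c \<noteq> i \<Longrightarrow> x c = y c" "p i \<noteq> 0"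
  shows "x i = y i"
proof -
  have "(\<Sum>c\<in>UNIV - {i}. p c * x c) = (\<Sum>c\<in>UNIV - {i}. p c * y c)"
    by (rule sum.cong) (auto simp: assms(2))
  with assms(1,3) show ?thesis
    by (simp add: sum.remove[of UNIV i])
qed

text \<open>A quadratic curve q with the prescribed 2-jet is pushed onto the cone along the
  coordinate i by the graph chart. The other three coordinates are unchanged, and since P_i is
  nonzero the two jet relations force the derivatives of the coordinate i.\<close>

lemma germ_with_jet:
  assumes hom: "homogeneous d P" and ch: "graph_chart P a b l i U \<phi> W"
    and v: "v \<in> W" "v \<in> proj_zeros {P}"
    and v1: "(\<Sum>c\<in>UNIV. cpoly_eval (cpoly_deriv c P) v * v1 $ c) = 0"
    and v2: "(\<Sum>c\<in>UNIV. cpoly_eval (cpoly_deriv c P) v * v2 $ c) + hessian P v v1 = 0"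
  obtains \<gamma> where "holomorphic_germ \<gamma>" "\<forall>\<^sub>F \<zeta> in nhds 0. \<gamma> \<zeta> \<in> proj_zeros {P}" "\<gamma> 0 = v"
    "\<And>c. jet1 \<gamma> c = v1 $ c" "\<And>c. jet2 \<gamma> c = v2 $ c"
proof -
  have dist: "distinct [a, b, l, i]" and univ: "UNIV = {a, b, l, i}"
    and U: "open U" "\<And>j. holomorphic_vec (\<lambda>p. \<phi> p $ j) U" "\<phi> ` U \<subseteq> proj_zeros {P}"
    and coords: "\<And>u. u \<in> U \<Longrightarrow> \<phi> u $ l = 1 \<and> \<phi> u $ a = u $ 1 \<and> \<phi> u $ b = u $ 2"
    and vW: "v $ l \<noteq> 0" "cpoly_eval (cpoly_deriv i P) v \<noteq> 0" "chart_coords a b l v \<in> U"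
      "v = v $ l *s \<phi> (chart_coords a b l v)"
    using ch v unfolding graph_chart_def surface_chart_def by blast+
  have cases4: "c = a \<or> c = b \<or> c = l \<or> c = i" for c using univ by blast
  define q where "q \<zeta> = (\<chi> c. v $ c + v1 $ c * \<zeta> + v2 $ c * \<zeta> ^ 2 / 2)" for \<zeta>
  have qd: "((\<lambda>\<zeta>. q \<zeta> $ c) has_field_derivative v1 $ c + v2 $ c * \<zeta>) (at \<zeta>)" for c \<zeta>
    unfolding q_def by (auto intro!: derivative_eq_intros)
  have qd2: "((\<lambda>\<zeta>. v1 $ c + v2 $ c * \<zeta>) has_field_derivative v2 $ c) (at \<zeta>)" for c \<zeta>
    by (auto intro!: derivative_eq_intros)
  have qderiv: "deriv (\<lambda>\<zeta>. q \<zeta> $ c) = (\<lambda>\<zeta>. v1 $ c + v2 $ c * \<zeta>)" for c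
    using DERIV_imp_deriv[OF qd] by (simp add: fun_eq_iff)
  have q0: "q 0 = v" by (simp add: q_def vec_eq_iff)
  have qj: "jet1 q c = v1 $ c" "jet2 q c = v2 $ c" for c
    unfolding qderiv using DERIV_imp_deriv[OF qd2] by simp_all
  have qhol: "(\<lambda>\<zeta>. q \<zeta> $ c) holomorphic_on T" for c T
    unfolding q_def vec_lambda_beta by (intro holomorphic_intros) auto
  have qgerm: "holomorphic_germ q"
    by (rule holomorphic_germI[OF open_UNIV UNIV_I qhol])
  define u where "u \<zeta> = chart_coords a b l (q \<zeta>)" for \<zeta>
  define T1 where "T1 = {\<zeta>. q \<zeta> $ l \<noteq> 0}"
  have opT1: "open T1"
    unfolding T1_def q_def vec_lambda_beta by (intro open_Collect_neq continuous_intros) auto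
  have uhol: "(\<lambda>\<zeta>. u \<zeta> $ n) holomorphic_on T1" for n
  proof -
    have "(\<lambda>\<zeta>. q \<zeta> $ c / q \<zeta> $ l) holomorphic_on T1" for c
      by (intro holomorphic_on_divide qhol) (auto simp: T1_def)
    then show ?thesis
      using exhaust_2[of n] by (auto simp: u_def chart_coords_def)
  qed
  define T where "T = T1 \<inter> u -` U"
  have "continuous_on T1 (\<lambda>\<zeta>. \<chi> n. u \<zeta> $ n)"
    by (rule continuous_on_vec_lambda) (rule holomorphic_on_imp_continuous_on[OF uhol])
  then have "continuous_on T1 u" by simp
  then have opT: "open T" unfolding T_def by (rule continuous_open_preimage[OF _ opT1 U(1)])
  have T0: "0 \<in> T" using vW by (simp add: T_def T1_def u_def q0)
  have TU: "u \<zeta> \<in> U" "q \<zeta> $ l \<noteq> 0" if "\<zeta> \<in> T" for \<zeta> using that by (auto simp: T_def T1_def)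
  define \<gamma> where "\<gamma> \<zeta> = q \<zeta> $ l *s \<phi> (u \<zeta>)" for \<zeta>
  have zeros: "\<gamma> \<zeta> \<in> proj_zeros {P}" if "\<zeta> \<in> T" for \<zeta>
    unfolding \<gamma>_def proj_zeros_scale[OF hom TU(2)[OF that]] using U(3) TU(1)[OF that] by blast
  have ev: "\<forall>\<^sub>F \<zeta> in nhds 0. \<gamma> \<zeta> \<in> proj_zeros {P}"
    using opT T0 zeros by (auto simp: eventually_nhds)
  have \<gamma>germ: "holomorphic_germ \<gamma>"
  proof (rule holomorphic_germI[OF opT T0])
    fix c
    have "(\<lambda>\<zeta>. \<phi> (u \<zeta>) $ c) holomorphic_on T"
      by (rule holomorphic_on_compose_vec[OF U(2) opT])
         (use TU in \<open>auto intro: holomorphic_on_subset[OF uhol] simp: T_def\<close>)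
    then show "(\<lambda>\<zeta>. \<gamma> \<zeta> $ c) holomorphic_on T"
      unfolding \<gamma>_def vector_smult_component by (intro holomorphic_on_mult qhol)
  qed
  have \<gamma>0: "\<gamma> 0 = v" using vW(4) by (simp add: \<gamma>_def u_def q0)
  have same: "\<gamma> \<zeta> $ c = q \<zeta> $ c" if "\<zeta> \<in> T" "c \<noteq> i" for \<zeta> c
    using coords[OF TU(1)[OF that(1)]] TU(2)[OF that(1)] cases4[of c] that(2)
    by (auto simp: \<gamma>_def) (auto simp: u_def chart_coords_def)
  have evsame: "\<forall>\<^sub>F \<zeta> in nhds 0. \<gamma> \<zeta> $ c = q \<zeta> $ c" if "c \<noteq> i" for c
    using opT T0 same that by (auto simp: eventually_nhds)
  have j1: "jet1 \<gamma> c = v1 $ c" if "c \<noteq> i" for c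
    using deriv_cong_ev[OF evsame[OF that] refl] qj by simp
  have j2: "jet2 \<gamma> c = v2 $ c" if "c \<noteq> i" for c
  proof -
    have "\<forall>\<^sub>F \<zeta> in nhds 0. deriv (\<lambda>\<zeta>. \<gamma> \<zeta> $ c) \<zeta> = deriv (\<lambda>\<zeta>. q \<zeta> $ c) \<zeta>"
    proof -
      have "\<forall>\<^sub>F z in nhds 0. \<forall>\<^sub>F \<zeta> in nhds z. \<gamma> \<zeta> $ c = q \<zeta> $ c"
        using evsame[OF that] by (simp only: eventually_eventually)
      then show ?thesis
        by eventually_elim (rule deriv_cong_ev, auto)
    qed
    from deriv_cong_ev[OF this refl] show ?thesis using qj by simp
  qed
  have evP: "\<forall>\<^sub>F \<zeta> in nhds 0. cpoly_eval P (\<gamma> \<zeta>) = 0"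
    using ev by eventually_elim (simp add: proj_zeros_def)
  note rel = germ_jet_relations[OF \<gamma>germ evP, unfolded \<gamma>0]
  have "jet1 \<gamma> i = v1 $ i"
    by (rule sum_except_one_unique[where x = "jet1 \<gamma>" and y = "\<lambda>c. v1 $ c"])
       (use rel(1) v1 j1 vW(2) in auto)
  with j1 have J1: "jet1 \<gamma> c = v1 $ c" for c by (cases "c = i") auto
  then have eqv: "(\<chi> c. jet1 \<gamma> c) = v1" by (simp add: vec_eq_iff)
  have "(\<Sum>c\<in>UNIV. cpoly_eval (cpoly_deriv c P) v * jet2 \<gamma> c) = (\<Sum>c\<in>UNIV. cpoly_eval (cpoly_deriv c P) v * v2 $ c)"
    by (rule add_right_imp_eq[OF trans[OF rel(2)[unfolded eqv] v2[symmetric]]])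
  then have "jet2 \<gamma> i = v2 $ i"
    by (rule sum_except_one_unique[where x = "jet2 \<gamma>" and y = "\<lambda>c. v2 $ c"]) (use j2 vW(2) in auto)
  with j2 have J2: "jet2 \<gamma> c = v2 $ c" for c by (cases "c = i") auto
  show thesis by (rule that[OF \<gamma>germ ev \<gamma>0 J1 J2])
qed

text \<open>The condition \<open>nz\<close> says that the velocity for \<open>\<xi> = 1\<close> is
  nonzero. It is also the rank condition for solving the second order relation together with
  \<open>\<eta> * x - y = \<omega>\<close> for the second derivatives.\<close>

lemma adapted_germ_exists:
  assumes hom: "homogeneous d P" and d: "d \<ge> 1" and sm: "smooth_form P" and v: "v \<in> proj_zeros {P}"
    and nz: "cpoly_eval (cpoly_deriv 4 P) v \<noteq> 0 \<or>
      cpoly_eval (cpoly_deriv 2 P) v + cpoly_eval (cpoly_deriv 3 P) v * \<eta> \<noteq> 0"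
  obtains \<gamma> where "adapted_germ P v 1 \<eta> \<omega> \<gamma>"
proof -
  obtain a b l i U \<phi> W where ch: "graph_chart P a b l i U \<phi> W" and W: "v \<in> W"
    using graph_chart_exists[OF hom d sm v] by blast
  define p2 p3 p4 where "p2 = cpoly_eval (cpoly_deriv 2 P) v" and "p3 = cpoly_eval (cpoly_deriv 3 P) v"
    and "p4 = cpoly_eval (cpoly_deriv 4 P) v"
  define Q where "Q = hessian P v (tangent P v 1 \<eta>)"
  have "\<exists>x y z. \<eta> * x - y = \<omega> \<and> p2 * x + p3 * y + p4 * z + Q = 0"
  proof (cases "p4 = 0")
    case False
    then show ?thesis
      by (intro exI[of _ 0] exI[of _ "- \<omega>"] exI[of _ "(p3 * \<omega> - Q) / p4"]) (simp add: field_simps)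
  next
    case True
    then have ne: "p2 + p3 * \<eta> \<noteq> 0" using nz by (simp add: p2_def p3_def p4_def)
    define x where "x = (p3 * \<omega> - Q) / (p2 + p3 * \<eta>)"
    have "(p2 + p3 * \<eta>) * x = p3 * \<omega> - Q" using ne by (simp add: x_def)
    then have "p2 * x + p3 * (\<eta> * x - \<omega>) + p4 * 0 + Q = 0" by (simp add: algebra_simps)
    then show ?thesis by (intro exI[of _ x] exI[of _ "\<eta> * x - \<omega>"] exI[of _ 0]) simp
  qed
  then obtain x y z where xyz: "\<eta> * x - y = \<omega>" "p2 * x + p3 * y + p4 * z + Q = 0" by blast
  obtain \<gamma> where \<gamma>: "holomorphic_germ \<gamma>" "\<forall>\<^sub>F \<zeta> in nhds 0. \<gamma> \<zeta> \<in> proj_zeros {P}" "\<gamma> 0 = v"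
    "\<And>c. jet1 \<gamma> c = tangent P v 1 \<eta> $ c" "\<And>c. jet2 \<gamma> c = (vector [0, x, y, z] :: complex^4) $ c"
  proof (rule germ_with_jet[OF hom ch W v])
    show "(\<Sum>c\<in>UNIV. cpoly_eval (cpoly_deriv c P) v * tangent P v 1 \<eta> $ c) = 0"
      by (simp add: sum_4 tangent_def algebra_simps)
    show "(\<Sum>c\<in>UNIV. cpoly_eval (cpoly_deriv c P) v * vector [0, x, y, z] $ c) + hessian P v (tangent P v 1 \<eta>) = 0"
      using xyz(2) by (simp add: sum_4 p2_def p3_def p4_def Q_def)
  qed blast
  have "adapted_germ P v 1 \<eta> \<omega> \<gamma>"
    using \<gamma> xyz(1) by (simp add: adapted_germ_def vec_eq_iff)
  then show thesis by (rule that)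
qed

text \<open>The values at \<open>\<xi> = 1\<close> suffice, as the exponent of \<open>\<xi>\<close>
  is fixed by the weight. For each admissible \<open>\<eta>\<close> all \<open>\<omega>\<close>
  occur, which separates the powers of \<open>\<omega>\<close>; at most one \<open>\<eta>\<close> is
  excluded, so the coefficients in \<open>\<eta>\<close> are determined too.\<close>

lemma jet_coeffs_unique:
  assumes hom: "homogeneous d P" and d: "d \<ge> 1" and sm: "smooth_form P" and v: "v \<in> proj_zeros {P}"
    and nz: "cpoly_eval (cpoly_deriv 2 P) v \<noteq> 0 \<or> cpoly_eval (cpoly_deriv 3 P) v \<noteq> 0 \<or>
      cpoly_eval (cpoly_deriv 4 P) v \<noteq> 0"
    and c: "jet_coeffs P m J v c" and e: "jet_coeffs P m J v e"
    and k: "k \<le> m div 3" and j: "j \<le> m - 3 * k"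
  shows "c j k = e j k"
proof -
  define good where "good = {\<eta>. cpoly_eval (cpoly_deriv 4 P) v \<noteq> 0 \<or>
      cpoly_eval (cpoly_deriv 2 P) v + cpoly_eval (cpoly_deriv 3 P) v * \<eta> \<noteq> 0}"
  have "infinite good"
  proof (cases "cpoly_eval (cpoly_deriv 4 P) v = 0")
    case True
    define r where "r = [:cpoly_eval (cpoly_deriv 2 P) v, cpoly_eval (cpoly_deriv 3 P) v:]"
    have "r \<noteq> 0" using nz True by (auto simp: r_def)
    then have "finite {\<eta>. poly r \<eta> = 0}" by (rule poly_roots_finite)
    moreover have "good = UNIV - {\<eta>. poly r \<eta> = 0}" by (auto simp: good_def r_def True mult.commute)
    ultimately show ?thesis by (simp add: Diff_infinite_finite infinite_UNIV_char_0)
  qed (simp add: good_def infinite_UNIV_char_0)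
  define f where "f k = (\<Sum>j\<le>m - 3 * k. monom (c j k - e j k) j)" for k
  have f0: "poly (f k) \<eta> = 0" if "\<eta> \<in> good" for \<eta>
  proof -
    define h where "h = (\<Sum>k\<le>m div 3. monom (poly (f k) \<eta>) k)"
    have "poly h \<omega> = 0" for \<omega>
    proof -
      obtain \<gamma> where \<gamma>: "adapted_germ P v 1 \<eta> \<omega> \<gamma>"
        using adapted_germ_exists[OF hom d sm v] \<open>\<eta> \<in> good\<close> unfolding good_def by blast
      have "jet_sum m c 1 \<eta> \<omega> = jet_sum m e 1 \<eta> \<omega>"
        using c e \<gamma> unfolding jet_coeffs_def by metis
      then have "jet_sum m c 1 \<eta> \<omega> - jet_sum m e 1 \<eta> \<omega> = 0" by simp
      then show ?thesis
        by (simp add: jet_sum_def h_def f_def poly_sum poly_monom sum_subtractf[symmetric]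
            sum_distrib_right left_diff_distrib)
    qed
    then have "h = 0" using poly_all_0_iff_0 by blast
    then have "coeff h k = 0" by simp
    then show ?thesis using k by (simp add: h_def coeff_sum)
  qed
  have "f k = 0"
  proof (rule ccontr)
    assume "f k \<noteq> 0"
    then have "finite {\<eta>. poly (f k) \<eta> = 0}" by (rule poly_roots_finite)
    then have "finite good" by (rule finite_subset[rotated]) (auto simp: f0)
    with \<open>infinite good\<close> show False by simp
  qed
  then have "coeff (f k) j = 0" by simp
  then show ?thesis using j by (simp add: f_def coeff_sum)
qed

text \<open>The velocity is multiplied by s while the partial derivatives in \<open>tangent\<close>
  are multiplied by s^(d - 1); r compensates for the difference. In \<open>\<omega>\<close> the
  second derivatives bring one more factor s.\<close>

lemma adapted_germ_scale:
  assumes hom: "homogeneous d P" and d: "d \<ge> 1" and s: "s \<noteq> 0"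
    and \<gamma>: "adapted_germ P v \<xi> \<eta> \<omega> \<gamma>"
  defines "r \<equiv> s / s ^ (d - 1)"
  shows "adapted_germ P (s *s v) (r * \<xi>) (r * \<eta>) (r * s * \<omega>) (\<lambda>\<zeta>. s *s \<gamma> \<zeta>)"
proof -
  have g: "holomorphic_germ \<gamma>" "\<forall>\<^sub>F \<zeta> in nhds 0. \<gamma> \<zeta> \<in> proj_zeros {P}" "\<gamma> 0 = v"
        "(\<chi> c. jet1 \<gamma> c) = tangent P v \<xi> \<eta>" "jet2 \<gamma> 1 = 0" "\<eta> * jet2 \<gamma> 2 - \<xi> * jet2 \<gamma> 3 = \<omega>"
    using \<gamma> by (auto simp: adapted_germ_def)
  obtain T where T: "open T" "0 \<in> T" "\<And>i. (\<lambda>\<zeta>. \<gamma> \<zeta> $ i) holomorphic_on T"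
    using holomorphic_germE[OF g(1)] by blast
  have fd: "(\<lambda>\<zeta>. \<gamma> \<zeta> $ c) field_differentiable at z" if "z \<in> T" for z c
    using T that by (meson holomorphic_on_imp_differentiable_at)
  have d1: "deriv (\<lambda>\<zeta>. (s *s \<gamma> \<zeta>) $ c) z = s * deriv (\<lambda>\<zeta>. \<gamma> \<zeta> $ c) z" if "z \<in> T" for z c
    using deriv_cmult[OF fd[OF that]] by simp
  have j1: "jet1 (\<lambda>\<zeta>. s *s \<gamma> \<zeta>) c = s * jet1 \<gamma> c" for c by (rule d1[OF T(2)])
  have j2: "jet2 (\<lambda>\<zeta>. s *s \<gamma> \<zeta>) c = s * jet2 \<gamma> c" for c
  proof -
    have "\<forall>\<^sub>F z in nhds 0. deriv (\<lambda>\<zeta>. (s *s \<gamma> \<zeta>) $ c) z = s * deriv (\<lambda>\<zeta>. \<gamma> \<zeta> $ c) z"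
      using T(1,2) d1 by (auto simp: eventually_nhds)
    from deriv_cong_ev[OF this refl]
    have "jet2 (\<lambda>\<zeta>. s *s \<gamma> \<zeta>) c = deriv (\<lambda>z. s * deriv (\<lambda>\<zeta>. \<gamma> \<zeta> $ c) z) 0" .
    also have "\<dots> = s * jet2 \<gamma> c"
      by (rule deriv_cmult) (use holomorphic_deriv[OF T(3) T(1)] T in \<open>meson holomorphic_on_imp_differentiable_at\<close>)
    finally show ?thesis .
  qed
  have tang: "s * tangent P v \<xi> \<eta> $ c = tangent P (s *s v) (r * \<xi>) (r * \<eta>) $ c" for c
    using exhaust_4[of c] s
    by (elim disjE) (simp_all add: tangent_def cpoly_deriv_scale[OF hom d s] r_def field_simps)
  have jc: "jet1 \<gamma> c = tangent P v \<xi> \<eta> $ c" for c using g(4) by (metis vec_lambda_beta)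
  show ?thesis
    unfolding adapted_germ_def
  proof (intro conjI)
    show "holomorphic_germ (\<lambda>\<zeta>. s *s \<gamma> \<zeta>)"
      by (rule holomorphic_germI[OF T(1,2)])
         (unfold vector_smult_component, intro holomorphic_on_mult holomorphic_on_const T(3))
    show "\<forall>\<^sub>F \<zeta> in nhds 0. s *s \<gamma> \<zeta> \<in> proj_zeros {P}"
      using g(2) by (simp add: proj_zeros_scale[OF hom s])
    show "(\<chi> c. jet1 (\<lambda>\<zeta>. s *s \<gamma> \<zeta>) c) = tangent P (s *s v) (r * \<xi>) (r * \<eta>)"
      unfolding j1 jc tang by (simp add: vec_eq_iff)
    show "jet2 (\<lambda>\<zeta>. s *s \<gamma> \<zeta>) 1 = 0" unfolding j2 using g(5) by simp
    show "r * \<eta> * jet2 (\<lambda>\<zeta>. s *s \<gamma> \<zeta>) 2 - r * \<xi> * jet2 (\<lambda>\<zeta>. s *s \<gamma> \<zeta>) 3 = r * s * \<omega>"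
      unfolding j2 g(6)[symmetric] by (simp add: algebra_simps)
  qed (simp add: g(3))
qed

lemma jet_differential_scale:
  assumes hom: "homogeneous d P" and d: "d \<ge> 1" and sm: "smooth_form P"
    and J: "invariant_jet_differential P m J" and s: "s \<noteq> 0"
    and g: "holomorphic_germ \<gamma>" "\<forall>\<^sub>F \<zeta> in nhds 0. \<gamma> \<zeta> \<in> proj_zeros {P}"
    and gs: "holomorphic_germ (\<lambda>\<zeta>. s *s \<gamma> \<zeta>)"
  shows "J (\<lambda>\<zeta>. s *s \<gamma> \<zeta>) = J \<gamma>"
proof -
  have "\<gamma> 0 \<in> proj_zeros {P}" using eventually_nhds_x_imp_x[OF g(2)] .
  then obtain a b l i U \<phi> W where ch: "graph_chart P a b l i U \<phi> W" and W: "\<gamma> 0 \<in> W"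
    using graph_chart_exists[OF hom d sm] by blast
  obtain R where R:
    "\<forall>\<gamma> \<gamma>'. holomorphic_germ \<gamma> \<and> (\<forall>\<^sub>F \<zeta> in nhds 0. \<gamma> \<zeta> \<in> proj_zeros {P}) \<and> \<gamma> 0 \<in> W \<and>
       holomorphic_germ \<gamma>' \<and> (\<forall>\<^sub>F \<zeta> in nhds 0. proj_eq (\<gamma> \<zeta>) (\<gamma>' \<zeta>)) \<longrightarrow>
       J \<gamma>' = local_jet_expression m R (\<lambda>\<zeta>. chart_coords a b l (\<gamma> \<zeta>))"
    using jet_differential_in_chart[OF J ch] by blast
  have "proj_eq (\<gamma> \<zeta>) (s *s \<gamma> \<zeta>)" for \<zeta> using s by (auto simp: proj_eq_def)
  then have "J (\<lambda>\<zeta>. s *s \<gamma> \<zeta>) = local_jet_expression m R (\<lambda>\<zeta>. chart_coords a b l (\<gamma> \<zeta>))"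
    using g gs W by (intro R[rule_format]) simp
  moreover have "J \<gamma> = local_jet_expression m R (\<lambda>\<zeta>. chart_coords a b l (\<gamma> \<zeta>))"
    using g W by (intro R[rule_format]) (simp add: proj_eq_refl)
  ultimately show ?thesis by simp
qed

text \<open>A monomial has j + (m - 3k - j) + k = m - 2k factors that scale with r, and each of the
  k factors \<open>\<omega>\<close> brings a further s.\<close>

lemma jet_coeffs_scale:
  assumes hom: "homogeneous d P" and d: "d \<ge> 1" and sm: "smooth_form P"
    and J: "invariant_jet_differential P m J" and s: "s \<noteq> 0"
    and c: "jet_coeffs P m J (s *s v) c"
  shows "jet_coeffs P m J v (\<lambda>j k. (s / s ^ (d - 1)) ^ (m - 2 * k) * s ^ k * c j k)"
  unfolding jet_coeffs_def
proof (intro allI impI)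
  fix \<gamma> \<xi> \<eta> \<omega> assume \<gamma>: "adapted_germ P v \<xi> \<eta> \<omega> \<gamma>"
  define r where "r = s / s ^ (d - 1)"
  note ad = adapted_germ_scale[OF hom d s \<gamma>, folded r_def]
  have "J \<gamma> = J (\<lambda>\<zeta>. s *s \<gamma> \<zeta>)"
    using jet_differential_scale[OF hom d sm J s] \<gamma> ad unfolding adapted_germ_def by metis
  also have "\<dots> = jet_sum m c (r * \<xi>) (r * \<eta>) (r * s * \<omega>)"
    using c ad unfolding jet_coeffs_def by blast
  also have "\<dots> = jet_sum m (\<lambda>j k. r ^ (m - 2 * k) * s ^ k * c j k) \<xi> \<eta> \<omega>"
    unfolding jet_sum_def
  proof (intro sum.cong refl)
    fix k j assume "k \<in> {..m div 3}" "j \<in> {..m - 3 * k}"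
    then have "m - 2 * k = j + (m - 3 * k - j) + k" by auto
    then have "r ^ (m - 2 * k) = r ^ j * r ^ (m - 3 * k - j) * r ^ k"
      by (simp only: power_add)
    then show "c j k * (r * \<eta>) ^ j * (r * \<xi>) ^ (m - 3 * k - j) * (r * s * \<omega>) ^ k =
       r ^ (m - 2 * k) * s ^ k * c j k * \<eta> ^ j * \<xi> ^ (m - 3 * k - j) * \<omega> ^ k"
      by (simp only: power_mult_distrib mult_ac)
  qed
  finally show "J \<gamma> = jet_sum m (\<lambda>j k. (s / s ^ (d - 1)) ^ (m - 2 * k) * s ^ k * c j k) \<xi> \<eta> \<omega>"
    by (simp add: r_def)
qed

lemma cpoly_deriv_eq_0_on_hyperplane:
  fixes v :: "complex^'n::finite"
  assumes "\<And>w. w $ i = 0 \<Longrightarrow> cpoly_eval P w = 0" "v $ i = 0" "c \<noteq> i"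
  shows "cpoly_eval (cpoly_deriv c P) v = 0"
proof -
  have 1: "((\<lambda>\<zeta>. cpoly_eval P (v + \<zeta> *s axis c 1)) has_field_derivative
     (\<Sum>j\<in>UNIV. cpoly_eval (cpoly_deriv j P) (v + 0 *s axis c 1) * (if j = c then 1 else 0))) (at 0)"
    by (rule cpoly_eval_chain) (auto intro!: derivative_eq_intros simp: axis_def)
  have "cpoly_eval P (v + \<zeta> *s axis c 1) = 0" for \<zeta>
    by (rule assms(1)) (use assms(2,3) in \<open>simp add: axis_def\<close>)
  with 1 have "((\<lambda>\<zeta>. 0) has_field_derivative
     (\<Sum>j\<in>UNIV. cpoly_eval (cpoly_deriv j P) (v + 0 *s axis c 1) * (if j = c then 1 else 0))) (at 0)"
    by simp
  from DERIV_unique[OF this DERIV_const] show ?thesis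
    by (simp add: if_distrib cong: if_cong)
qed

text \<open>Four divisors meeting at a point would require a dimension with
  \<open>proj_dim V + 4 = 3\<close>, which no extended natural number satisfies.\<close>

lemma general_position_partials:
  assumes "general_position [P, P1, P2, P3, P4]" "v \<in> proj_zeros {P}"
  shows "cpoly_eval P2 v \<noteq> 0 \<or> cpoly_eval P3 v \<noteq> 0 \<or> cpoly_eval P4 v \<noteq> 0"
proof (rule ccontr)
  assume neg: "\<not> ?thesis"
  define V where "V = proj_zeros {[P, P1, P2, P3, P4] ! i | i. i \<in> {0, 2, 3, 4}}"
  have "{0, 2, 3, 4} \<noteq> ({} :: nat set) \<and> {0, 2, 3, 4} \<subseteq> {..<length [P, P1, P2, P3, P4]}" by simp
  from assms(1)[unfolded general_position_def, rule_format, OF this]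
  have gp: "V = {} \<or> proj_dim V + enat 4 = 3" by (simp add: V_def Let_def eval_nat_numeral)
  have "v \<in> V"
    using assms(2) neg by (auto simp: V_def proj_zeros_def)
  then have "proj_dim V + enat 4 = 3" using gp by auto
  then show False by (cases "proj_dim V") (auto simp: numeral_eq_enat)
qed

lemma dehomogenized_term:
  fixes r :: complex
  assumes "r \<noteq> 0" "k \<le> m div 3" "j \<le> m - 3 * k"
  shows "G * (y / r) ^ j * (x / r) ^ (m - 3 * k - j) * (w / r) ^ k =
     G / r ^ (m - 2 * k) * y ^ j * x ^ (m - 3 * k - j) * w ^ k"
proof -
  have "m - 2 * k = j + (m - 3 * k - j) + k" using assms(2,3) by auto
  then have "r ^ (m - 2 * k) = r ^ j * r ^ (m - 3 * k - j) * r ^ k" by (simp only: power_add)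
  then show ?thesis by (simp add: power_divide)
qed

theorem proposition4p1:
  fixes Rhat :: "4 cpoly" and d m :: nat and R :: "3 cpoly"
    and J :: "(complex \<Rightarrow> complex^4) \<Rightarrow> complex"
  assumes "d \<ge> 1" and "homogeneous d Rhat" and "smooth_form Rhat"
    and "general_position
           [Rhat, cpoly_deriv 1 Rhat, cpoly_deriv 2 Rhat, cpoly_deriv 3 Rhat, cpoly_deriv 4 Rhat]"
    and "R = dehomogenize Rhat"
    and "invariant_jet_differential Rhat m J"
  shows "\<exists>F :: nat \<Rightarrow> nat \<Rightarrow> 3 cpoly.
    \<forall>c :: complex \<Rightarrow> complex^3.
      holomorphic_germ c \<and> (\<forall>\<^sub>F \<zeta> in nhds 0. cpoly_eval R (c \<zeta>) = 0) \<and>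
      cpoly_eval (cpoly_deriv 3 R) (c 0) \<noteq> 0 \<longrightarrow>
      J (\<lambda>\<zeta>. affine_point (c \<zeta>)) =
        (\<Sum>k\<le>m div 3. \<Sum>j\<le>m - 3 * k.
           cpoly_eval (F j k) (c 0) / cpoly_eval (cpoly_deriv 3 R) (c 0) ^ (m - 2 * k) *
           jet1 c 2 ^ j * jet1 c 1 ^ (m - 3 * k - j) *
           (jet1 c 2 * jet2 c 1 - jet1 c 1 * jet2 c 2) ^ k)"
proof -
  note d = assms(1) and hom = assms(2) and sm = assms(3) and J = assms(6)
  let ?S = "proj_zeros {Rhat}"
  note nz = general_position_partials[OF assms(4)]
  \<comment> \<open>If the form vanished on the plane T = 0, its derivatives in the directions X, Y,
    Z would vanish there too, against general position.\<close>
  have "\<exists>e :: complex^4. e $ 1 = 0 \<and> cpoly_eval Rhat e \<noteq> 0"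
  proof (rule ccontr)
    assume "\<not> ?thesis"
    then have 0: "cpoly_eval Rhat w = 0" if "w $ 1 = 0" for w using that by blast
    let ?v = "axis 2 1 :: complex^4"
    have v1: "?v $ 1 = 0" by (simp add: axis_def)
    have "?v \<in> ?S" using 0[OF v1] by (simp add: proj_zeros_def)
    then show False
      using nz[of ?v] cpoly_deriv_eq_0_on_hyperplane[of 1 Rhat ?v, OF 0 v1] by simp
  qed
  then obtain e :: "complex^4" where e: "e $ 1 = 0" "cpoly_eval Rhat e \<noteq> 0" by blast
  have local: "\<exists>W c. open W \<and> v \<in> W \<and> (\<forall>j k. holomorphic_vec (c j k) W) \<and>
     (\<forall>x\<in>W. jet_coeffs Rhat m J x (\<lambda>j k. c j k x))" if v: "v \<in> ?S" for v
  proof -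
    obtain a b l i U \<phi> W where ch: "graph_chart Rhat a b l i U \<phi> W" and W: "v \<in> W"
      using graph_chart_exists[OF hom d sm v] by blast
    obtain c where "\<And>j k. holomorphic_vec (c j k) W" "\<And>v. v \<in> W \<Longrightarrow> jet_coeffs Rhat m J v (\<lambda>j k. c j k v)"
      using jet_coeffs_local[OF J ch] by blast
    moreover have "open W" using ch by (simp add: graph_chart_def)
    ultimately show ?thesis using W by blast
  qed
  \<comment> \<open>An arbitrary choice at each point. By uniqueness it agrees on the cone, for the
    relevant indices, with the local holomorphic families.\<close>
  define C where "C v = (SOME c. jet_coeffs Rhat m J v c)" for v
  have C: "jet_coeffs Rhat m J v (C v)" if "v \<in> ?S" for v
    unfolding C_def using local[OF that] by (metis someI)
  note uniq = jet_coeffs_unique[OF hom d sm _ nz]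
  have "\<exists>F :: 3 cpoly. \<forall>q. affine_point q \<in> ?S \<longrightarrow> cpoly_eval F q = C (affine_point q) j k"
    if k: "k \<le> m div 3" and j: "j \<le> m - 3 * k" for j k
  proof -
    define g where "g v = v $ 1 ^ (m - k) * C v j k" for v
    have "cone_section Rhat d e g ((d - 1) * (m - 2 * k))"
    proof
      fix v s assume v: "v \<in> ?S" and s: "(s :: complex) \<noteq> 0"
      have "s *s v \<in> ?S" using v by (simp add: proj_zeros_scale[OF hom s])
      from jet_coeffs_scale[OF hom d sm J s C[OF this]]
      have "C v j k = (s / s ^ (d - 1)) ^ (m - 2 * k) * s ^ k * C (s *s v) j k"
        by (rule uniq[OF v v C[OF v] _ k j])
      moreover have "s ^ ((d - 1) * (m - 2 * k)) * ((s / s ^ (d - 1)) ^ (m - 2 * k) * s ^ k) = s ^ (m - k)"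
      proof -
        have mk: "m - k = (m - 2 * k) + k" using k by auto
        show ?thesis
          using s unfolding mk power_add by (simp add: power_divide power_mult)
      qed
      ultimately show "g (s *s v) = s ^ ((d - 1) * (m - 2 * k)) * g v"
        unfolding g_def by (simp add: power_mult_distrib mult_ac)
    next
      fix v assume v: "v \<in> ?S"
      obtain W c where W: "open W" "v \<in> W" "\<forall>j k. holomorphic_vec (c j k) W"
        "\<forall>x\<in>W. jet_coeffs Rhat m J x (\<lambda>j k. c j k x)"
        using local[OF v] by blast
      show "\<exists>W G. open W \<and> v \<in> W \<and> holomorphic_vec G W \<and> (\<forall>x\<in>W \<inter> ?S. G x = g x)"
      proof (intro exI conjI ballI)
        show "holomorphic_vec (\<lambda>x. x $ 1 ^ (m - k) * c j k x) W"
          using W(3) by (intro hol_intros) auto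
        fix x assume x: "x \<in> W \<inter> ?S"
        then have "c j k x = C x j k"
          by (intro uniq[OF _ _ _ _ k j, where c = "\<lambda>j k. c j k x"]) (use W(4) C in auto)
        then show "x $ 1 ^ (m - k) * c j k x = g x" by (simp add: g_def)
      qed (use W in auto)
    qed (use d hom sm e in auto)
    from cone_section.section_is_polynomial[OF this e(1)] obtain F :: "3 cpoly" where
      "\<And>q. affine_point q \<in> ?S \<Longrightarrow> cpoly_eval F q = g (affine_point q)" by blast
    then show ?thesis by (intro exI[of _ F]) (simp add: g_def)
  qed
  \<comment> \<open>Outside the index range F is left arbitrary; those indices do not occur in the
    sum.\<close>
  then have "\<forall>j k. \<exists>F :: 3 cpoly. k \<le> m div 3 \<and> j \<le> m - 3 * k \<longrightarrow>
     (\<forall>q. affine_point q \<in> ?S \<longrightarrow> cpoly_eval F q = C (affine_point q) j k)" by blast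
  then obtain F :: "nat \<Rightarrow> nat \<Rightarrow> 3 cpoly" where F: "\<forall>j k. k \<le> m div 3 \<and> j \<le> m - 3 * k \<longrightarrow>
     (\<forall>q. affine_point q \<in> ?S \<longrightarrow> cpoly_eval (F j k) q = C (affine_point q) j k)" by metis
  show ?thesis
  proof (intro exI[of _ F] allI impI, elim conjE)
    fix c :: "complex \<Rightarrow> complex^3"
    assume c: "holomorphic_germ c" and R0: "\<forall>\<^sub>F \<zeta> in nhds 0. cpoly_eval R (c \<zeta>) = 0"
      and Rz: "cpoly_eval (cpoly_deriv 3 R) (c 0) \<noteq> 0"
    define \<gamma> where "\<gamma> \<zeta> = affine_point (c \<zeta>)" for \<zeta>
    define v where "v = \<gamma> 0"
    define r where "r = cpoly_eval (cpoly_deriv 3 R) (c 0)"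
    have r: "r = cpoly_eval (cpoly_deriv 4 Rhat) v" "r \<noteq> 0"
      using Rz by (simp_all add: r_def v_def \<gamma>_def assms(5) cpoly_deriv_dehomogenize)
    obtain T where T: "open T" "0 \<in> T" "\<And>i. (\<lambda>\<zeta>. c \<zeta> $ i) holomorphic_on T"
      using holomorphic_germE[OF c] by blast
    have comp: "(\<lambda>\<zeta>. \<gamma> \<zeta> $ 1) = (\<lambda>\<zeta>. 1)" "(\<lambda>\<zeta>. \<gamma> \<zeta> $ 2) = (\<lambda>\<zeta>. c \<zeta> $ 1)"
      "(\<lambda>\<zeta>. \<gamma> \<zeta> $ 3) = (\<lambda>\<zeta>. c \<zeta> $ 2)" "(\<lambda>\<zeta>. \<gamma> \<zeta> $ 4) = (\<lambda>\<zeta>. c \<zeta> $ 3)"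
      by (simp_all add: \<gamma>_def)
    have germ: "holomorphic_germ \<gamma>"
    proof (rule holomorphic_germI[OF T(1,2)])
      show "(\<lambda>\<zeta>. \<gamma> \<zeta> $ i) holomorphic_on T" for i
        using exhaust_4[of i] by (elim disjE) (simp_all add: comp T(3))
    qed
    have zeros: "\<forall>\<^sub>F \<zeta> in nhds 0. \<gamma> \<zeta> \<in> ?S"
      using R0
    proof eventually_elim
      case (elim \<zeta>)
      have "\<gamma> \<zeta> $ 1 = 1" by (simp add: \<gamma>_def)
      then have "\<gamma> \<zeta> \<noteq> 0" by auto
      with elim show ?case by (simp add: proj_zeros_def \<gamma>_def assms(5) cpoly_eval_dehomogenize)
    qed
    have vS: "v \<in> ?S" unfolding v_def by (rule eventually_nhds_x_imp_x[OF zeros])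
    have evR: "\<forall>\<^sub>F \<zeta> in nhds 0. cpoly_eval Rhat (\<gamma> \<zeta>) = 0"
      using zeros by eventually_elim (simp add: proj_zeros_def)
    define \<xi> \<eta> \<omega> where "\<xi> = jet1 c 1 / r" and "\<eta> = jet1 c 2 / r"
      and "\<omega> = (jet1 c 2 * jet2 c 1 - jet1 c 1 * jet2 c 2) / r"
    have "adapted_germ Rhat v \<xi> \<eta> \<omega> \<gamma>"
      unfolding adapted_germ_def
    proof (intro conjI germ zeros)
      show "\<gamma> 0 = v" by (simp add: v_def)
      have "jet1 c 3 * r = - (cpoly_eval (cpoly_deriv 2 Rhat) v * jet1 c 1 + cpoly_eval (cpoly_deriv 3 Rhat) v * jet1 c 2)"
        using germ_jet_relations(1)[OF germ evR] r(1)
        unfolding sum_4 comp v_def[symmetric] eq_neg_iff_add_eq_0 by (simp add: algebra_simps)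
      then have "jet1 c 3 = - (cpoly_eval (cpoly_deriv 2 Rhat) v * \<xi> + cpoly_eval (cpoly_deriv 3 Rhat) v * \<eta>)"
        using r(2) by (simp add: \<xi>_def \<eta>_def field_simps)
      then show "(\<chi> i. jet1 \<gamma> i) = tangent Rhat v \<xi> \<eta>"
        using r by (simp add: vec_eq_iff forall_4 comp tangent_def \<xi>_def \<eta>_def)
      show "jet2 \<gamma> 1 = 0" unfolding comp by simp
      show "\<eta> * jet2 \<gamma> 2 - \<xi> * jet2 \<gamma> 3 = \<omega>"
        unfolding comp by (simp add: \<xi>_def \<eta>_def \<omega>_def diff_divide_distrib)
    qed
    then have "J \<gamma> = jet_sum m (C v) \<xi> \<eta> \<omega>"
      using C[OF vS] unfolding jet_coeffs_def by blast
    also have "\<dots> = (\<Sum>k\<le>m div 3. \<Sum>j\<le>m - 3 * k. cpoly_eval (F j k) (c 0) / r ^ (m - 2 * k) *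
           jet1 c 2 ^ j * jet1 c 1 ^ (m - 3 * k - j) * (jet1 c 2 * jet2 c 1 - jet1 c 1 * jet2 c 2) ^ k)"
      unfolding jet_sum_def \<xi>_def \<eta>_def \<omega>_def
    proof (intro sum.cong refl)
      fix k j assume kj: "k \<in> {..m div 3}" "j \<in> {..m - 3 * k}"
      then have "C v j k = cpoly_eval (F j k) (c 0)"
        using F vS by (simp add: v_def \<gamma>_def)
      then show "C v j k * (jet1 c 2 / r) ^ j * (jet1 c 1 / r) ^ (m - 3 * k - j) *
          ((jet1 c 2 * jet2 c 1 - jet1 c 1 * jet2 c 2) / r) ^ k =
          cpoly_eval (F j k) (c 0) / r ^ (m - 2 * k) * jet1 c 2 ^ j * jet1 c 1 ^ (m - 3 * k - j) *
          (jet1 c 2 * jet2 c 1 - jet1 c 1 * jet2 c 2) ^ k"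
        using dehomogenized_term[OF r(2)] kj by simp
    qed
    finally show "J (\<lambda>\<zeta>. affine_point (c \<zeta>)) = (\<Sum>k\<le>m div 3. \<Sum>j\<le>m - 3 * k.
           cpoly_eval (F j k) (c 0) / cpoly_eval (cpoly_deriv 3 R) (c 0) ^ (m - 2 * k) *
           jet1 c 2 ^ j * jet1 c 1 ^ (m - 3 * k - j) * (jet1 c 2 * jet2 c 1 - jet1 c 1 * jet2 c 2) ^ k)"
      unfolding r_def \<gamma>_def[abs_def] .
  qed
qed

end
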